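(* Let $q=p^r$ with $p\in\{2,3\}$, let $d\in\{-1,3\}$ with $p=2$ if $d=3$, let $a,b\in\mathbb{F}_q$ with $a\neq b$, let $c\in\mathbb{F}_q^*$, and let $m=p^ks$ with $k\ge0$ and $p\nmid s$. Then $$G_{c,d}(m)=\sum_{t\mid s}\mu\big(\tfrac st\big)H_{c,d}(p^kt),$$ where, for every $n\ge1$, $H_{c,d}(n)=|\{z\in\mathbb{F}_{q^n}:\mathrm{tr}_n(z)=0,\ \mathrm{tr}_n(z^d)=c\}|$ satisfies $$H_{c,d}(n)=\frac1{q^2}\big(N_{n,d}(-\alpha_nc)-1+\epsilon\big)$$ for any $\alpha_n\in\mathbb{F}_{q^n}$ with $\mathrm{tr}_n(\alpha_n)=1$, with $\epsilon=0$ if $d=3$ and $\epsilon=1-q$ if $d=-1$.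
   Context: $\mathrm{tr}_n$ denotes the trace $\mathbb{F}_{q^n}\to\mathbb{F}_q$, and $\mathrm{tr}=\mathrm{tr}_m$; convention $0^{-1}=0$. $G_{c,d}(m)$ is the number of $z\in\mathbb{F}_{q^m}$ of degree $m$ over $\mathbb{F}_q$ (i.e. $z$ lies in no proper subfield) with $\mathrm{tr}(z)=0$ and $\mathrm{tr}(z^d)=c$. $N_{n,d}(\beta)$ (for $\beta\in\mathbb{F}_{q^n}$) is the number of rational places of the function field $\mathbb{F}_{q^n}(x,y_a,y_b)$ defined by $y_a^q-y_a=x+a(\beta+x^d)$, $y_b^q-y_b=x+b(\beta+x^d)$. $\mu$ is the Möbius function. *)

theory Defs
  imports "HOL-Algebra.Algebra" "HOL-Algebra.Algebraic_Closure_Type" "HOL-Library.Cardinality"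
begin

text \<open>
  The field with \<open>q\<close> elements is an arbitrary finite field type \<open>'a\<close>, so \<open>q = CARD('a)\<close>. All
  its finite extensions live in the algebraic closure \<open>'a alg_closure\<close>, into which \<open>'a\<close> is
  embedded by \<open>to_ac\<close>; the extension of degree \<open>n\<close> is the set of roots of \<open>X ^ (q ^ n) - X\<close>.
\<close>

definition GF_ext :: "nat \<Rightarrow> 'a::{field, finite} alg_closure set" where
  "GF_ext n = {z. z ^ (CARD('a) ^ n) = z}"

text \<open>The trace from \<open>GF_ext n\<close> to the base field, as the sum of the conjugates.\<close>

definition tr :: "nat \<Rightarrow> 'a::{field, finite} alg_closure \<Rightarrow> 'a alg_closure" where
  "tr n z = (\<Sum>i<n. z ^ (CARD('a) ^ i))"

text \<open>\<open>z\<close> has degree \<open>m\<close> over the base field \<open>k\<close>, that is \<open>[k(z) : k] = m\<close>.\<close>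

definition has_degree :: "'a::field alg_closure \<Rightarrow> nat \<Rightarrow> bool" where
  "has_degree z m \<longleftrightarrow>
     ring.dimension ring_of_type_algebra m (range to_ac)
       (generate_field ring_of_type_algebra (insert z (range to_ac)))"

text \<open>
  In both definitions \<open>d\<close> is an integer and \<open>powi\<close> satisfies \<open>0 powi (-1) = 0\<close>.
\<close>

definition G_count :: "'a::{field, finite} \<Rightarrow> int \<Rightarrow> nat \<Rightarrow> nat" where
  "G_count c d m =
     card {z \<in> GF_ext m. has_degree z m \<and> tr m z = 0 \<and> tr m (z powi d) = to_ac c}"

definition H_count :: "'a::{field, finite} \<Rightarrow> int \<Rightarrow> nat \<Rightarrow> nat" where
  "H_count c d n = card {z \<in> GF_ext n. tr n z = 0 \<and> tr n (z powi d) = to_ac c}"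

definition moebius :: "nat \<Rightarrow> int" where
  "moebius n = (if squarefree n then (-1) ^ card (prime_factors n) else 0)"

text \<open>
  Places of a function field \<open>F\<close> with constant field \<open>K\<close>: a place is the maximal ideal \<open>P\<close> of a
  valuation ring \<open>V\<close> of \<open>F\<close> over \<open>K\<close>, and it is rational if its residue field \<open>V/P\<close> has
  dimension 1 over (the image of) \<open>K\<close>.
\<close>

definition valuation_ring_over :: "('f, 'e) ring_scheme \<Rightarrow> 'f set \<Rightarrow> 'f set \<Rightarrow> bool" where
  "valuation_ring_over F K V \<longleftrightarrow>
     subring V F \<and> K \<subset> V \<and> V \<subset> carrier F \<and>
     (\<forall>z \<in> carrier F - {\<zero>\<^bsub>F\<^esub>}. z \<in> V \<or> inv\<^bsub>F\<^esub> z \<in> V)"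

definition place_has_degree ::
  "('f, 'e) ring_scheme \<Rightarrow> 'f set \<Rightarrow> 'f set \<Rightarrow> 'f set \<Rightarrow> nat \<Rightarrow> bool" where
  "place_has_degree F K V P n \<longleftrightarrow>
     (let R = F\<lparr>carrier := V\<rparr>; L = R Quot P
      in ring.dimension L n ((\<lambda>u. P +>\<^bsub>R\<^esub> u) ` K) (carrier L))"

definition rational_places :: "('f, 'e) ring_scheme \<Rightarrow> 'f set \<Rightarrow> 'f set set" where
  "rational_places F K =
     {P. \<exists>V. valuation_ring_over F K V \<and> maximalideal P (F\<lparr>carrier := V\<rparr>) \<and>
             place_has_degree F K V P 1}"

text \<open>
  The function fields are realised inside an algebraic closure of the rational function field in
  one variable over \<open>'a alg_closure\<close>.
\<close>

type_synonym 'a fun_closure = "'a alg_closure poly fract alg_closure"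

definition const_fun :: "'a::field alg_closure \<Rightarrow> 'a fun_closure" where
  "const_fun u = to_ac (Fract [:u:] 1)"

definition x_fun :: "'a::field fun_closure" where
  "x_fun = to_ac (Fract [:0, 1:] 1)"

text \<open>
  A root \<open>y\<close> of \<open>y ^ q - y = x + a (\<beta> + x ^ d)\<close>. Two roots differ by an element of the field with
  \<open>q\<close> elements, so the field generated below does not depend on the choice of the root.
\<close>

definition y_fun :: "int \<Rightarrow> 'a::{field, finite} alg_closure \<Rightarrow> 'a \<Rightarrow> 'a fun_closure" where
  "y_fun d \<beta> a = (SOME y. y ^ CARD('a) - y =
     x_fun + const_fun (to_ac a) * (const_fun \<beta> + x_fun powi d))"

definition fun_field ::
  "'a \<Rightarrow> 'a \<Rightarrow> nat \<Rightarrow> int \<Rightarrow> 'a::{field, finite} alg_closure \<Rightarrow> 'a fun_closure ring" where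
  "fun_field a b n d \<beta> = ring_of_type_algebra\<lparr>carrier :=
     generate_field ring_of_type_algebra
       (const_fun ` GF_ext n \<union> {x_fun, y_fun d \<beta> a, y_fun d \<beta> b})\<rparr>"

definition N_places :: "'a \<Rightarrow> 'a \<Rightarrow> nat \<Rightarrow> int \<Rightarrow> 'a::{field, finite} alg_closure \<Rightarrow> nat" where
  "N_places a b n d \<beta> = card (rational_places (fun_field a b n d \<beta>) (const_fun ` GF_ext n))"

end

theory Submission
  imports Defs "HOL-Number_Theory.Residues"
begin

text \<open>
  The degree \<open>e\<close> of a point counted by \<open>H_count c d (p ^ k * s)\<close> is divisible by \<open>p ^ k\<close>, since otherwise
  \<open>tr (z ^ d)\<close> would be a multiple of \<open>p\<close>; for \<open>p \<le> 3\<close> the remaining factor \<open>p ^ k * s / e\<close> is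
  \<open>\<plusminus> 1\<close> in the field and can be absorbed into \<open>z\<close>. This gives a divisor sum, to be inverted.

  For the second formula let \<open>u = (y_a - y_b) / (a - b)\<close> and \<open>w = y_a - a u\<close>. Then \<open>w ^ q - w = x\<close> and
  \<open>u ^ q - u = \<beta> + x ^ d\<close>, so the function field is a single Artin-Schreier extension \<open>K(w, u)\<close> of the
  rational function field \<open>K(w)\<close>; for \<open>d = 3\<close> replacing \<open>u\<close> by \<open>u - w\<^sup>3\<close> makes the right-hand side a
  polynomial of degree \<open>2 q + 1\<close> in \<open>w\<close>. Rational places centred at a pole of the right-hand side whose
  order is prime to \<open>p\<close> are totally ramified, hence there is exactly one above each such pole: one (at
  infinity) for \<open>d = 3\<close>, and \<open>q\<close> (the roots of \<open>w ^ q = w\<close>) for \<open>d = -1\<close>. For \<open>d = -1\<close> there is none above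
  \<open>w = \<infinity>\<close>, because \<open>u ^ q - u = \<beta>\<close> has no solution in \<open>K\<close>. The other rational places correspond to the
  points \<open>(w0, u0)\<close> of the affine curve, and Hilbert 90 counts \<open>q\<^sup>2\<close> of these for each \<open>x\<close> with
  \<open>tr x = 0\<close> and \<open>tr (\<beta> + x ^ d) = 0\<close>.

  Uniqueness of a place with a given centre is shown by writing every element of the field as
  \<open>c \<pi> ^ k (1 + \<dots>)\<close> with a uniformiser \<open>\<pi>\<close>, where \<open>k\<close> and \<open>c\<close> do not depend on the place; existence follows from
  Chevalley's extension theorem.
\<close>

section \<open>Valuation rings\<close>

text \<open>A place is defined through an arbitrary valuation ring: neither discreteness nor a
  uniformiser is given, and the degree of the extension is not known beforehand. Two consequences
  shape the argument. Expansions are made for a set of valuation rings at once, in powers of a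
  \<open>\<pi>\<close> only known to lie in every maximal ideal; once all nonzero elements have one,
  uniqueness and the residue field follow together. Irreducibility of the Artin-Schreier equation is
  replaced by independence of \<open>1, u, ..., u^(q-1)\<close> over polynomials in
  \<open>w\<close>, read off at one ramified place, where the monomials have distinct orders; it
  makes every affine point a specialisation, so that Chevalley's theorem applies. At an unramified
  point powers of \<open>w - w0\<close> are split off one by one, and this stops because the
  valuation rings of the whole closure with such a centre have rank one. These auxiliary rings
  contain all constants of the algebraic closure, while places are counted over a finite field. For
  \<open>d = 3\<close> the substitution is needed because the right-hand side has degree
  \<open>3 q\<close> in \<open>w\<close>, a multiple of \<open>p = 2\<close>.\<close>

definition is_subring :: "'b::comm_ring_1 set \<Rightarrow> bool" where
  "is_subring B \<longleftrightarrow> 1 \<in> B \<and> (\<forall>x\<in>B. \<forall>y\<in>B. x - y \<in> B \<and> x * y \<in> B)"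

definition is_subfield :: "'b::field set \<Rightarrow> bool" where
  "is_subfield C \<longleftrightarrow> is_subring C \<and> (\<forall>x\<in>C. inverse x \<in> C)"

definition is_valring :: "'b::field set \<Rightarrow> 'b set \<Rightarrow> bool" where
  "is_valring F V \<longleftrightarrow> is_subring V \<and> V \<subseteq> F \<and> (\<forall>z\<in>F. z \<in> V \<or> inverse z \<in> V)"

text \<open>The maximal ideal of a valuation ring. Zero is listed separately because
  \<open>inverse 0 = 0\<close> lies in \<open>V\<close>.\<close>

definition nonunits :: "'b::field set \<Rightarrow> 'b set" where
  "nonunits V = {z \<in> V. z = 0 \<or> inverse z \<notin> V}"

lemma is_subringD:
  assumes "is_subring B"
  shows "1 \<in> B" "0 \<in> B" "x \<in> B \<Longrightarrow> y \<in> B \<Longrightarrow> x - y \<in> B" "x \<in> B \<Longrightarrow> y \<in> B \<Longrightarrow> x * y \<in> B"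
    "x \<in> B \<Longrightarrow> - x \<in> B" "x \<in> B \<Longrightarrow> y \<in> B \<Longrightarrow> x + y \<in> B" "x \<in> B \<Longrightarrow> x ^ n \<in> B"
proof -
  show one: "1 \<in> B" and diff: "x \<in> B \<Longrightarrow> y \<in> B \<Longrightarrow> x - y \<in> B"
    and mult: "x \<in> B \<Longrightarrow> y \<in> B \<Longrightarrow> x * y \<in> B" for x y
    using assms by (auto simp: is_subring_def)
  show zero: "0 \<in> B" using diff[OF one one] by simp
  show um: "x \<in> B \<Longrightarrow> - x \<in> B" for x using diff[OF zero, of x] by simp
  show "x \<in> B \<Longrightarrow> y \<in> B \<Longrightarrow> x + y \<in> B" using diff[OF _ um, of x y] by simp
  show "x \<in> B \<Longrightarrow> x ^ n \<in> B" by (induction n) (auto intro: one mult)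
qed

lemma is_subfieldD:
  assumes "is_subfield C"
  shows "1 \<in> C" "0 \<in> C" "x \<in> C \<Longrightarrow> y \<in> C \<Longrightarrow> x - y \<in> C" "x \<in> C \<Longrightarrow> y \<in> C \<Longrightarrow> x * y \<in> C"
    "x \<in> C \<Longrightarrow> - x \<in> C" "x \<in> C \<Longrightarrow> y \<in> C \<Longrightarrow> x + y \<in> C" "x \<in> C \<Longrightarrow> x ^ n \<in> C"
    "x \<in> C \<Longrightarrow> inverse x \<in> C" "x \<in> C \<Longrightarrow> y \<in> C \<Longrightarrow> x / y \<in> C" "x \<in> C \<Longrightarrow> x powi k \<in> C"
    "is_subring C"
  using assms unfolding is_subfield_def
  by (auto intro: is_subringD simp: divide_inverse power_int_def)

lemma is_subfield_UNIV: "is_subfield UNIV"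
  by (simp add: is_subfield_def is_subring_def)

lemma is_valringD:
  assumes "is_valring F V"
  shows "is_subring V" "V \<subseteq> F" "x \<in> V \<Longrightarrow> x \<in> F" "z \<in> F \<Longrightarrow> z \<in> V \<or> inverse z \<in> V"
  using assms by (auto simp: is_valring_def)

lemmas is_valring_subringD = is_subringD[OF is_valringD(1)]

text \<open>Valuation rings are constructed in the whole ambient field and then cut down to the
  function field; their maximal ideals restrict accordingly.\<close>

lemma is_valring_Int:
  assumes V: "is_valring E V" and F: "is_subfield F" "F \<subseteq> E"
  shows "is_valring F (V \<inter> F)" "nonunits (V \<inter> F) = nonunits V \<inter> F"
  using assms by (auto simp: is_valring_def is_subring_def is_subfield_def nonunits_def)

lemma nonunits_subset: "nonunits V \<subseteq> V"
  by (auto simp: nonunits_def)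

lemma zero_in_nonunits: "is_valring F V \<Longrightarrow> 0 \<in> nonunits V"
  by (auto simp: nonunits_def intro: is_valring_subringD)

lemma one_notin_nonunits: "is_valring F V \<Longrightarrow> 1 \<notin> nonunits V"
  by (auto simp: nonunits_def intro: is_valring_subringD)

lemma inverse_in_nonunits:
  assumes "is_valring F V" "z \<in> F" "z \<notin> V"
  shows "inverse z \<in> nonunits V"
  using assms by (auto simp: nonunits_def dest: is_valringD)

lemma nonunits_mult:
  assumes V: "is_valring F V" and x: "x \<in> nonunits V" and y: "y \<in> V"
  shows "x * y \<in> nonunits V" "y * x \<in> nonunits V"
proof -
  show "x * y \<in> nonunits V"
  proof (cases "x * y = 0")
    case True
    then show ?thesis using zero_in_nonunits[OF V] by metis
  next
    case False
    have "inverse (x * y) \<notin> V"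
    proof
      assume "inverse (x * y) \<in> V"
      then have "inverse (x * y) * y \<in> V" using y is_valring_subringD(4)[OF V] by blast
      then have "inverse x \<in> V" using False by (simp add: mult.assoc)
      then show False using x False by (simp add: nonunits_def)
    qed
    then show ?thesis using x y is_valring_subringD(4)[OF V] by (auto simp: nonunits_def)
  qed
  then show "y * x \<in> nonunits V" by (simp add: mult.commute)
qed

lemma nonunits_uminus:
  assumes "is_valring F V" "x \<in> nonunits V"
  shows "- x \<in> nonunits V"
  using nonunits_mult(1)[OF assms, of "-1"] is_valring_subringD[OF assms(1)] by simp

text \<open>One of \<open>x / y\<close> and \<open>y / x\<close> lies in \<open>V\<close>, so the
  sum is a multiple of \<open>y\<close> or of \<open>x\<close> by an element of
  \<open>V\<close>.\<close>

lemma nonunits_add: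
  assumes V: "is_valring F V" and F: "is_subfield F" and x: "x \<in> nonunits V" and y: "y \<in> nonunits V"
  shows "x + y \<in> nonunits V"
proof (cases "x = 0 \<or> y = 0")
  case True
  then show ?thesis using x y by auto
next
  case False
  have "x / y \<in> F"
    using x y nonunits_subset is_valringD(3)[OF V] is_subfieldD(9)[OF F] by blast
  then consider "x / y \<in> V" | "y / x \<in> V"
    using is_valringD(4)[OF V] by (metis inverse_divide)
  then show ?thesis
  proof cases
    case 1
    have "y * (x / y + 1) \<in> nonunits V"
      using 1 by (intro nonunits_mult[OF V y] is_valring_subringD[OF V])
    then show ?thesis using False by (simp add: distrib_left)
  next
    case 2
    have "x * (1 + y / x) \<in> nonunits V"
      using 2 by (intro nonunits_mult[OF V x] is_valring_subringD[OF V])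
    then show ?thesis using False by (simp add: distrib_left)
  qed
qed

lemma nonunits_diff:
  assumes "is_valring F V" "is_subfield F" "x \<in> nonunits V" "y \<in> nonunits V"
  shows "x - y \<in> nonunits V"
  using nonunits_add[OF assms(1-3) nonunits_uminus[OF assms(1,4)]] by simp

lemma nonunits_power:
  assumes V: "is_valring F V" and x: "x \<in> nonunits V" and n: "n > 0"
  shows "x ^ n \<in> nonunits V"
proof -
  have "x ^ (n - 1) \<in> V"
    using x nonunits_subset by (blast intro: is_valring_subringD[OF V])
  then have "x * x ^ (n - 1) \<in> nonunits V" by (rule nonunits_mult[OF V x])
  then show ?thesis using n by (cases n) auto
qed

lemma nonunits_powerD:
  assumes V: "is_valring F V" and z: "z \<in> F" and zn: "z ^ n \<in> nonunits V"
  shows "z \<in> nonunits V"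
proof (rule ccontr)
  assume nz: "z \<notin> nonunits V"
  then have "inverse z \<in> V" "z \<noteq> 0"
    using is_valringD(4)[OF V z] zero_in_nonunits[OF V] by (auto simp: nonunits_def)
  then have "inverse z ^ n \<in> V" by (intro is_valring_subringD(7)[OF V])
  then have "z ^ n * inverse z ^ n \<in> nonunits V" using nonunits_mult[OF V zn] by blast
  then show False using \<open>z \<noteq> 0\<close> one_notin_nonunits[OF V] by (simp add: power_inverse)
qed

lemma unit_notin_nonunits:
  assumes V: "is_valring F V" and C: "is_subfield C" "C \<subseteq> V" and c: "c \<in> C" "c \<noteq> 0"
  shows "c \<notin> nonunits V"
  using c is_subfieldD(8)[OF C(1)] C(2) by (auto simp: nonunits_def)

text \<open>Integral closedness for one equation: if \<open>z\<close> had a pole, multiplication by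
  \<open>inverse z ^ n\<close> would leave \<open>1\<close> from the leading term and nonunits from
  everything else.\<close>

lemma val_integral:
  assumes V: "is_valring F V" and F: "is_subfield F" and z: "z \<in> F" and n: "n \<ge> 2"
    and v: "z ^ n - z \<in> V"
  shows "z \<in> V"
proof (rule ccontr)
  assume zV: "z \<notin> V"
  have iz: "inverse z \<in> nonunits V" using inverse_in_nonunits[OF V z zV] .
  have z0: "z \<noteq> 0" using zV is_valring_subringD(2)[OF V] by auto
  have "inverse z ^ n * (z ^ n - z) \<in> nonunits V"
    using n by (intro nonunits_mult[OF V] nonunits_power[OF V iz] v) auto
  moreover have "inverse z ^ n * (z ^ n - z) = 1 - inverse z ^ (n - 1)"
    using z0 n by (cases n) (auto simp: field_simps)
  moreover have "inverse z ^ (n - 1) \<in> nonunits V"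
    using n by (intro nonunits_power[OF V iz]) auto
  ultimately have "1 - inverse z ^ (n - 1) + inverse z ^ (n - 1) \<in> nonunits V"
    using nonunits_add[OF V F] by metis
  then show False using one_notin_nonunits[OF V] by simp
qed

section \<open>Leading terms with respect to a common parameter\<close>

text \<open>Of \<open>\<pi>\<close> only a nonzero nonunit of every member is required; that it
  behaves like a uniformiser has to be proved by expanding the elements of \<open>F\<close>. In the
  applications \<open>\<V>\<close> consists either of all valuation rings with a given centre or of
  one auxiliary ring.\<close>

locale valuation_class =
  fixes C F :: "'b::field set" and \<V> :: "'b set set" and \<pi> :: 'b
  assumes C: "is_subfield C" and F: "is_subfield F" and CF: "C \<subseteq> F"
    and V: "\<And>V. V \<in> \<V> \<Longrightarrow> is_valring F V" and CV: "\<And>V. V \<in> \<V> \<Longrightarrow> C \<subseteq> V"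
    and pi: "\<And>V. V \<in> \<V> \<Longrightarrow> \<pi> \<in> nonunits V" and pi0: "\<pi> \<noteq> 0" and piF: "\<pi> \<in> F"
begin

text \<open>Read \<open>asym z k c\<close> as \<open>z \<sim> c \<pi> ^ k\<close>, simultaneously for all valuation rings in \<open>\<V>\<close>.\<close>

definition asym :: "'b \<Rightarrow> int \<Rightarrow> 'b \<Rightarrow> bool" where
  "asym z k c \<longleftrightarrow> c \<in> C \<and> c \<noteq> 0 \<and> z \<in> F \<and> (\<forall>V\<in>\<V>. z * \<pi> powi (- k) - c \<in> nonunits V)"

lemma asym_in_V:
  assumes "asym z k c" "V \<in> \<V>"
  shows "z * \<pi> powi (- k) \<in> V" "z * \<pi> powi (- k) \<notin> nonunits V" "inverse (z * \<pi> powi (- k)) \<in> V"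
proof -
  note v = V[OF assms(2)] and cv = CV[OF assms(2)]
  have n: "z * \<pi> powi (- k) - c \<in> nonunits V" and c: "c \<in> C" "c \<noteq> 0" and z: "z \<in> F"
    using assms by (auto simp: asym_def)
  have "(z * \<pi> powi (- k) - c) + c \<in> V"
    using n c cv nonunits_subset by (blast intro: is_valring_subringD[OF v])
  then show 1: "z * \<pi> powi (- k) \<in> V" by simp
  show 2: "z * \<pi> powi (- k) \<notin> nonunits V"
  proof
    assume "z * \<pi> powi (- k) \<in> nonunits V"
    then have "z * \<pi> powi (- k) - (z * \<pi> powi (- k) - c) \<in> nonunits V"
      using n by (rule nonunits_diff[OF v F])
    then show False using unit_notin_nonunits[OF v C cv c] by simp
  qed
  show "inverse (z * \<pi> powi (- k)) \<in> V"
    using 1 2 by (auto simp: nonunits_def)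
qed

lemma asym_const: "c \<in> C \<Longrightarrow> c \<noteq> 0 \<Longrightarrow> asym c 0 c"
  using CF V by (auto simp: asym_def intro: zero_in_nonunits)

lemma asym_pi: "asym \<pi> 1 1"
  using piF pi0 V is_subfieldD[OF C] by (auto simp: asym_def intro: zero_in_nonunits)

lemma asym_perturb:
  assumes "c \<in> C" "c \<noteq> 0" "z \<in> F" "\<And>V. V \<in> \<V> \<Longrightarrow> z - c \<in> nonunits V"
  shows "asym z 0 c"
  using assms by (auto simp: asym_def)

lemma asym_mult:
  assumes z: "asym z k c" and z': "asym z' k' c'"
  shows "asym (z * z') (k + k') (c * c')"
  unfolding asym_def
proof (intro conjI ballI)
  show "c * c' \<in> C" "c * c' \<noteq> 0" "z * z' \<in> F"
    using z z' by (auto simp: asym_def intro: is_subfieldD[OF C] is_subfieldD[OF F])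
  fix W assume W: "W \<in> \<V>"
  note v = V[OF W]
  have "(z * \<pi> powi (- k) - c) * (z' * \<pi> powi (- k')) + (z' * \<pi> powi (- k') - c') * c \<in> nonunits W"
    using z z' W CV[OF W] asym_in_V[OF z' W]
    by (intro nonunits_add[OF v F] nonunits_mult[OF v]) (auto simp: asym_def)
  moreover have "\<pi> powi (- (k + k')) = \<pi> powi (- k) * \<pi> powi (- k')"
    using pi0 by (simp flip: power_int_add)
  ultimately show "z * z' * \<pi> powi (- (k + k')) - c * c' \<in> nonunits W"
    by (simp add: algebra_simps)
qed

lemma asym_inverse:
  assumes z: "asym z k c"
  shows "asym (inverse z) (- k) (inverse c)"
  unfolding asym_def
proof (intro conjI ballI)
  show "inverse c \<in> C" "inverse c \<noteq> 0" "inverse z \<in> F"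
    using z by (auto simp: asym_def intro: is_subfieldD[OF C] is_subfieldD[OF F])
  fix W assume W: "W \<in> \<V>"
  note v = V[OF W]
  define a where "a = z * \<pi> powi (- k)"
  have a: "a - c \<in> nonunits W" "inverse a \<in> W" "a \<noteq> 0"
    using z W asym_in_V[OF z W] zero_in_nonunits[OF v] unfolding a_def asym_def by (blast, blast, metis)
  have c: "c \<noteq> 0" "inverse c \<in> W"
    using z CV[OF W] is_subfieldD[OF C] by (auto simp: asym_def)
  have "(a - c) * (- (inverse a * inverse c)) \<in> nonunits W"
    using a c by (intro nonunits_mult[OF v] is_valring_subringD[OF v])
  also have "(a - c) * (- (inverse a * inverse c)) = inverse a - inverse c"
    using a c by (simp add: field_simps)
  also have "inverse a = inverse z * \<pi> powi (- (- k))"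
    by (simp add: a_def power_int_minus)
  finally show "inverse z * \<pi> powi (- (- k)) - inverse c \<in> nonunits W" .
qed

lemma asym_divide: "asym z k c \<Longrightarrow> asym z' k' c' \<Longrightarrow> asym (z / z') (k - k') (c / c')"
  using asym_mult[OF _ asym_inverse] by (simp add: divide_inverse)

lemma asym_power: "asym z k c \<Longrightarrow> asym (z ^ n) (int n * k) (c ^ n)"
proof (induction n)
  case 0
  then show ?case using asym_const[of 1] is_subfieldD[OF C] by simp
next
  case (Suc n)
  then show ?case using asym_mult[of z k c "z ^ n" "int n * k" "c ^ n"] by (simp add: algebra_simps)
qed

text \<open>Divided by \<open>\<pi> ^ k\<close>, the summand of higher order is a unit times a
  positive power of \<open>\<pi>\<close>, hence a nonunit.\<close>

lemma asym_add_less: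
  assumes z: "asym z k c" and z': "asym z' k' c'" and less: "k < k'"
  shows "asym (z + z') k c"
  unfolding asym_def
proof (intro conjI ballI)
  show "c \<in> C" "c \<noteq> 0" "z + z' \<in> F"
    using z z' by (auto simp: asym_def intro: is_subfieldD[OF F])
  fix W assume W: "W \<in> \<V>"
  note v = V[OF W]
  have "\<pi> ^ nat (k' - k) * (z' * \<pi> powi (- k')) \<in> nonunits W"
    using less by (intro nonunits_mult[OF v] nonunits_power[OF v] pi W asym_in_V[OF z' W]) auto
  moreover have "\<pi> ^ nat (k' - k) * \<pi> powi (- k') = \<pi> powi (- k)"
    using pi0 less power_int_add[of \<pi> "k' - k" "- k'"] by (simp add: power_int_def)
  ultimately have "z' * \<pi> powi (- k) \<in> nonunits W"
    by (simp add: mult.left_commute)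
  then have "(z * \<pi> powi (- k) - c) + z' * \<pi> powi (- k) \<in> nonunits W"
    using z W by (intro nonunits_add[OF v F]) (auto simp: asym_def)
  then show "(z + z') * \<pi> powi (- k) - c \<in> nonunits W"
    by (simp add: algebra_simps)
qed

text \<open>With pairwise distinct exponents the term of least exponent dominates the sum, so the
  leading terms cannot cancel.\<close>

lemma asym_sum:
  assumes "finite I" "I \<noteq> {}" "\<And>i. i \<in> I \<Longrightarrow> asym (f i) (\<kappa> i) (\<gamma> i)" "inj_on \<kappa> I"
  shows "\<exists>i\<in>I. asym (sum f I) (\<kappa> i) (\<gamma> i)"
  using assms
proof (induction I rule: finite_ne_induct)
  case (insert x I)
  then obtain i where i: "i \<in> I" "asym (sum f I) (\<kappa> i) (\<gamma> i)" by (auto simp: inj_on_def)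
  have x: "asym (f x) (\<kappa> x) (\<gamma> x)" using insert by blast
  have "\<kappa> x \<noteq> \<kappa> i" using insert.prems(2) i(1) insert.hyps by (auto simp: inj_on_def)
  then consider "\<kappa> x < \<kappa> i" | "\<kappa> i < \<kappa> x" by linarith
  then show ?case
  proof cases
    case 1
    then show ?thesis using asym_add_less[OF x i(2)] insert.hyps by auto
  next
    case 2
    then have "asym (sum f I + f x) (\<kappa> i) (\<gamma> i)" using asym_add_less[OF i(2) x] by blast
    then show ?thesis using insert.hyps i(1) by (auto simp: add.commute)
  qed
qed auto

lemma asym_nonzero:
  assumes "asym z k c" "\<V> \<noteq> {}"
  shows "z \<noteq> 0"
  using asym_in_V(2)[OF assms(1)] zero_in_nonunits[OF V] assms(2) by force

text \<open>Membership is decided by the sign of \<open>k\<close>, which is the same for all members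
  of \<open>\<V>\<close>. This is what makes a member unique.\<close>

lemma asym_mem_iff:
  assumes z: "asym z k c" and W: "W \<in> \<V>"
  shows "z \<in> W \<longleftrightarrow> k \<ge> 0"
proof
  note v = V[OF W]
  show "z \<in> W" if "k \<ge> 0"
  proof -
    have "z * \<pi> powi (- k) * \<pi> ^ nat k \<in> W"
      using asym_in_V[OF z W] pi[OF W] nonunits_subset by (blast intro: is_valring_subringD[OF v])
    moreover have "\<pi> powi (- k) * \<pi> ^ nat k = 1"
      using pi0 that power_int_add[of \<pi> "- k" k] by (simp add: power_int_def)
    ultimately show ?thesis by (simp add: mult.assoc)
  qed
  show "k \<ge> 0" if "z \<in> W"
  proof (rule ccontr)
    assume "\<not> k \<ge> 0"
    then have "\<pi> ^ nat (- k) * z \<in> nonunits W"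
      using that by (intro nonunits_mult[OF v] nonunits_power[OF v] pi W) auto
    then show False using asym_in_V(2)[OF z W] \<open>\<not> k \<ge> 0\<close>
      by (simp add: power_int_def mult.commute)
  qed
qed

lemma asym_residue:
  assumes z: "asym z k c" and W: "W \<in> \<V>" and zW: "z \<in> W"
  shows "\<exists>c\<in>C. z - c \<in> nonunits W"
proof (cases "k = 0")
  case True
  then show ?thesis using z W by (auto simp: asym_def)
next
  case False
  then have "k > 0" using asym_mem_iff[OF z W] zW by simp
  then have "\<pi> ^ nat k * (z * \<pi> powi (- k)) \<in> nonunits W"
    by (intro nonunits_mult[OF V[OF W]] nonunits_power[OF V[OF W]] pi W asym_in_V[OF z W]) auto
  also have "\<pi> ^ nat k * (z * \<pi> powi (- k)) = z"
    using pi0 \<open>k > 0\<close> by (simp add: power_int_minus power_int_def field_simps)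
  finally have "z - 0 \<in> nonunits W" by simp
  then show ?thesis using is_subfieldD(2)[OF C] by blast
qed

lemma valring_unique:
  assumes all: "\<And>z. z \<in> F \<Longrightarrow> z = 0 \<or> (\<exists>k c. asym z k c)" and W: "W \<in> \<V>" "W' \<in> \<V>"
  shows "W = W'"
proof -
  have "z \<in> W \<longleftrightarrow> z \<in> W'" if "z \<in> F" for z
    using all[OF that] asym_mem_iff W is_valring_subringD(2)[OF V] by metis
  moreover have "W \<subseteq> F" "W' \<subseteq> F" using is_valringD(2)[OF V] W by blast+
  ultimately show ?thesis by blast
qed

lemma valring_residue:
  assumes all: "\<And>z. z \<in> F \<Longrightarrow> z = 0 \<or> (\<exists>k c. asym z k c)" and W: "W \<in> \<V>" and z: "z \<in> W"
  shows "\<exists>c\<in>C. z - c \<in> nonunits W"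
  using all[OF is_valringD(3)[OF V[OF W] z]] asym_residue[OF _ W z]
    zero_in_nonunits[OF V[OF W]] is_subfieldD(2)[OF C] by (metis diff_zero)

end

section \<open>Chevalley's extension theorem\<close>

text \<open>\<open>B\<close> is an arbitrary set, so that the predicate serves for subrings and also
  for the ideals in Chevalley's argument.\<close>

definition coeffs_in :: "'b::zero set \<Rightarrow> 'b poly \<Rightarrow> bool" where
  "coeffs_in B p \<longleftrightarrow> (\<forall>i. Polynomial.coeff p i \<in> B)"

lemma coeffs_in_ideal_mult:
  assumes J0: "0 \<in> J" and Jadd: "\<And>x y. x \<in> J \<Longrightarrow> y \<in> J \<Longrightarrow> x + y \<in> J"
    and Jmult: "\<And>b x. b \<in> B \<Longrightarrow> x \<in> J \<Longrightarrow> b * x \<in> J"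
    and p: "coeffs_in B p" and q: "coeffs_in J (q :: 'b::comm_ring_1 poly)"
  shows "coeffs_in J (p * q)"
proof -
  have sum: "sum f I \<in> J" if "\<And>i. f i \<in> J" for f :: "nat \<Rightarrow> 'b" and I
    by (induction I rule: infinite_finite_induct) (auto intro: J0 Jadd that)
  have "(\<Sum>i\<le>n. Polynomial.coeff p i * Polynomial.coeff q (n - i)) \<in> J" for n
    using p q by (intro sum Jmult) (auto simp: coeffs_in_def)
  then show ?thesis by (simp add: coeffs_in_def coeff_mult)
qed

context
  fixes B :: "'b::comm_ring_1 set"
  assumes B: "is_subring B"
begin

lemma coeffs_in_0: "coeffs_in B 0"
  using is_subringD(2)[OF B] by (simp add: coeffs_in_def)

lemma coeffs_in_pCons_iff: "coeffs_in B (pCons a p) \<longleftrightarrow> a \<in> B \<and> coeffs_in B p"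
  unfolding coeffs_in_def by (metis coeff_pCons_0 coeff_pCons_Suc not0_implies_Suc)

lemma coeffs_in_const: "coeffs_in B [:a:] \<longleftrightarrow> a \<in> B"
  by (simp add: coeffs_in_pCons_iff coeffs_in_0)

lemma coeffs_in_1: "coeffs_in B 1"
  using coeffs_in_const[of 1] is_subringD(1)[OF B] by (simp add: one_pCons)

lemma coeffs_in_add: "coeffs_in B p \<Longrightarrow> coeffs_in B q \<Longrightarrow> coeffs_in B (p + q)"
  using is_subringD(6)[OF B] by (simp add: coeffs_in_def)

lemma coeffs_in_diff: "coeffs_in B p \<Longrightarrow> coeffs_in B q \<Longrightarrow> coeffs_in B (p - q)"
  using is_subringD(3)[OF B] by (simp add: coeffs_in_def)

lemma coeffs_in_uminus: "coeffs_in B p \<Longrightarrow> coeffs_in B (- p)"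
  using is_subringD(5)[OF B] by (simp add: coeffs_in_def)

lemma coeffs_in_mult: "coeffs_in B p \<Longrightarrow> coeffs_in B q \<Longrightarrow> coeffs_in B (p * q)"
  by (rule coeffs_in_ideal_mult) (auto intro: is_subringD[OF B])

lemma coeffs_in_power: "coeffs_in B p \<Longrightarrow> coeffs_in B (p ^ n)"
  by (induction n) (auto intro: coeffs_in_1 coeffs_in_mult)

lemma coeffs_in_monom: "a \<in> B \<Longrightarrow> coeffs_in B (Polynomial.monom a n)"
  using is_subringD(2)[OF B] by (simp add: coeffs_in_def)

lemma coeffs_in_pcompose: "coeffs_in B p \<Longrightarrow> coeffs_in B q \<Longrightarrow> coeffs_in B (pcompose p q)"
proof (induction p)
  case 0
  then show ?case by (simp add: coeffs_in_0)
next
  case (pCons a p)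
  then show ?case
    by (auto simp: pcompose_pCons coeffs_in_pCons_iff coeffs_in_const
        intro!: coeffs_in_add coeffs_in_mult coeffs_in_0)
qed

lemma coeffs_in_is_subring: "is_subring {p. coeffs_in B p}"
  by (auto simp: is_subring_def intro: coeffs_in_1 coeffs_in_diff coeffs_in_mult)

lemma poly_in_subring:
  assumes V: "is_subring V" "B \<subseteq> V" "x \<in> V"
  shows "coeffs_in B p \<Longrightarrow> poly p x \<in> V"
  by (induction p)
    (use assms in \<open>auto simp: coeffs_in_pCons_iff intro!: is_subringD(2,4,6)[OF V(1)]\<close>)

end

text \<open>The candidates for Zorn's lemma: a subring \<open>B\<close> with a proper ideal
  \<open>J\<close>, extending \<open>A\<close> and \<open>I\<close>. Primeness of \<open>J\<close>
  is not demanded; maximality of the pair does the work.\<close>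

definition chevalley_pair :: "'b::field set \<Rightarrow> 'b set \<Rightarrow> 'b set \<Rightarrow> 'b set \<Rightarrow> bool" where
  "chevalley_pair A I B J \<longleftrightarrow> is_subring B \<and> A \<subseteq> B \<and> I \<subseteq> J \<and> J \<subseteq> B \<and> 0 \<in> J \<and>
     (\<forall>x\<in>J. \<forall>y\<in>J. x + y \<in> J) \<and> (\<forall>b\<in>B. \<forall>x\<in>J. b * x \<in> J) \<and> 1 \<notin> J"

text \<open>Eliminates the leading coefficient of the longer relation by means of the shorter one.\<close>

lemma chevalley_reduce:
  fixes A I B J :: "'b::field set"
  assumes BJ: "chevalley_pair A I B J" and z: "z \<noteq> 0"
    and p: "coeffs_in J p" "poly p z = 1" and q: "coeffs_in J q" "poly q (inverse z) = 1"
    and le: "Polynomial.degree q \<le> Polynomial.degree p"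
  shows "\<exists>p'. coeffs_in J p' \<and> poly p' z = 1 \<and> Polynomial.degree p' < Polynomial.degree p"
proof -
  have B: "is_subring B" and JB: "J \<subseteq> B" and J0: "0 \<in> J" and J1: "1 \<notin> J"
    and Jadd: "\<And>x y. x \<in> J \<Longrightarrow> y \<in> J \<Longrightarrow> x + y \<in> J" and Jmult: "\<And>b x. b \<in> B \<Longrightarrow> x \<in> J \<Longrightarrow> b * x \<in> J"
    using BJ by (auto simp: chevalley_pair_def)
  define n m where "n = Polynomial.degree p" and "m = Polynomial.degree q"
  define a b where "a = Polynomial.coeff p" and "b = Polynomial.coeff q"
  have aJ: "a i \<in> J" and bJ: "b i \<in> J" for i
    using p q by (auto simp: a_def b_def coeffs_in_def)
  have n0: "n > 0"
  proof (rule ccontr)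
    assume "\<not> n > 0"
    then have "poly p z = a 0" by (simp add: poly_altdef n_def a_def)
    then show False using p aJ[of 0] J1 by simp
  qed
  \<comment> \<open>Write \<open>1\<close> as the sum of \<open>a i * z ^ i\<close> and as the sum
    of \<open>b j * inverse z ^ j\<close>. The second relation times \<open>a n * z ^ n\<close>
    expresses \<open>(1 - b 0) * a n * z ^ n\<close> through powers below \<open>n\<close>.
    Substituting this into \<open>1 - b 0\<close> times the first relation and adding
    \<open>b 0\<close> gives \<open>p'\<close>.\<close>
  define p' where "p' = [:b 0:] + (\<Sum>i<n. Polynomial.monom ((1 - b 0) * a i) i)
    + (\<Sum>j=1..m. Polynomial.monom (b j * a n) (n - j))"
  have sum: "coeffs_in J (sum f I)" if "\<And>i. coeffs_in J (f i)" for f :: "nat \<Rightarrow> 'b poly" and I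
    using that
    by (induction I rule: infinite_finite_induct) (auto simp: coeffs_in_def intro: J0 Jadd)
  have "(1 - b 0) * a i \<in> J" "b j * a i \<in> J" for i j
    using JB bJ is_subringD[OF B] by (blast intro: Jmult aJ)+
  then have "coeffs_in J p'"
    unfolding p'_def using bJ[of 0]
    by (auto simp: coeffs_in_def coeff_pCons intro!: Jadd sum[unfolded coeffs_in_def, rule_format] J0
        split: nat.splits)
  moreover have "Polynomial.degree p' < Polynomial.degree p"
  proof -
    have "Polynomial.degree p' \<le> n - 1"
      unfolding p'_def using n0
      by (intro degree_add_le degree_sum_le) (auto intro!: order.trans[OF degree_monom_le])
    then show ?thesis using n0 by (simp add: n_def)
  qed
  moreover have "poly p' z = 1"
  proof -
    have pa: "(\<Sum>i<n. a i * z ^ i) = 1 - a n * z ^ n"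
      using p(2) n0 by (simp add: poly_altdef n_def[symmetric] a_def[symmetric] eq_diff_eq flip: lessThan_Suc_atMost)
    have "(\<Sum>j\<le>m. b j * inverse z ^ j) = 1"
      using q(2) by (simp add: poly_altdef m_def[symmetric] b_def[symmetric])
    moreover have "{..m} = insert 0 {1..m}" by auto
    ultimately have qb: "(\<Sum>j=1..m. b j * inverse z ^ j) = 1 - b 0"
      by (simp add: algebra_simps)
    have "(\<Sum>j=1..m. b j * a n * z ^ (n - j)) = a n * z ^ n * (\<Sum>j=1..m. b j * inverse z ^ j)"
      unfolding sum_distrib_left
    proof (rule sum.cong)
      fix j assume "j \<in> {1..m}"
      then have "z ^ n = z ^ (n - j) * z ^ j"
        using le by (simp add: n_def m_def flip: power_add)
      then show "b j * a n * z ^ (n - j) = a n * z ^ n * (b j * inverse z ^ j)"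
        using z by (simp add: power_inverse)
    qed simp
    then have 1: "(\<Sum>j=1..m. b j * a n * z ^ (n - j)) = a n * z ^ n * (1 - b 0)"
      by (simp only: qb)
    have 2: "(\<Sum>i<n. (1 - b 0) * a i * z ^ i) = (1 - b 0) * (1 - a n * z ^ n)"
      by (simp add: pa[symmetric] sum_distrib_left mult.assoc)
    show ?thesis
      unfolding p'_def poly_add poly_sum poly_monom 1 2 by (simp add: algebra_simps)
  qed
  ultimately show ?thesis by blast
qed

text \<open>The new pair is \<open>B[z]\<close> with the ideal that \<open>J\<close> generates in
  it. The only property that can fail is properness, and its failure is a relation
  \<open>poly p z = 1\<close> over \<open>J\<close>.\<close>

lemma chevalley_pair_adjoin:
  assumes BJ: "chevalley_pair A I B J"
    and no: "\<And>p. coeffs_in J p \<Longrightarrow> poly p z \<noteq> 1"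
  shows "chevalley_pair B J ((\<lambda>p. poly p z) ` {p. coeffs_in B p}) ((\<lambda>p. poly p z) ` {p. coeffs_in J p})"
    (is "chevalley_pair B J ?B ?J")
proof -
  have B: "is_subring B" and JB: "J \<subseteq> B" and J0: "0 \<in> J"
    and Jadd: "\<And>x y. x \<in> J \<Longrightarrow> y \<in> J \<Longrightarrow> x + y \<in> J" and Jmult: "\<And>b x. b \<in> B \<Longrightarrow> x \<in> J \<Longrightarrow> b * x \<in> J"
    using BJ by (auto simp: chevalley_pair_def)
  have cJ: "coeffs_in J [:a:]" if "a \<in> J" for a
    using that J0 by (auto simp: coeffs_in_def coeff_pCons split: nat.splits)
  show ?thesis
    unfolding chevalley_pair_def
  proof (intro conjI ballI)
    have 1: "poly p z - poly q z = poly (p - q) z" "poly p z * poly q z = poly (p * q) z" for p q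
      by simp_all
    show "is_subring ?B"
      unfolding is_subring_def
      using coeffs_in_1[OF B] coeffs_in_diff[OF B] coeffs_in_mult[OF B]
      by (auto simp: image_iff simp del: poly_diff poly_mult simp flip: 1 intro: exI[of _ 1])
        (metis poly_1 1)+
    show "B \<subseteq> ?B"
    proof
      fix x assume "x \<in> B"
      then have "coeffs_in B [:x:]" using coeffs_in_const[OF B] by blast
      then show "x \<in> ?B" by (auto intro: image_eqI[of _ _ "[:x:]"])
    qed
    show "J \<subseteq> ?J"
    proof
      fix x assume "x \<in> J"
      then have "coeffs_in J [:x:]" by (rule cJ)
      then show "x \<in> ?J" by (auto intro: image_eqI[of _ _ "[:x:]"])
    qed
    show "?J \<subseteq> ?B" using JB by (auto simp: coeffs_in_def)
    show "0 \<in> ?J" using J0 by (auto simp: coeffs_in_def intro: image_eqI[of _ _ 0])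
    show "x + y \<in> ?J" if xy: "x \<in> ?J" "y \<in> ?J" for x y
    proof -
      obtain p q where "x = poly p z" "y = poly q z" "coeffs_in J p" "coeffs_in J q"
        using xy by blast
      moreover from this have "coeffs_in J (p + q)" by (auto simp: coeffs_in_def intro: Jadd)
      ultimately show ?thesis by (auto intro: image_eqI[of _ _ "p + q"])
    qed
    show "b * x \<in> ?J" if xy: "b \<in> ?B" "x \<in> ?J" for b x
    proof -
      obtain p q where "b = poly p z" "x = poly q z" "coeffs_in B p" "coeffs_in J q"
        using xy by blast
      moreover from this have "coeffs_in J (p * q)" by (intro coeffs_in_ideal_mult[OF J0 Jadd Jmult])
      ultimately show ?thesis by (auto intro: image_eqI[of _ _ "p * q"])
    qed
    show "1 \<notin> ?J" using no by force
  qed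
qed

text \<open>Zorn's lemma gives a maximal pair \<open>(B, J)\<close>. If neither \<open>z\<close> nor
  \<open>inverse z\<close> lay in \<open>B\<close>, adjoining either would make the ideal improper,
  and the two resulting relations could be shortened forever.\<close>

theorem chevalley_extension:
  fixes A I :: "'b::field set"
  assumes A: "is_subring A" and I: "I \<subseteq> A" "0 \<in> I" "1 \<notin> I"
    and Iadd: "\<And>x y. x \<in> I \<Longrightarrow> y \<in> I \<Longrightarrow> x + y \<in> I"
    and Imult: "\<And>a x. a \<in> A \<Longrightarrow> x \<in> I \<Longrightarrow> a * x \<in> I"
  shows "\<exists>V. is_valring UNIV V \<and> A \<subseteq> V \<and> I \<subseteq> nonunits V"
proof -
  \<comment> \<open>A pair of sets is coded as one subset of a sum type, so that Zorn's lemma for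
    inclusion applies as it stands.\<close>
  define P where "P S \<longleftrightarrow> chevalley_pair A I (vimage Inl S) (vimage Inr S)" for S :: "('b + 'b) set"
  have PI: "P (Inl ` B \<union> Inr ` J)" if "chevalley_pair A I B J" for B J
  proof -
    have "vimage Inl (Inl ` B \<union> Inr ` J) = B" "vimage Inr (Inl ` B \<union> Inr ` J) = J" by auto
    then show ?thesis using that by (simp add: P_def)
  qed
  have "chevalley_pair A I A I" using assms by (auto simp: chevalley_pair_def)
  then have ne: "{S. P S} \<noteq> {}" using PI by blast
  have "\<exists>M\<in>{S. P S}. \<forall>S\<in>{S. P S}. M \<subseteq> S \<longrightarrow> S = M"
  proof (rule subset_Zorn_nonempty[OF ne])
    fix \<C> assume \<C>: "\<C> \<noteq> {}" "subset.chain {S. P S} \<C>"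
    have P: "P S" if "S \<in> \<C>" for S using \<C> that by (auto simp: subset.chain_def)
    have dir: "\<exists>Z\<in>\<C>. x \<in> Z \<and> y \<in> Z" if "x \<in> \<Union>\<C>" "y \<in> \<Union>\<C>" for x y
      using that \<C>(2) unfolding subset_chain_def by blast
    note * = P[unfolded P_def chevalley_pair_def is_subring_def]
    have 1: "is_subring (vimage Inl (\<Union>\<C>))"
      unfolding is_subring_def
    proof (intro conjI ballI)
      show "1 \<in> vimage Inl (\<Union>\<C>)" using \<C>(1) * by blast
      fix x y assume "x \<in> vimage Inl (\<Union>\<C>)" "y \<in> vimage Inl (\<Union>\<C>)"
      then obtain Z where "Z \<in> \<C>" "Inl x \<in> Z" "Inl y \<in> Z" using dir by blast
      then show "x - y \<in> vimage Inl (\<Union>\<C>)" "x * y \<in> vimage Inl (\<Union>\<C>)" using *[of Z] by blast+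
    qed
    have 2: "x + y \<in> vimage Inr (\<Union>\<C>)" if xy: "x \<in> vimage Inr (\<Union>\<C>)" "y \<in> vimage Inr (\<Union>\<C>)" for x y
    proof -
      obtain Z where "Z \<in> \<C>" "Inr x \<in> Z" "Inr y \<in> Z" using dir xy by blast
      then show ?thesis using *[of Z] by blast
    qed
    have 3: "x * y \<in> vimage Inr (\<Union>\<C>)" if xy: "x \<in> vimage Inl (\<Union>\<C>)" "y \<in> vimage Inr (\<Union>\<C>)" for x y
    proof -
      obtain Z where "Z \<in> \<C>" "Inl x \<in> Z" "Inr y \<in> Z" using dir xy by blast
      then show ?thesis using *[of Z] by blast
    qed
    have "A \<subseteq> vimage Inl (\<Union>\<C>)" "I \<subseteq> vimage Inr (\<Union>\<C>)" "0 \<in> vimage Inr (\<Union>\<C>)" using \<C>(1) * by blast+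
    moreover have "vimage Inr (\<Union>\<C>) \<subseteq> vimage Inl (\<Union>\<C>)" "1 \<notin> vimage Inr (\<Union>\<C>)" using * by blast+
    ultimately show "\<Union>\<C> \<in> {S. P S}"
      using 1 2 3 by (simp add: P_def chevalley_pair_def)
  qed
  then obtain M where M: "P M" and max: "\<And>S. P S \<Longrightarrow> M \<subseteq> S \<Longrightarrow> S = M" by blast
  define B J where "B = vimage Inl M" and "J = vimage Inr M"
  have BJ: "chevalley_pair A I B J" using M by (simp add: P_def B_def J_def)
  have B: "is_subring B" and sub: "A \<subseteq> B" "I \<subseteq> J" "J \<subseteq> B" and J0: "0 \<in> J" and J1: "1 \<notin> J"
    and Jadd: "\<And>x y. x \<in> J \<Longrightarrow> y \<in> J \<Longrightarrow> x + y \<in> J" and Jmult: "\<And>b x. b \<in> B \<Longrightarrow> x \<in> J \<Longrightarrow> b * x \<in> J"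
    using BJ by (auto simp: chevalley_pair_def)
  have ex: "\<exists>p. coeffs_in J p \<and> poly p z = 1" if "z \<notin> B" for z
  proof (rule ccontr)
    assume "\<nexists>p. coeffs_in J p \<and> poly p z = 1"
    then have "chevalley_pair B J ((\<lambda>p. poly p z) ` {p. coeffs_in B p}) ((\<lambda>p. poly p z) ` {p. coeffs_in J p})"
      (is "chevalley_pair _ _ ?B ?J")
      using chevalley_pair_adjoin[OF BJ] by blast
    then have *: "chevalley_pair A I ?B ?J" and "B \<subseteq> ?B" "J \<subseteq> ?J"
      using sub unfolding chevalley_pair_def by (meson order_trans)+
    moreover have "x \<in> M \<longleftrightarrow> x \<in> Inl ` B \<union> Inr ` J" for x
      unfolding B_def J_def by (cases x) auto
    ultimately have "M \<subseteq> Inl ` ?B \<union> Inr ` ?J"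
      by (meson Un_iff image_mono subset_iff)
    then have "Inl ` ?B \<union> Inr ` ?J = M"
      by (rule max[OF PI[OF *]])
    then have "?B \<subseteq> B" unfolding B_def by blast
    moreover have "coeffs_in B [:0, 1:]"
      using is_subringD[OF B] by (simp add: coeffs_in_pCons_iff[OF B] coeffs_in_0[OF B])
    then have "z \<in> ?B" by (auto intro: image_eqI[of _ _ "[:0, 1:]"])
    ultimately show False using that by blast
  qed
  have "z \<in> B \<or> inverse z \<in> B" for z
  proof (rule ccontr)
    assume "\<not> (z \<in> B \<or> inverse z \<in> B)"
    then have zB: "z \<notin> B" "inverse z \<notin> B" by auto
    then have z: "z \<noteq> 0" using is_subringD[OF B] by auto
    \<comment> \<open>\<open>R\<close> collects pairs of relations, one in \<open>z\<close> and one
      in \<open>inverse z\<close>. A pair of least total degree is contradictory, because its longer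
      relation can be replaced by a shorter one.\<close>
    define R where "R pq \<longleftrightarrow> coeffs_in J (fst pq) \<and> poly (fst pq) z = 1 \<and>
      coeffs_in J (snd pq) \<and> poly (snd pq) (inverse z) = 1" for pq
    define f where "f pq = Polynomial.degree (fst pq) + Polynomial.degree (snd pq)" for pq :: "'b poly \<times> 'b poly"
    obtain p0 q0 where "R (p0, q0)" using ex[OF zB(1)] ex[OF zB(2)] by (auto simp: R_def)
    then have R: "R (arg_min f R)" and min: "\<And>pq. R pq \<Longrightarrow> f (arg_min f R) \<le> f pq"
      using arg_min_natI arg_min_nat_le by metis+
    define p q where "p = fst (arg_min f R)" and "q = snd (arg_min f R)"
    have p: "coeffs_in J p" "poly p z = 1" and q: "coeffs_in J q" "poly q (inverse z) = 1"
      using R by (simp_all add: R_def p_def q_def)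
    consider "Polynomial.degree q \<le> Polynomial.degree p" | "Polynomial.degree p \<le> Polynomial.degree q"
      by linarith
    then show False
    proof cases
      case 1
      obtain p' where "coeffs_in J p'" "poly p' z = 1" "Polynomial.degree p' < Polynomial.degree p"
        using chevalley_reduce[OF BJ z p q 1] by blast
      then show False using min[of "(p', q)"] q by (simp add: R_def f_def flip: p_def q_def)
    next
      case 2
      have "poly p (inverse (inverse z)) = 1" using p by simp
      then obtain q' where "coeffs_in J q'" "poly q' (inverse z) = 1" "Polynomial.degree q' < Polynomial.degree q"
        using chevalley_reduce[OF BJ _ q p(1) _ 2] z by auto
      then show False using min[of "(p, q')"] p by (simp add: R_def f_def flip: p_def q_def)
    qed
  qed
  then have "is_valring UNIV B" using B by (simp add: is_valring_def)
  moreover have "J \<subseteq> nonunits B"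
  proof
    fix x assume "x \<in> J"
    then show "x \<in> nonunits B"
      using sub(3) J1 Jmult[of "inverse x" x] by (auto simp: nonunits_def)
  qed
  ultimately show ?thesis using sub by blast
qed
text \<open>The condition on kernels lets \<open>g\<close> factor through the image of
  \<open>f\<close>. The kernel of the factored map is an ideal of that image, proper because
  \<open>g 1 = 1\<close>, and Chevalley's theorem applies. Here \<open>f\<close> is evaluation at
  the generic point and \<open>g\<close> evaluation at the intended centre.\<close>

lemma ex_valring_of_hom:
  fixes f g :: "'r::comm_ring_1 \<Rightarrow> 'b::field"
  assumes R: "is_subring R"
    and f: "f 1 = 1" "\<And>x y. f (x - y) = f x - f y" "\<And>x y. f (x + y) = f x + f y" "\<And>x y. f (x * y) = f x * f y"
    and g: "g 1 = 1" "\<And>x y. g (x - y) = g x - g y" "\<And>x y. g (x + y) = g x + g y" "\<And>x y. g (x * y) = g x * g y"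
    and ker: "\<And>x. x \<in> R \<Longrightarrow> f x = 0 \<Longrightarrow> g x = 0"
  shows "\<exists>V. is_valring UNIV V \<and> f ` R \<subseteq> V \<and> f ` {x \<in> R. g x = 0} \<subseteq> nonunits V"
proof (rule chevalley_extension)
  note RD = is_subringD[OF R]
  show "is_subring (f ` R)"
    unfolding is_subring_def
    using RD(1,3,4) by (auto simp: f(1)[symmetric] simp flip: f(2,4))
  show "0 \<in> f ` {x \<in> R. g x = 0}"
    using f(2)[of 0 0] g(2)[of 0 0] RD(2) by (intro image_eqI[of _ _ 0]) auto
  show "1 \<notin> f ` {x \<in> R. g x = 0}"
  proof
    assume "1 \<in> f ` {x \<in> R. g x = 0}"
    then obtain x where x: "x \<in> R" "g x = 0" "f x = 1" by auto
    have "f (1 - x) = 0" unfolding f(2) f(1) x(3) by simp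
    then have "g (1 - x) = 0" by (intro ker RD(1,3) x(1))
    then show False unfolding g(2) g(1) x(2) by simp
  qed
  show "x + y \<in> f ` {x \<in> R. g x = 0}" if xy: "x \<in> f ` {x \<in> R. g x = 0}" "y \<in> f ` {x \<in> R. g x = 0}" for x y
  proof -
    obtain a b where "x = f a" "y = f b" "a \<in> R" "b \<in> R" "g a = 0" "g b = 0" using xy by auto
    then show ?thesis using RD(6) by (intro image_eqI[of _ _ "a + b"]) (auto simp: f g)
  qed
  show "a * x \<in> f ` {x \<in> R. g x = 0}" if xy: "a \<in> f ` R" "x \<in> f ` {x \<in> R. g x = 0}" for a x
  proof -
    obtain b c where "a = f b" "x = f c" "b \<in> R" "c \<in> R" "g c = 0" using xy by auto
    then show ?thesis using RD(4) by (intro image_eqI[of _ _ "b * c"]) (auto simp: f g)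
  qed
qed auto

section \<open>Asymptotic expansions in an Artin-Schreier extension\<close>

text \<open>\<open>Q\<close> is a polynomial in \<open>u\<close> whose coefficients are polynomials
  in \<open>w\<close>; the outer variable is filled with the constant polynomial
  \<open>[:u:]\<close>, and the result is evaluated at \<open>w\<close>.\<close>

definition eval2 :: "'b::comm_ring_1 poly poly \<Rightarrow> 'b \<Rightarrow> 'b \<Rightarrow> 'b" where
  "eval2 Q w u = poly (poly Q [:u:]) w"

lemma eval2_simps [simp]:
  "eval2 0 w u = 0" "eval2 1 w u = 1" "eval2 (Q + R) w u = eval2 Q w u + eval2 R w u"
  "eval2 (Q - R) w u = eval2 Q w u - eval2 R w u" "eval2 (- Q) w u = - eval2 Q w u"
  "eval2 (Q * R) w u = eval2 Q w u * eval2 R w u" "eval2 (Q ^ n) w u = eval2 Q w u ^ n"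
  "eval2 (pCons p Q) w u = poly p w + u * eval2 Q w u"
  "eval2 (smult p Q) w u = poly p w * eval2 Q w u"
  "eval2 (Polynomial.monom p n) w u = poly p w * u ^ n"
  by (simp_all add: eval2_def poly_monom)

lemma eval2_altdef:
  "eval2 Q w u = (\<Sum>i\<le>Polynomial.degree Q. poly (Polynomial.coeff Q i) w * u ^ i)"
  by (simp add: eval2_def poly_altdef[of Q] poly_sum)

abbreviation coeffs_in2 :: "'b::comm_ring_1 set \<Rightarrow> 'b poly poly \<Rightarrow> bool" where
  "coeffs_in2 B \<equiv> coeffs_in {p. coeffs_in B p}"

context
  fixes B :: "'b::comm_ring_1 set"
  assumes B: "is_subring B"
begin

lemmas coeffs_in2_intros =
  coeffs_in_0[OF coeffs_in_is_subring[OF B]] coeffs_in_1[OF coeffs_in_is_subring[OF B]]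
  coeffs_in_add[OF coeffs_in_is_subring[OF B]] coeffs_in_diff[OF coeffs_in_is_subring[OF B]]
  coeffs_in_uminus[OF coeffs_in_is_subring[OF B]] coeffs_in_mult[OF coeffs_in_is_subring[OF B]]
  coeffs_in_power[OF coeffs_in_is_subring[OF B]]

lemma coeffs_in2_pCons_iff: "coeffs_in2 B (pCons p Q) \<longleftrightarrow> coeffs_in B p \<and> coeffs_in2 B Q"
  using coeffs_in_pCons_iff[OF coeffs_in_is_subring[OF B]] by simp

lemma coeffs_in2_monom: "coeffs_in B p \<Longrightarrow> coeffs_in2 B (Polynomial.monom p n)"
  using coeffs_in_monom[OF coeffs_in_is_subring[OF B]] by simp

lemma coeffs_in2_smult: "coeffs_in B p \<Longrightarrow> coeffs_in2 B Q \<Longrightarrow> coeffs_in2 B (smult p Q)"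
  using coeffs_in_mult[OF B] by (simp add: coeffs_in_def[of "{p. coeffs_in B p}"])

lemma coeffs_in2_coeff: "coeffs_in2 B Q \<Longrightarrow> coeffs_in B (Polynomial.coeff Q i)"
  by (simp add: coeffs_in_def[of "{p. coeffs_in B p}"])

lemma coeffs_in2_map_const: "coeffs_in B p \<Longrightarrow> coeffs_in2 B [:p:]"
  by (simp add: coeffs_in2_pCons_iff coeffs_in2_intros)

lemma eval2_in_subring:
  assumes V: "is_subring V" "B \<subseteq> V" "w \<in> V" "u \<in> V"
  shows "coeffs_in2 B Q \<Longrightarrow> eval2 Q w u \<in> V"
  by (induction Q)
    (use assms in \<open>auto simp: coeffs_in2_pCons_iff
      intro!: is_subringD(2,4,6)[OF V(1)] poly_in_subring[OF B]\<close>)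

text \<open>Powers from \<open>u ^ q\<close> on are eliminated by the relation, at the price of a
  factor \<open>h\<close> in each step of the induction. \<open>N\<close> and \<open>R\<close> are
  chosen before \<open>w\<close> and \<open>u\<close>, so the same \<open>R\<close> can be evaluated
  at the generic point and at a point of the curve.\<close>

lemma reduce_degree:
  assumes h: "coeffs_in B h" and g: "coeffs_in B g" and q: "q \<ge> 2"
  shows "coeffs_in2 B Q \<Longrightarrow> \<exists>N R. coeffs_in2 B R \<and> Polynomial.degree R < q \<and>
    (\<forall>w u. poly h w * (u ^ q - u) = poly g w \<longrightarrow> poly h w ^ N * eval2 Q w u = eval2 R w u)"
proof (induction Q)
  case 0
  show ?case using q by (intro exI[of _ 0]) (auto intro: coeffs_in2_intros)
next
  case (pCons p Q)
  have p: "coeffs_in B p" and "coeffs_in2 B Q" using pCons.prems by (auto simp: coeffs_in2_pCons_iff)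
  then obtain N R where R: "coeffs_in2 B R" "Polynomial.degree R < q"
    and eq: "\<And>w u. poly h w * (u ^ q - u) = poly g w \<Longrightarrow> poly h w ^ N * eval2 Q w u = eval2 R w u"
    using pCons.IH by auto
  define c where "c = Polynomial.coeff R (q - 1)"
  define R' where "R' = R - Polynomial.monom c (q - 1)"
  \<comment> \<open>With \<open>R = R' + c u ^ (q - 1)\<close>, multiplication by \<open>u\<close>
    creates the single bad term \<open>c u ^ q\<close>. After the extra factor \<open>h\<close> it
    is replaced by \<open>c h u + c g\<close>.\<close>
  define S where "S = [:h ^ (N + 1) * p + c * g:] + Polynomial.monom (c * h) 1 + smult h (pCons 0 R')"
  have c: "coeffs_in B c" unfolding c_def by (rule coeffs_in2_coeff[OF R(1)])
  have R': "coeffs_in2 B R'"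
    unfolding R'_def by (intro coeffs_in2_intros coeffs_in2_monom R c)
  have "coeffs_in2 B S"
    unfolding S_def
    by (intro coeffs_in2_intros coeffs_in2_map_const coeffs_in2_monom coeffs_in2_smult
        coeffs_in_add[OF B] coeffs_in_mult[OF B] coeffs_in_power[OF B] c h g p)
      (simp add: coeffs_in2_pCons_iff coeffs_in_0[OF B] R')
  moreover have "Polynomial.degree S < q"
  proof -
    have "Polynomial.degree R' \<le> q - 2"
    proof (rule degree_le, intro allI impI)
      fix i assume "q - 2 < i"
      then have "i = q - 1 \<or> i > Polynomial.degree R" using R(2) by linarith
      then show "Polynomial.coeff R' i = 0"
        using R(2) by (auto simp: R'_def c_def coeff_eq_0)
    qed
    then have "Polynomial.degree (smult h (pCons 0 R')) \<le> q - 1"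
      using q by (intro order.trans[OF degree_smult_le] order.trans[OF degree_pCons_le]) linarith
    moreover have "Polynomial.degree (Polynomial.monom (c * h) 1) \<le> q - 1"
      using q by (intro order.trans[OF degree_monom_le]) auto
    ultimately have "Polynomial.degree S \<le> q - 1"
      unfolding S_def by (intro degree_add_le) auto
    then show ?thesis using q by linarith
  qed
  moreover have "poly h w ^ (N + 1) * eval2 (pCons p Q) w u = eval2 S w u"
    if rel: "poly h w * (u ^ q - u) = poly g w" for w u
  proof -
    have "eval2 R w u = eval2 R' w u + poly c w * u ^ (q - 1)" by (simp add: R'_def)
    then have "poly h w ^ (N + 1) * eval2 (pCons p Q) w u
        = poly h w ^ (N + 1) * poly p w + poly h w * u * eval2 R' w u + poly c w * (poly h w * (u * u ^ (q - 1)))"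
      using eq[OF rel] by (simp add: algebra_simps)
    also have "u * u ^ (q - 1) = u ^ q" using q by (cases q) auto
    also have "poly h w * u ^ q = poly h w * u + poly g w"
      using rel by (simp add: algebra_simps)
    finally show ?thesis by (simp add: S_def algebra_simps)
  qed
  ultimately show ?case by blast
qed

lemma poly_taylor:
  assumes w0: "w0 \<in> B"
  shows "coeffs_in B p \<Longrightarrow> \<exists>p1. coeffs_in B p1 \<and> (\<forall>w. poly p w = poly p w0 + (w - w0) * poly p1 w)"
proof (induction p)
  case 0
  then show ?case by (intro exI[of _ 0]) (auto intro: coeffs_in_0[OF B])
next
  case (pCons a p)
  then obtain p1 where p1: "coeffs_in B p1" "\<And>w. poly p w = poly p w0 + (w - w0) * poly p1 w"
    unfolding coeffs_in_pCons_iff[OF B] by blast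
  have "poly p w0 \<in> B"
    using pCons.prems by (intro poly_in_subring[OF B B] w0) (auto simp: coeffs_in_pCons_iff[OF B])
  then have "coeffs_in B (pCons (poly p w0) p1)" using p1(1) by (simp add: coeffs_in_pCons_iff[OF B])
  moreover have "poly (pCons a p) w = poly (pCons a p) w0 + (w - w0) * poly (pCons (poly p w0) p1) w" for w
    by (subst poly_pCons, subst p1(2)[of w]) (simp add: algebra_simps)
  ultimately show ?case by blast
qed

text \<open>A first-order expansion whose cofactors again have coefficients in \<open>B\<close>, so
  that it can be iterated and reduced modulo maximal ideals.\<close>

lemma eval2_taylor:
  assumes w0: "w0 \<in> B" and u0: "u0 \<in> B"
  shows "coeffs_in2 B Q \<Longrightarrow> \<exists>Q1 Q2. coeffs_in2 B Q1 \<and> coeffs_in2 B Q2 \<and>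
    (\<forall>w u. eval2 Q w u = eval2 Q w0 u0 + (w - w0) * eval2 Q1 w u + (u - u0) * eval2 Q2 w u)"
proof (induction Q)
  case 0
  then show ?case by (intro exI[of _ 0]) (auto intro: coeffs_in2_intros)
next
  case (pCons p Q)
  then have p: "coeffs_in B p" and Q: "coeffs_in2 B Q" by (auto simp: coeffs_in2_pCons_iff)
  obtain Q1 Q2 where Q12: "coeffs_in2 B Q1" "coeffs_in2 B Q2"
    "\<And>w u. eval2 Q w u = eval2 Q w0 u0 + (w - w0) * eval2 Q1 w u + (u - u0) * eval2 Q2 w u"
    using pCons.IH[OF Q] by blast
  obtain p1 where p1: "coeffs_in B p1" "\<And>w. poly p w = poly p w0 + (w - w0) * poly p1 w"
    using poly_taylor[OF w0 p] by blast
  have e: "eval2 Q w0 u0 \<in> B" by (intro eval2_in_subring[OF B] w0 u0 Q) auto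
  have "coeffs_in2 B (pCons p1 Q1)" using p1(1) Q12(1) by (simp add: coeffs_in2_pCons_iff)
  moreover have "coeffs_in2 B (pCons [:eval2 Q w0 u0:] Q2)"
    using e Q12(2) by (simp add: coeffs_in2_pCons_iff coeffs_in_const[OF B])
  moreover have "eval2 (pCons p Q) w u = eval2 (pCons p Q) w0 u0 + (w - w0) * eval2 (pCons p1 Q1) w u
      + (u - u0) * eval2 (pCons [:eval2 Q w0 u0:] Q2) w u" for w u
    unfolding eval2_simps(8) by (subst Q12(3)[of w u], subst p1(2)[of w]) (simp add: algebra_simps)
  ultimately show ?case by blast
qed

end

text \<open>The field generated by \<open>C\<close>, \<open>w\<close> and \<open>u\<close>, as
  explicit quotients: to expand all its elements it is enough to expand the values
  \<open>eval2 Q w u\<close>.\<close>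

definition frac_field :: "'b::field set \<Rightarrow> 'b \<Rightarrow> 'b \<Rightarrow> 'b set" where
  "frac_field C w u = {eval2 Q w u / eval2 R w u | Q R. coeffs_in2 C Q \<and> coeffs_in2 C R \<and> eval2 R w u \<noteq> 0}"

lemma
  assumes C: "is_subring C"
  shows is_subfield_frac_field: "is_subfield (frac_field C w u)"
    and frac_field_gens: "C \<subseteq> frac_field C w u" "w \<in> frac_field C w u" "u \<in> frac_field C w u"
proof -
  note CI = coeffs_in2_intros[OF C]
  have FI: "eval2 Q w u / eval2 R w u \<in> frac_field C w u"
    if "coeffs_in2 C Q" "coeffs_in2 C R" "eval2 R w u \<noteq> 0" for Q R
    using that by (auto simp: frac_field_def)
  have FI1: "eval2 Q w u \<in> frac_field C w u" if "coeffs_in2 C Q" for Q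
    using FI[OF that CI(2)] by simp
  show "is_subfield (frac_field C w u)"
    unfolding is_subfield_def is_subring_def
  proof (intro conjI ballI)
    show "1 \<in> frac_field C w u" using FI1[OF CI(2)] by simp
    fix x assume x: "x \<in> frac_field C w u"
    then obtain Q R where Q: "x = eval2 Q w u / eval2 R w u" "coeffs_in2 C Q" "coeffs_in2 C R" "eval2 R w u \<noteq> 0"
      by (auto simp: frac_field_def)
    show "inverse x \<in> frac_field C w u"
      using FI[of R Q] FI1[OF CI(1)] Q by (cases "eval2 Q w u = 0") auto
    fix y assume "y \<in> frac_field C w u"
    then obtain Q' R' where Q': "y = eval2 Q' w u / eval2 R' w u" "coeffs_in2 C Q'" "coeffs_in2 C R'" "eval2 R' w u \<noteq> 0"
      by (auto simp: frac_field_def)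
    have "eval2 (Q * R' - Q' * R) w u / eval2 (R * R') w u \<in> frac_field C w u"
      using Q Q' by (intro FI CI) auto
    then show "x - y \<in> frac_field C w u" using Q Q' by (simp add: diff_frac_eq)
    have "eval2 (Q * Q') w u / eval2 (R * R') w u \<in> frac_field C w u"
      using Q Q' by (intro FI CI) auto
    then show "x * y \<in> frac_field C w u" using Q Q' by simp
  qed
  show "C \<subseteq> frac_field C w u"
  proof
    fix c assume "c \<in> C"
    then show "c \<in> frac_field C w u"
      using FI1[OF coeffs_in2_map_const[OF C], of "[:c:]"] by (simp add: coeffs_in_const[OF C])
  qed
  have "coeffs_in C [:0, 1:]"
    using is_subringD[OF C] by (simp add: coeffs_in_pCons_iff[OF C] coeffs_in_0[OF C])
  then show "w \<in> frac_field C w u"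
    using FI1[OF coeffs_in2_map_const[OF C], of "[:0, 1:]"] by simp
  have "coeffs_in2 C [:0, 1:]"
    using coeffs_in_0[OF C] coeffs_in_1[OF C] CI by (simp add: coeffs_in2_pCons_iff[OF C])
  then show "u \<in> frac_field C w u" using FI1[of "[:0, 1:]"] by simp
qed

lemma frac_field_least:
  assumes "is_subfield C" "is_subfield E" "C \<subseteq> E" "w \<in> E" "u \<in> E"
  shows "frac_field C w u \<subseteq> E"
  unfolding frac_field_def using assms
  by (auto intro!: is_subfieldD(9)[OF assms(2)] eval2_in_subring[OF is_subfieldD(11) is_subfieldD(11)])

lemma eval2_cong_nonunits:
  assumes W: "is_valring E W" and E: "is_subfield E" and C: "is_subfield C" "C \<subseteq> W"
    and w0: "w0 \<in> C" and u0: "u0 \<in> C"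
    and w: "w - w0 \<in> nonunits W" and u: "u - u0 \<in> nonunits W" and Q: "coeffs_in2 C Q"
  shows "eval2 Q w u - eval2 Q w0 u0 \<in> nonunits W" "eval2 Q w0 u0 \<in> C" "eval2 Q w u \<in> W"
proof -
  note sC = is_subfieldD(11)[OF C(1)] and sW = is_valringD(1)[OF W]
  have w1: "w \<in> W" using is_subringD(6)[OF sW, of "w - w0" w0] w w0 C nonunits_subset by auto
  have u1: "u \<in> W" using is_subringD(6)[OF sW, of "u - u0" u0] u u0 C nonunits_subset by auto
  obtain Q1 Q2 where Q12: "coeffs_in2 C Q1" "coeffs_in2 C Q2"
    and eq: "eval2 Q w u = eval2 Q w0 u0 + (w - w0) * eval2 Q1 w u + (u - u0) * eval2 Q2 w u"
    using eval2_taylor[OF sC w0 u0 Q] by blast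
  have "(w - w0) * eval2 Q1 w u + (u - u0) * eval2 Q2 w u \<in> nonunits W"
    by (intro nonunits_add[OF W E] nonunits_mult(1)[OF W] w u eval2_in_subring[OF sC sW] C w1 u1 Q12)
  then show "eval2 Q w u - eval2 Q w0 u0 \<in> nonunits W"
    by (metis eq add.assoc add_diff_cancel_left')
  show "eval2 Q w0 u0 \<in> C" by (intro eval2_in_subring[OF sC sC] w0 u0 Q) auto
  show "eval2 Q w u \<in> W" by (intro eval2_in_subring[OF sC sW] C w1 u1 Q)
qed

lemma poly_cong_nonunits:
  assumes W: "is_valring E W" and E: "is_subfield E" and C: "is_subfield C" "C \<subseteq> W"
    and w0: "w0 \<in> C" and w: "w - w0 \<in> nonunits W" and p: "coeffs_in C p"
  shows "poly p w - poly p w0 \<in> nonunits W" "poly p w0 \<in> C" "poly p w \<in> W"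
  using eval2_cong_nonunits[OF W E C w0 is_subfieldD(2)[OF C(1)] w _
      coeffs_in2_map_const[OF is_subfieldD(11)[OF C(1)] p], of 0] zero_in_nonunits[OF W] by simp_all

section \<open>Expansions at ramified and at unramified points\<close>

context valuation_class
begin

text \<open>
  The exponents \<open>j \<sigma> - i e\<close> of the monomials \<open>w ^ j u ^ i\<close> with \<open>i < q\<close> are pairwise distinct, so
  no cancellation can occur.
\<close>

lemma asym_eval2_ramified:
  assumes w: "asym w \<sigma> c1" and u: "asym u (- e) c2" and \<sigma>: "\<bar>\<sigma>\<bar> = int q" and q: "q > 0"
    and co: "coprime (int q) e"
    and Q: "coeffs_in2 C Q" "Polynomial.degree Q < q" "Q \<noteq> 0"
  shows "\<exists>k c. asym (eval2 Q w u) k c"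
proof -
  define J where "J i = {j. j \<le> Polynomial.degree (Polynomial.coeff Q i) \<and> Polynomial.coeff (Polynomial.coeff Q i) j \<noteq> 0}" for i
  define I where "I = Sigma {..Polynomial.degree Q} J"
  define f where "f = (\<lambda>(i, j). Polynomial.coeff (Polynomial.coeff Q i) j * w ^ j * u ^ i)"
  define \<kappa> where "\<kappa> = (\<lambda>(i, j). int j * \<sigma> - int i * e)"
  define \<gamma> where "\<gamma> = (\<lambda>(i, j). Polynomial.coeff (Polynomial.coeff Q i) j * c1 ^ j * c2 ^ i)"
  have finJ: "finite (J i)" for i by (auto simp: J_def)
  have "eval2 Q w u = (\<Sum>i\<le>Polynomial.degree Q. \<Sum>j\<in>J i. f (i, j))"
    unfolding eval2_altdef
  proof (rule sum.cong)
    fix i assume "i \<in> {..Polynomial.degree Q}"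
    have "poly (Polynomial.coeff Q i) w = (\<Sum>j\<in>J i. Polynomial.coeff (Polynomial.coeff Q i) j * w ^ j)"
      unfolding poly_altdef by (rule sum.mono_neutral_right) (auto simp: J_def)
    then show "poly (Polynomial.coeff Q i) w * u ^ i = (\<Sum>j\<in>J i. f (i, j))"
      by (simp add: f_def sum_distrib_right)
  qed simp
  also have "\<dots> = sum f I"
    unfolding I_def by (subst sum.Sigma) (auto simp: finJ)
  finally have eq: "eval2 Q w u = sum f I" .
  have "\<exists>i\<in>I. asym (sum f I) (\<kappa> i) (\<gamma> i)"
  proof (rule asym_sum)
    show "finite I" by (auto simp: I_def finJ)
    have "Polynomial.lead_coeff Q \<noteq> 0" using Q by simp
    then have "(Polynomial.degree Q, Polynomial.degree (Polynomial.lead_coeff Q)) \<in> I"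
      by (auto simp: I_def J_def)
    then show "I \<noteq> {}" by blast
    show "asym (f x) (\<kappa> x) (\<gamma> x)" if "x \<in> I" for x
    proof -
      obtain i j where x: "x = (i, j)" by force
      have nz: "Polynomial.coeff (Polynomial.coeff Q i) j \<noteq> 0" using that by (auto simp: x I_def J_def)
      have "Polynomial.coeff (Polynomial.coeff Q i) j \<in> C"
        using coeffs_in2_coeff[OF is_subfieldD(11)[OF C] Q(1), of i] by (simp add: coeffs_in_def)
      from asym_mult[OF asym_mult[OF asym_const[OF this nz] asym_power[OF w, of j]] asym_power[OF u, of i]]
      show ?thesis by (simp add: x f_def \<kappa>_def \<gamma>_def)
    qed
    show "inj_on \<kappa> I"
    proof (rule inj_onI)
      fix x y assume "x \<in> I" "y \<in> I" and eq: "\<kappa> x = \<kappa> y"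
      obtain i j i' j' where x: "x = (i, j)" and y: "y = (i', j')" by force
      have i: "i < q" "i' < q" using \<open>x \<in> I\<close> \<open>y \<in> I\<close> Q(2) by (auto simp: x y I_def)
      \<comment> \<open>Since \<open>q\<close> divides \<open>\<sigma>\<close> and is prime to
        \<open>e\<close>, it divides \<open>i - i'\<close>; both indices are below \<open>q\<close>,
        so they agree, and \<open>\<sigma>\<close> being nonzero then gives \<open>j = j'\<close>.
        The sign of \<open>\<sigma>\<close> is immaterial, which covers zeros and poles of
        \<open>w\<close>.\<close>
      have *: "(int j - int j') * \<sigma> = (int i - int i') * e"
        using eq by (simp add: x y \<kappa>_def algebra_simps)
      have "int q dvd \<sigma>" using \<sigma> by (metis dvd_abs_iff dvd_refl)
      then have "int q dvd (int i - int i') * e" by (metis * dvd_mult)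
      then have "int q dvd int i - int i'" using co by (simp add: coprime_dvd_mult_left_iff)
      then have "i = i'" using i zdvd_imp_le[of "int q" "int i - int i'"] zdvd_imp_le[of "int q" "int i' - int i"]
        by (cases i i' rule: linorder_cases) (auto simp: dvd_diff_commute)
      moreover have "j = j'" using * \<open>i = i'\<close> \<sigma> q by auto
      ultimately show "x = y" by (simp add: x y)
    qed
  qed
  then show ?thesis using eq by metis
qed

lemma asym_frac_field:
  assumes F_eq: "F = frac_field C w u"
    and ring: "\<And>Q. coeffs_in2 C Q \<Longrightarrow> eval2 Q w u \<noteq> 0 \<Longrightarrow> \<exists>k c. asym (eval2 Q w u) k c"
    and z: "z \<in> F"
  shows "z = 0 \<or> (\<exists>k c. asym z k c)"
proof -
  obtain Q R where Q: "coeffs_in2 C Q" "coeffs_in2 C R" "z = eval2 Q w u / eval2 R w u" "eval2 R w u \<noteq> 0"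
    using z by (auto simp: F_eq frac_field_def)
  show ?thesis
    using ring[OF Q(1)] ring[OF Q(2,4)] Q(3) asym_divide by (cases "eval2 Q w u = 0") (simp, metis)
qed

text \<open>After multiplication by a power of \<open>h\<close> the degree in \<open>u\<close> is
  below \<open>q\<close>, where the exponents are distinct. The power of \<open>h\<close> is divided
  out again; \<open>h\<close> is expanded by the same result, as a polynomial of degree 0 in
  \<open>u\<close>.\<close>

lemma asym_ramified:
  assumes F_eq: "F = frac_field C w u"
    and w: "asym w \<sigma> c1" and u: "asym u (- e) c2" and \<sigma>: "\<bar>\<sigma>\<bar> = int q" and q: "q \<ge> 2"
    and co: "coprime (int q) e" and h: "coeffs_in C h" and g: "coeffs_in C g"
    and rel: "poly h w * (u ^ q - u) = poly g w" and hw: "poly h w \<noteq> 0" and z: "z \<in> F"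
  shows "z = 0 \<or> (\<exists>k c. asym z k c)"
proof (rule asym_frac_field[OF F_eq _ z])
  fix Q assume Q: "coeffs_in2 C Q" and nz: "eval2 Q w u \<noteq> 0"
  note sC = is_subfieldD(11)[OF C]
  have q0: "q > 0" using q by simp
  obtain N R where R: "coeffs_in2 C R" "Polynomial.degree R < q"
    and "\<forall>w u. poly h w * (u ^ q - u) = poly g w \<longrightarrow> poly h w ^ N * eval2 Q w u = eval2 R w u"
    using reduce_degree[OF sC h g q Q] by (elim exE conjE)
  then have eq: "poly h w ^ N * eval2 Q w u = eval2 R w u" using rel by simp
  have "R \<noteq> 0" using eq nz hw by auto
  then obtain k c where 1: "asym (eval2 R w u) k c"
    using asym_eval2_ramified[OF w u \<sigma> q0 co R] by blast
  have "[:h:] \<noteq> 0" using hw by auto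
  then obtain k' c' where 2: "asym (eval2 [:h:] w u) k' c'"
    using asym_eval2_ramified[OF w u \<sigma> q0 co coeffs_in2_map_const[OF sC h]] q0 by auto
  have "eval2 Q w u = eval2 R w u / poly h w ^ N" using eq hw by (simp add: field_simps)
  then show "\<exists>k c. asym (eval2 Q w u) k c"
    using asym_divide[OF 1 asym_power[OF 2, of N]] by auto
qed

text \<open>Near the point, \<open>u - u0\<close> is \<open>w - w0\<close> times a polynomial value
  divided by a unit. So whenever a polynomial expression vanishes at the point, a factor
  \<open>w - w0\<close> splits off up to a unit. The bound \<open>ord\<close> for the one ring
  \<open>V0\<close> ends the process, and its result is valid for every member of
  \<open>\<V>\<close>.\<close>

lemma asym_smooth:
  assumes F_eq: "F = frac_field C w u" and w0: "w0 \<in> C" and u0: "u0 \<in> C"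
    and pi_eq: "\<pi> = w - w0" and uN: "\<And>V. V \<in> \<V> \<Longrightarrow> u - u0 \<in> nonunits V"
    and h: "coeffs_in C h" and g: "coeffs_in C g" and q: "q \<ge> 2"
    and frob: "(u - u0) ^ q = u ^ q - u0 ^ q"
    and rel: "poly h w * (u ^ q - u) = poly g w" and rel0: "poly h w0 * (u0 ^ q - u0) = poly g w0"
    and h0: "poly h w0 \<noteq> 0"
    and V0: "is_valring UNIV V0" "C \<subseteq> V0" "w - w0 \<in> nonunits V0" "u - u0 \<in> nonunits V0"
    and ord: "\<And>z. z \<noteq> 0 \<Longrightarrow> \<exists>k. z / (w - w0) ^ k \<notin> V0"
    and z: "z \<in> F"
  shows "z = 0 \<or> (\<exists>k c. asym z k c)"
proof (rule asym_frac_field[OF F_eq _ z])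
  fix Q assume Q: "coeffs_in2 C Q" and nz: "eval2 Q w u \<noteq> 0"
  note sC = is_subfieldD(11)[OF C]
  note CI = coeffs_in2_intros[OF sC] coeffs_in2_map_const[OF sC]
  have unit: "asym (eval2 E w u) 0 (eval2 E w0 u0)" if "coeffs_in2 C E" "eval2 E w0 u0 \<noteq> 0" for E
  proof (rule asym_perturb)
    show "eval2 E w0 u0 \<in> C" by (intro eval2_in_subring[OF sC sC] w0 u0 that) auto
    show "eval2 E w u \<in> F"
      using CF frac_field_gens[OF sC] F_eq
      by (intro eval2_in_subring[OF sC] that is_subfieldD(11)[OF F]) auto
    show "eval2 E w u - eval2 E w0 u0 \<in> nonunits V" if "V \<in> \<V>" for V
      using eval2_cong_nonunits(1)[OF V F C CV w0 u0 _ uN \<open>coeffs_in2 C E\<close>] pi pi_eq that by auto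
  qed fact
  have X: "coeffs_in2 C [:0, 1:]"
    using coeffs_in_0[OF sC] coeffs_in_1[OF sC] CI by (simp add: coeffs_in2_pCons_iff[OF sC])
  define U where "U = [:0, 1:] - [:[:u0:]:]"
  have U: "coeffs_in2 C U" "\<And>w u. eval2 U w u = u - u0"
    using X u0 CI by (auto simp: U_def coeffs_in_const[OF sC] simp del: diff_pCons)
  \<comment> \<open>\<open>G0\<close> is \<open>g\<close> shifted so that it vanishes at
    \<open>w0\<close>; at the generic point it equals \<open>h w\<close> times
    \<open>(u - u0) ^ q - (u - u0)\<close>.\<close>
  define G0 where "G0 = g - [:u0 ^ q - u0:] * h"
  have "coeffs_in C G0"
    unfolding G0_def
    by (intro coeffs_in_diff[OF sC] coeffs_in_mult[OF sC] g h) (simp add: coeffs_in_const[OF sC] u0 is_subfieldD[OF C])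
  then obtain G1 where G1: "coeffs_in C G1" "\<And>w. poly G0 w = poly G0 w0 + (w - w0) * poly G1 w"
    using poly_taylor[OF sC w0] by blast
  \<comment> \<open>The cofactor of \<open>u - u0\<close> in the shifted equation. Its value at the
    point is \<open>- h w0\<close>, because \<open>q - 1\<close> is positive; hence it is a unit
    there.\<close>
  define E0 where "E0 = [:h:] * (U ^ (q - 1) - 1)"
  have E0: "coeffs_in2 C E0" unfolding E0_def by (intro CI h U)
  have E00: "eval2 E0 w0 u0 \<noteq> 0" using h0 q by (simp add: E0_def U power_0_left)
  have "(u - u0) * eval2 E0 w u = poly h w * ((u - u0) * (u - u0) ^ (q - 1) - (u - u0))"
    by (simp add: E0_def U algebra_simps)
  also have "(u - u0) * (u - u0) ^ (q - 1) = (u - u0) ^ q" using q by (cases q) (simp_all only: power_Suc diff_Suc_1)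
  also have "(u - u0) ^ q = u ^ q - u0 ^ q" by (rule frob)
  also have "poly h w * (u ^ q - u0 ^ q - (u - u0)) = poly G0 w"
    using rel by (simp add: G0_def algebra_simps)
  also have "\<dots> = (w - w0) * poly G1 w"
    using G1(2)[of w] rel0 by (simp add: G0_def algebra_simps)
  finally have key: "(u - u0) * eval2 E0 w u = (w - w0) * poly G1 w" .
  have step: "(\<exists>k c. asym (eval2 Q w u) k c) \<or> (\<exists>E R. coeffs_in2 C E \<and> coeffs_in2 C R \<and>
      eval2 E w0 u0 \<noteq> 0 \<and> eval2 E w u * eval2 Q w u = (w - w0) ^ k * eval2 R w u)" for k
  proof (induction k)
    case 0
    show ?case using Q CI(2) by (intro disjI2 exI[of _ 1] exI[of _ Q]) auto
  next
    case (Suc k)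
    show ?case
    proof (cases "\<exists>k c. asym (eval2 Q w u) k c")
      case True
      then show ?thesis by blast
    next
      case no: False
      with Suc obtain E R where E: "coeffs_in2 C E" "coeffs_in2 C R" "eval2 E w0 u0 \<noteq> 0"
        and eq: "eval2 E w u * eval2 Q w u = (w - w0) ^ k * eval2 R w u" by blast
      have R0: "eval2 R w0 u0 = 0"
      proof (rule ccontr)
        assume "eval2 R w0 u0 \<noteq> 0"
        then have *: "asym (\<pi> ^ k * eval2 R w u / eval2 E w u) (int k * 1 + 0 - 0)
            (1 ^ k * eval2 R w0 u0 / eval2 E w0 u0)"
          using E by (intro asym_divide asym_mult asym_power asym_pi unit)
        show False
        \<comment> \<open>The division by \<open>E\<close> needs a nonzero value at the generic
          point. \<open>V0\<close> ensures it: there the value is congruent to the nonzero constant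
          \<open>eval2 E w0 u0\<close>.\<close>
        proof (cases "eval2 E w u = 0")
          case True
          have "eval2 E w u - eval2 E w0 u0 \<in> nonunits V0"
            by (rule eval2_cong_nonunits(1)[OF V0(1) is_subfield_UNIV C V0(2) w0 u0 V0(3,4) E(1)])
          then have "- eval2 E w0 u0 \<in> nonunits V0" using True by simp
          moreover have "- eval2 E w0 u0 \<in> C"
            by (intro is_subfieldD(5)[OF C] eval2_in_subring[OF sC sC] w0 u0 E) auto
          ultimately show False using unit_notin_nonunits[OF V0(1) C V0(2)] E(3) by simp
        next
          case False
          then have "\<pi> ^ k * eval2 R w u / eval2 E w u = eval2 Q w u"
            using eq by (simp add: pi_eq field_simps)
          then show False using * no by metis
        qed
      qed
      obtain Q1 Q2 where Q12: "coeffs_in2 C Q1" "coeffs_in2 C Q2"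
        "eval2 R w u = eval2 R w0 u0 + (w - w0) * eval2 Q1 w u + (u - u0) * eval2 Q2 w u"
        using eval2_taylor[OF sC w0 u0 E(2)] by blast
      have "eval2 (E0 * E) w u * eval2 Q w u = (w - w0) ^ k * (eval2 E0 w u * eval2 R w u)"
        using eq by (simp add: mult.assoc mult.left_commute)
      also have "eval2 E0 w u * eval2 R w u
          = (w - w0) * (eval2 E0 w u * eval2 Q1 w u) + ((u - u0) * eval2 E0 w u) * eval2 Q2 w u"
        by (subst Q12(3), subst R0) (simp add: algebra_simps)
      also have "\<dots> = (w - w0) * eval2 (E0 * Q1 + [:G1:] * Q2) w u"
        unfolding key by (simp add: algebra_simps)
      finally have "eval2 (E0 * E) w u * eval2 Q w u = (w - w0) ^ Suc k * eval2 (E0 * Q1 + [:G1:] * Q2) w u"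
        by (simp add: algebra_simps)
      moreover have "coeffs_in2 C (E0 * E)" "coeffs_in2 C (E0 * Q1 + [:G1:] * Q2)"
        by (intro CI E0 E Q12 G1)+
      moreover have "eval2 (E0 * E) w0 u0 \<noteq> 0" using E00 E(3) by simp
      ultimately show ?thesis by blast
    qed
  qed
  show "\<exists>k c. asym (eval2 Q w u) k c"
  proof (rule ccontr)
    assume no: "\<nexists>k c. asym (eval2 Q w u) k c"
    obtain k where k: "eval2 Q w u / (w - w0) ^ k \<notin> V0" using ord[OF nz] by blast
    obtain E R where E: "coeffs_in2 C E" "coeffs_in2 C R" "eval2 E w0 u0 \<noteq> 0"
      and eq: "eval2 E w u * eval2 Q w u = (w - w0) ^ k * eval2 R w u"
      using step[of k] no by blast
    note cong = eval2_cong_nonunits[OF V0(1) is_subfield_UNIV C V0(2) w0 u0 V0(3,4)]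
    have EN: "eval2 E w u \<notin> nonunits V0"
    proof
      assume "eval2 E w u \<in> nonunits V0"
      from nonunits_diff[OF V0(1) is_subfield_UNIV this cong(1)[OF E(1)]]
      have "eval2 E w0 u0 \<in> nonunits V0" by simp
      then show False using unit_notin_nonunits[OF V0(1) C V0(2) cong(2)[OF E(1)] E(3)] by simp
    qed
    then have "inverse (eval2 E w u) \<in> V0" "eval2 E w u \<noteq> 0"
      using cong(3)[OF E(1)] zero_in_nonunits[OF V0(1)] by (auto simp: nonunits_def)
    then have "inverse (eval2 E w u) * eval2 R w u \<in> V0"
      by (intro is_valring_subringD(4)[OF V0(1)] cong(3)[OF E(2)])
    moreover have "w - w0 \<noteq> 0" using pi0 pi_eq by simp
    then have "eval2 Q w u / (w - w0) ^ k = inverse (eval2 E w u) * eval2 R w u"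
      using eq \<open>eval2 E w u \<noteq> 0\<close> by (simp add: field_simps)
    ultimately show False using k by simp
  qed
qed

end

section \<open>Rational places as valuation rings\<close>

abbreviation subring_struct :: "'b::field set \<Rightarrow> 'b ring" where
  "subring_struct B \<equiv> ring_of_type_algebra\<lparr>carrier := B\<rparr>"

lemma ring_of_type_algebra_simps [simp]:
  "carrier ring_of_type_algebra = UNIV" "x \<otimes>\<^bsub>ring_of_type_algebra\<^esub> y = x * y"
  "x \<oplus>\<^bsub>ring_of_type_algebra\<^esub> y = x + y" "\<one>\<^bsub>ring_of_type_algebra\<^esub> = 1" "\<zero>\<^bsub>ring_of_type_algebra\<^esub> = 0"
  by (simp_all add: ring_of_type_algebra_def)

lemma subring_struct_simps:
  "carrier (subring_struct B) = B" "x \<otimes>\<^bsub>subring_struct B\<^esub> y = x * y" "x \<oplus>\<^bsub>subring_struct B\<^esub> y = x + y"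
  "\<one>\<^bsub>subring_struct B\<^esub> = 1" "\<zero>\<^bsub>subring_struct B\<^esub> = 0"
  by (simp_all add: ring_of_type_algebra_def)

lemma subring_struct_cring:
  assumes B: "is_subring B"
  shows "cring (subring_struct B)"
proof -
  have "\<exists>y\<in>B. x + y = 0" if "x \<in> B" for x
    using is_subringD(5)[OF B that] by (intro bexI[of _ "- x"]) auto
  then show ?thesis
    by unfold_locales (auto simp: Units_def algebra_simps add_eq_0_iff is_subringD[OF B])
qed

lemma subring_struct_a_inv:
  assumes B: "is_subring B" and x: "x \<in> B"
  shows "\<ominus>\<^bsub>subring_struct B\<^esub> x = - x"
proof -
  interpret cring "subring_struct B" by (rule subring_struct_cring[OF B])
  show ?thesis using minus_equality[of "- x" x] x is_subringD(5)[OF B x] by simp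
qed

lemma subring_struct_m_inv:
  assumes F: "is_subfield F" and x: "x \<in> F" "x \<noteq> 0"
  shows "inv\<^bsub>subring_struct F\<^esub> x = inverse x"
proof -
  interpret cring "subring_struct F" by (rule subring_struct_cring[OF is_subfieldD(11)[OF F]])
  show ?thesis using comm_inv_char[of x "inverse x"] x is_subfieldD(8)[OF F] by simp
qed

lemma
  shows is_subfield_generate_field: "is_subfield (generate_field (ring_of_type_algebra :: 'b::field ring) H)"
    and generate_field_least: "is_subfield E \<Longrightarrow> H \<subseteq> E \<Longrightarrow> generate_field ring_of_type_algebra H \<subseteq> E"
proof -
  interpret field "ring_of_type_algebra :: 'b ring" by (rule field_from_type_algebra)
  have a_inv: "\<ominus>\<^bsub>ring_of_type_algebra\<^esub> h = - h" for h :: 'b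
    using minus_equality[of "- h" h] by simp
  have m_inv: "inv\<^bsub>ring_of_type_algebra\<^esub> h = inverse h" if "h \<noteq> 0" for h :: 'b
    using comm_inv_char[of h "inverse h"] that by simp
  let ?G = "generate_field (ring_of_type_algebra :: 'b ring) H"
  have 1: "1 \<in> ?G" using generate_field.one[of "ring_of_type_algebra :: 'b ring" H] by simp
  have uminus: "- x \<in> ?G" if "x \<in> ?G" for x using generate_field.a_inv[OF that] a_inv by simp
  have add: "x + y \<in> ?G" and mult: "x * y \<in> ?G" if "x \<in> ?G" "y \<in> ?G" for x y
    using generate_field.eng_add[OF that] generate_field.eng_mult[OF that] by simp_all
  have inverse: "inverse x \<in> ?G" if "x \<in> ?G" for x
  proof (cases "x = 0")
    case True
    then show ?thesis using that by simp
  next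
    case False
    then show ?thesis using generate_field.m_inv[OF that] m_inv[OF False] by simp
  qed
  have "x - y \<in> ?G" if "x \<in> ?G" "y \<in> ?G" for x y
    using add[OF that(1) uminus[OF that(2)]] by simp
  then show "is_subfield ?G" using 1 mult inverse by (simp add: is_subfield_def is_subring_def)
  show "?G \<subseteq> E" if E: "is_subfield E" "H \<subseteq> E"
  proof
    fix x assume "x \<in> ?G"
    then show "x \<in> E"
      by (induction rule: generate_field.induct)
        (use E(2) is_subfieldD[OF E(1)] a_inv m_inv in auto)
  qed
qed

lemma subring_subring_struct_iff:
  assumes F: "is_subring F"
  shows "subring V (subring_struct F) \<longleftrightarrow> is_subring V \<and> V \<subseteq> F"
proof
  interpret cring "subring_struct F" by (rule subring_struct_cring[OF F])
  show "is_subring V \<and> V \<subseteq> F" if "subring V (subring_struct F)"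
  proof -
    have V: "V \<subseteq> F" using subringE(1)[OF that] by simp
    moreover have "x - y \<in> V" if "x \<in> V" "y \<in> V" for x y
      using subringE(5,7)[OF \<open>subring V (subring_struct F)\<close>] that subring_struct_a_inv[OF F] V
      by (metis add_uminus_conv_diff subring_struct_simps(3) subsetD)
    ultimately show ?thesis
      using subringE(3,6)[OF that] by (auto simp: is_subring_def)
  qed
  show "subring V (subring_struct F)" if "is_subring V \<and> V \<subseteq> F"
    using that by (intro subringI) (auto simp: subring_struct_a_inv[OF F] subset_iff intro: is_subringD)
qed

lemma valuation_ring_over_iff:
  assumes F: "is_subfield F"
  shows "valuation_ring_over (subring_struct F) K V \<longleftrightarrow> is_valring F V \<and> K \<subset> V \<and> V \<noteq> F"
  unfolding valuation_ring_over_def is_valring_def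
    subring_subring_struct_iff[OF is_subfieldD(11)[OF F]]
  using is_subringD(2) subring_struct_m_inv[OF F] by (auto simp: psubset_eq)

text \<open>An ideal that is not contained in \<open>nonunits V\<close> contains a unit and so is
  all of \<open>V\<close>; thus \<open>nonunits V\<close> is the only maximal ideal.\<close>

lemma
  assumes F: "is_subfield F" and V: "is_valring F V"
  shows ideal_nonunits: "ideal (nonunits V) (subring_struct V)"
    and maximalideal_iff: "maximalideal P (subring_struct V) \<longleftrightarrow> P = nonunits V"
proof -
  note sV = is_valringD(1)[OF V]
  interpret R: cring "subring_struct V" by (rule subring_struct_cring[OF sV])
  show N: "ideal (nonunits V) (subring_struct V)"
  proof (rule idealI[OF R.ring_axioms])
    show "subgroup (nonunits V) (add_monoid (subring_struct V))"
    proof (rule R.add.subgroupI)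
      show "nonunits V \<subseteq> carrier (subring_struct V)" using nonunits_subset by auto
      show "nonunits V \<noteq> {}" using zero_in_nonunits[OF V] by auto
      show "\<ominus>\<^bsub>subring_struct V\<^esub> a \<in> nonunits V" if "a \<in> nonunits V" for a
      proof -
        have "a \<in> V" using that nonunits_subset by blast
        then show ?thesis using nonunits_uminus[OF V that] by (simp add: subring_struct_a_inv[OF sV])
      qed
    qed (auto intro: nonunits_add[OF V F])
  qed (auto intro: nonunits_mult[OF V])
  have J: "J \<subseteq> nonunits V \<or> J = V" if J: "ideal J (subring_struct V)" for J
  proof (rule disjCI)
    assume "J \<noteq> V"
    interpret J: ideal J "subring_struct V" by (rule J)
    have JV: "J \<subseteq> V" using J.a_subset by simp
    show "J \<subseteq> nonunits V"
    proof (rule ccontr)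
      assume "\<not> J \<subseteq> nonunits V"
      then obtain z where z: "z \<in> J" "z \<noteq> 0" "inverse z \<in> V" using JV by (auto simp: nonunits_def)
      then have "inverse z * z \<in> J" using J.I_l_closed[of z "inverse z"] by simp
      then have 1: "1 \<in> J" using z by simp
      have "V \<subseteq> J"
      proof
        fix x assume "x \<in> V"
        then have "x * 1 \<in> J" using J.I_l_closed[OF 1, of x] by simp
        then show "x \<in> J" by simp
      qed
      then show False using JV \<open>J \<noteq> V\<close> by blast
    qed
  qed
  have ne: "nonunits V \<noteq> V" using one_notin_nonunits[OF V] is_subringD(1)[OF sV] by blast
  show "maximalideal P (subring_struct V) \<longleftrightarrow> P = nonunits V"
  proof
    assume "maximalideal P (subring_struct V)"
    then interpret P: maximalideal P "subring_struct V" .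
    have "P \<subseteq> nonunits V" using J[OF P.is_ideal] P.I_notcarr by auto
    then show "P = nonunits V" using P.I_maximal[OF N] ne nonunits_subset by auto
  next
    assume P: "P = nonunits V"
    show "maximalideal P (subring_struct V)"
      unfolding P using J ne by (intro maximalidealI[OF N]) auto
  qed
qed

text \<open>Dimension one gives a residue class \<open>v\<close> of which all others are multiples
  by constants. As \<open>1\<close> is among these multiples, \<open>v\<close> is itself the class
  of a constant and can be replaced by \<open>1\<close>.\<close>

lemma place_has_degree_1_iff:
  assumes F: "is_subfield F" and V: "is_valring F V" and K: "is_subfield K" "K \<subseteq> V"
  shows "place_has_degree (subring_struct F) K V (nonunits V) 1 \<longleftrightarrow> (\<forall>z\<in>V. \<exists>c\<in>K. z - c \<in> nonunits V)"
proof -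
  note sV = is_valringD(1)[OF V]
  let ?R = "subring_struct V" and ?N = "nonunits V"
  define L where "L = ?R Quot ?N"
  define \<phi> where "\<phi> u = ?N +>\<^bsub>?R\<^esub> u" for u
  interpret R: cring ?R by (rule subring_struct_cring[OF sV])
  interpret N: ideal ?N ?R by (rule ideal_nonunits[OF F V])
  interpret L: ring L unfolding L_def by (rule N.quotient_is_ring)
  have phi_def': "\<phi> u = (\<lambda>n. n + u) ` ?N" for u by (auto simp: \<phi>_def a_r_coset_def')
  have phi_eq: "\<phi> u = \<phi> v \<longleftrightarrow> u - v \<in> ?N" for u v
  proof
    assume "\<phi> u = \<phi> v"
    moreover have "u \<in> \<phi> u" using zero_in_nonunits[OF V] by (force simp: phi_def')
    ultimately show "u - v \<in> ?N" by (auto simp: phi_def')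
  next
    assume uv: "u - v \<in> ?N"
    have "\<exists>n'\<in>?N. n + u = n' + v" if "n \<in> ?N" for n
      using nonunits_add[OF V F that uv] by (intro bexI[of _ "n + (u - v)"]) auto
    moreover have "\<exists>n'\<in>?N. n + v = n' + u" if "n \<in> ?N" for n
      using nonunits_diff[OF V F that uv] by (intro bexI[of _ "n - (u - v)"]) auto
    ultimately show "\<phi> u = \<phi> v" unfolding phi_def' by (auto simp: image_iff)
  qed
  have carr: "carrier L = \<phi> ` V"
    by (auto simp: L_def FactRing_def A_RCOSETS_def' \<phi>_def)
  have hom: "\<phi> \<in> ring_hom ?R L" unfolding \<phi>_def L_def by (rule N.rcos_ring_hom)
  have mult: "\<phi> u \<otimes>\<^bsub>L\<^esub> \<phi> v = \<phi> (u * v)" if "u \<in> V" "v \<in> V" for u v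
    using ring_hom_mult[OF hom, of u v] that by simp
  have zero: "\<zero>\<^bsub>L\<^esub> = \<phi> 0" by (simp add: L_def FactRing_def phi_def')
  have "place_has_degree (subring_struct F) K V ?N 1 \<longleftrightarrow> L.dimension 1 (\<phi> ` K) (carrier L)"
    by (simp add: place_has_degree_def Let_def L_def \<phi>_def[abs_def])
  also have "\<dots> \<longleftrightarrow> (\<exists>v\<in>carrier L. v \<noteq> \<zero>\<^bsub>L\<^esub> \<and> carrier L = L.line_extension (\<phi> ` K) v {\<zero>\<^bsub>L\<^esub>})"
  proof
    assume "L.dimension 1 (\<phi> ` K) (carrier L)"
    then have "L.dimension (Suc 0) (\<phi> ` K) (carrier L)" by simp
    then obtain v E where "v \<in> carrier L" "L.dimension 0 (\<phi> ` K) E" "v \<notin> E"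
      "carrier L = L.line_extension (\<phi> ` K) v E"
      by (cases rule: L.dimension.cases)
    moreover from this(2) have "E = {\<zero>\<^bsub>L\<^esub>}" by (cases rule: L.dimension.cases)
    ultimately show "\<exists>v\<in>carrier L. v \<noteq> \<zero>\<^bsub>L\<^esub> \<and> carrier L = L.line_extension (\<phi> ` K) v {\<zero>\<^bsub>L\<^esub>}" by auto
  next
    assume "\<exists>v\<in>carrier L. v \<noteq> \<zero>\<^bsub>L\<^esub> \<and> carrier L = L.line_extension (\<phi> ` K) v {\<zero>\<^bsub>L\<^esub>}"
    then obtain v where v: "v \<in> carrier L" "v \<noteq> \<zero>\<^bsub>L\<^esub>" and eq: "carrier L = L.line_extension (\<phi> ` K) v {\<zero>\<^bsub>L\<^esub>}"
      by blast
    have "L.dimension (Suc 0) (\<phi> ` K) (L.line_extension (\<phi> ` K) v {\<zero>\<^bsub>L\<^esub>})"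
      using v by (intro L.Suc_dim L.zero_dim) auto
    then show "L.dimension 1 (\<phi> ` K) (carrier L)" using eq by simp
  qed
  also have "\<dots> \<longleftrightarrow> (\<exists>v\<in>V. v \<notin> ?N \<and> (\<forall>z\<in>V. \<exists>c\<in>K. z - c * v \<in> ?N))"
  proof -
    have "L.line_extension (\<phi> ` K) (\<phi> v) {\<zero>\<^bsub>L\<^esub>} = (\<lambda>c. \<phi> (c * v)) ` K" if "v \<in> V" for v
    proof -
      have "\<phi> c \<otimes>\<^bsub>L\<^esub> \<phi> v \<oplus>\<^bsub>L\<^esub> \<zero>\<^bsub>L\<^esub> = \<phi> (c * v)" if c: "c \<in> K" for c
      proof -
        have cv: "c * v \<in> V" using c K(2) \<open>v \<in> V\<close> by (auto intro: is_subringD(4)[OF sV])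
        then have "\<phi> (c * v) \<in> carrier L" by (simp add: carr)
        then show ?thesis using mult[of c v] c K(2) \<open>v \<in> V\<close> by (simp add: subset_iff)
      qed
      note eq = this
      have "x \<in> L.line_extension (\<phi> ` K) (\<phi> v) {\<zero>\<^bsub>L\<^esub>} \<longleftrightarrow> (\<exists>c\<in>K. x = \<phi> (c * v))" for x
        unfolding L.line_extension_mem_iff using eq by (metis image_iff singletonD singletonI)
      then show ?thesis by blast
    qed
    moreover have "\<phi> ` V = (\<lambda>c. \<phi> (c * v)) ` K \<longleftrightarrow> (\<forall>z\<in>V. \<exists>c\<in>K. z - c * v \<in> ?N)" if "v \<in> V" for v
    proof -
      have "(\<lambda>c. \<phi> (c * v)) ` K \<subseteq> \<phi> ` V"
        using K(2) that is_subringD(4)[OF sV] by blast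
      then have "\<phi> ` V = (\<lambda>c. \<phi> (c * v)) ` K \<longleftrightarrow> \<phi> ` V \<subseteq> (\<lambda>c. \<phi> (c * v)) ` K"
        by (simp add: set_eq_subset)
      also have "\<dots> \<longleftrightarrow> (\<forall>z\<in>V. \<exists>c\<in>K. \<phi> z = \<phi> (c * v))"
        by (simp add: image_subset_iff image_iff)
      finally show ?thesis by (simp add: phi_eq)
    qed
    ultimately show ?thesis by (simp add: carr zero phi_eq)
  qed
  also have "\<dots> \<longleftrightarrow> (\<forall>z\<in>V. \<exists>c\<in>K. z - c \<in> ?N)"
  proof
    assume "\<forall>z\<in>V. \<exists>c\<in>K. z - c \<in> ?N"
    then show "\<exists>v\<in>V. v \<notin> ?N \<and> (\<forall>z\<in>V. \<exists>c\<in>K. z - c * v \<in> ?N)"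
      using is_subringD(1)[OF sV] one_notin_nonunits[OF V] by (intro bexI[of _ 1]) auto
  next
    assume "\<exists>v\<in>V. v \<notin> ?N \<and> (\<forall>z\<in>V. \<exists>c\<in>K. z - c * v \<in> ?N)"
    then obtain v where v: "v \<in> V" "v \<notin> ?N" and all: "\<And>z. z \<in> V \<Longrightarrow> \<exists>c\<in>K. z - c * v \<in> ?N" by blast
    \<comment> \<open>From \<open>1\<close> congruent to \<open>e * v\<close> one gets
      \<open>v\<close> congruent to \<open>inverse e\<close>, hence \<open>c * v\<close> congruent
      to \<open>c * inverse e\<close>.\<close>
    obtain e where e: "e \<in> K" "1 - e * v \<in> ?N" using all[of 1] is_subringD(1)[OF sV] by blast
    then have e0: "e \<noteq> 0" using one_notin_nonunits[OF V] by auto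
    have ie: "inverse e \<in> K" using is_subfieldD(8)[OF K(1) e(1)] .
    have "\<exists>c\<in>K. z - c \<in> ?N" if z: "z \<in> V" for z
    proof -
      obtain c where c: "c \<in> K" "z - c * v \<in> ?N" using all[OF z] by blast
      have "c * inverse e \<in> K" using c ie is_subfieldD(4)[OF K(1)] by blast
      moreover have "(1 - e * v) * (c * inverse e) \<in> ?N"
        using K(2) calculation by (intro nonunits_mult(1)[OF V e(2)]) auto
      then have "(z - c * v) - (1 - e * v) * (c * inverse e) \<in> ?N"
        by (rule nonunits_diff[OF V F c(2)])
      then have "z - c * inverse e \<in> ?N" using e0 by (simp add: field_simps)
      ultimately show ?thesis by blast
    qed
    then show "\<forall>z\<in>V. \<exists>c\<in>K. z - c \<in> ?N" by blast
  qed
  finally show ?thesis .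
qed

definition is_rational_valring :: "'b::field set \<Rightarrow> 'b set \<Rightarrow> 'b set \<Rightarrow> bool" where
  "is_rational_valring F K V \<longleftrightarrow> is_valring F V \<and> K \<subset> V \<and> V \<noteq> F \<and> (\<forall>z\<in>V. \<exists>c\<in>K. z - c \<in> nonunits V)"

lemma rational_places_eq:
  assumes F: "is_subfield F" and K: "is_subfield K"
  shows "rational_places (subring_struct F) K = nonunits ` {V. is_rational_valring F K V}"
proof -
  have "(valuation_ring_over (subring_struct F) K V \<and> maximalideal P (subring_struct F\<lparr>carrier := V\<rparr>) \<and>
      place_has_degree (subring_struct F) K V P 1) \<longleftrightarrow> is_rational_valring F K V \<and> P = nonunits V" for V P
    using valuation_ring_over_iff[OF F, of K V] maximalideal_iff[OF F, of V P] place_has_degree_1_iff[OF F _ K, of V]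
    by (auto simp: is_rational_valring_def)
  then show ?thesis by (auto simp: rational_places_def)
qed

text \<open>A nonzero \<open>z\<close> lies outside \<open>V\<close> exactly if its inverse is a
  nonunit, so the ring is recovered from its maximal ideal. Counting places therefore means counting
  rings.\<close>

lemma nonunits_inj:
  assumes V: "is_valring F V" and V': "is_valring F V'" and eq: "nonunits V = nonunits V'"
  shows "V = V'"
proof -
  have *: "W = {z \<in> F. z = 0 \<or> inverse z \<notin> nonunits W}" if W: "is_valring F W" for W
    using is_valringD[OF W] is_subringD(2)[OF is_valringD(1)[OF W]] inverse_in_nonunits[OF W]
    by (auto simp: nonunits_def)
  show ?thesis using *[OF V] *[OF V'] eq by simp
qed

text \<open>The classes \<open>\<C> i\<close> will be the sets of rings with a prescribed centre.
  Existence and uniqueness within a class are separate theorems, and together they make the index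
  set count the places.\<close>

lemma card_rational_places:
  assumes F: "is_subfield F" and K: "is_subfield K"
    and val: "\<And>i V. i \<in> I \<Longrightarrow> V \<in> \<C> i \<Longrightarrow> is_rational_valring F K V"
    and cover: "\<And>V. is_rational_valring F K V \<Longrightarrow> \<exists>i\<in>I. V \<in> \<C> i"
    and ne: "\<And>i. i \<in> I \<Longrightarrow> \<C> i \<noteq> {}"
    and uniq: "\<And>i V V'. i \<in> I \<Longrightarrow> V \<in> \<C> i \<Longrightarrow> V' \<in> \<C> i \<Longrightarrow> V = V'"
    and disj: "\<And>i j V. i \<in> I \<Longrightarrow> j \<in> I \<Longrightarrow> V \<in> \<C> i \<Longrightarrow> V \<in> \<C> j \<Longrightarrow> i = j"
  shows "card (rational_places (subring_struct F) K) = card I"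
proof -
  define v where "v i = (SOME V. V \<in> \<C> i)" for i
  have v: "v i \<in> \<C> i" if "i \<in> I" for i
    unfolding v_def using ne[OF that] by (auto intro: someI)
  have "bij_betw v I {V. is_rational_valring F K V}"
  proof (rule bij_betw_imageI)
    show "inj_on v I" by (rule inj_onI) (metis v disj)
    show "v ` I = {V. is_rational_valring F K V}"
      using val v cover uniq by (auto simp: image_iff) metis
  qed
  moreover have "inj_on nonunits {V. is_rational_valring F K V}"
    by (rule inj_onI) (metis is_rational_valring_def mem_Collect_eq nonunits_inj)
  ultimately show ?thesis
    by (simp add: rational_places_eq[OF F K] card_image bij_betw_same_card)
qed

section \<open>Moebius inversion\<close>

lemma moebius_mult_prime:
  assumes p: "Factorial_Ring.prime p" and e: "\<not> p dvd e" "e > 0"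
  shows "moebius (p * e) = - moebius e"
proof -
  have co: "coprime p e" using p e by (simp add: prime_imp_coprime)
  have "squarefree (p * e) \<longleftrightarrow> squarefree e"
    using co p by (auto simp: squarefree_mult_coprime squarefree_prime dest: squarefree_multD)
  moreover have "prime_factors (p * e) = insert p (prime_factors e)"
    using p e by (auto simp: prime_factors_product prime_prime_factors)
  moreover have "p \<notin> prime_factors e" using e by (auto simp: prime_factors_dvd)
  ultimately show ?thesis by (simp add: moebius_def)
qed

text \<open>For a prime \<open>p\<close> dividing \<open>n\<close>, the map \<open>d\<close> to
  \<open>p * d\<close> pairs the divisors prime to \<open>p\<close> with those divisible by
  \<open>p\<close> exactly once, with opposite signs. All other divisors contain a square.\<close>

lemma sum_moebius_divisors:
  assumes n: "n > 0"
  shows "(\<Sum>d | d dvd n. moebius d) = (if n = 1 then 1 else 0)"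
proof (cases "n = 1")
  case True
  then show ?thesis by (simp add: moebius_def)
next
  case False
  then obtain p where p: "Factorial_Ring.prime p" "p dvd n" using prime_factor_nat by blast
  have fin: "finite {d. d dvd n}" using n by simp
  define A B where "A = {d. d dvd n \<and> \<not> p dvd d}" and "B = {d. d dvd n \<and> p dvd d \<and> \<not> p * p dvd d}"
  have "(\<Sum>d | d dvd n. moebius d) = (\<Sum>d\<in>A \<union> B. moebius d)"
  proof (rule sum.mono_neutral_right)
    show "\<forall>i\<in>{d. d dvd n} - (A \<union> B). moebius i = 0"
    proof
      fix i assume "i \<in> {d. d dvd n} - (A \<union> B)"
      then have "p\<^sup>2 dvd i" by (auto simp: A_def B_def power2_eq_square)
      then have "\<not> squarefree i" using p(1) by (auto simp: squarefree_def)
      then show "moebius i = 0" by (simp add: moebius_def)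
    qed
  qed (use fin in \<open>auto simp: A_def B_def\<close>)
  also have "\<dots> = (\<Sum>d\<in>A. moebius d) + (\<Sum>d\<in>B. moebius d)"
    using fin by (intro sum.union_disjoint) (auto simp: A_def B_def)
  also have "(\<Sum>d\<in>B. moebius d) = (\<Sum>d\<in>A. - moebius d)"
  proof (rule sum.reindex_bij_witness[of _ "\<lambda>d. p * d" "\<lambda>d. d div p"])
    fix d assume d: "d \<in> A"
    then have "d dvd n" "\<not> p dvd d" by (auto simp: A_def)
    moreover from this have "p * d dvd n" using p by (simp add: divides_mult prime_imp_coprime)
    ultimately show "p * d \<in> B" using p(1) by (auto simp: B_def dvd_mult_cancel_left prime_gt_0_nat)
    show "p * d div p = d" using p(1) by (simp add: prime_gt_0_nat)
  next
    fix d assume d: "d \<in> B"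
    then obtain e where e: "d = p * e" by (auto simp: B_def)
    have e': "\<not> p dvd e" using d by (auto simp: B_def e)
    then have "e > 0" by (auto intro: gr0I)
    then show "- moebius (d div p) = moebius d"
      using moebius_mult_prime[OF p(1) e'] p(1) by (simp add: e prime_gt_0_nat)
    show "d div p \<in> A" using d e' p(1) by (auto simp: A_def B_def e prime_gt_0_nat dest: dvd_mult_right)
    show "p * (d div p) = d" by (simp add: e)
  qed
  finally show ?thesis using False by (simp add: sum_negf)
qed

text \<open>The divisor sum is assumed only for divisors of \<open>s\<close>. This suits the
  application, where it is available for arguments \<open>p ^ k * t\<close> with \<open>t\<close>
  prime to \<open>p\<close>.\<close>

lemma moebius_inversion:
  fixes f g :: "nat \<Rightarrow> int"
  assumes s: "s > 0" and f: "\<And>t. t dvd s \<Longrightarrow> f t = (\<Sum>e | e dvd t. g e)"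
  shows "g s = (\<Sum>t | t dvd s. moebius (s div t) * f t)"
proof -
  have fin: "finite {d. d dvd t}" if "t dvd s" for t
    using s that by (intro finite_divisors_nat) (auto intro: gr0I)
  have "(\<Sum>t | t dvd s. moebius (s div t) * f t)
      = (\<Sum>t | t dvd s. \<Sum>e | e dvd s \<and> e dvd t. moebius (s div t) * g e)"
  proof (rule sum.cong)
    fix t assume t: "t \<in> {t. t dvd s}"
    then have "{e. e dvd s \<and> e dvd t} = {e. e dvd t}" by (auto intro: dvd_trans)
    then show "moebius (s div t) * f t = (\<Sum>e | e dvd s \<and> e dvd t. moebius (s div t) * g e)"
      using f[of t] t by (simp add: sum_distrib_left)
  qed simp
  also have "\<dots> = (\<Sum>e | e dvd s. \<Sum>t | t dvd s \<and> e dvd t. moebius (s div t) * g e)"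
    using sum.swap_restrict[of "{t. t dvd s}" "{t. t dvd s}" "\<lambda>t e. moebius (s div t) * g e" "\<lambda>t e. e dvd t"] fin[of s]
    by simp
  also have "\<dots> = (\<Sum>e | e dvd s. if e = s then g s else 0)"
  proof (rule sum.cong)
    fix e assume "e \<in> {e. e dvd s}"
    then obtain n where n: "s = e * n" by auto
    have en: "e > 0" "n > 0" using s n by auto
    \<comment> \<open>With \<open>s = e * n\<close> the substitution
      \<open>t = e * (n div d)\<close> turns \<open>s div t\<close> into \<open>d\<close>.\<close>
    have "(\<Sum>t | t dvd s \<and> e dvd t. moebius (s div t)) = (\<Sum>d | d dvd n. moebius d)"
    proof (rule sum.reindex_bij_witness[of _ "\<lambda>d. e * (n div d)" "\<lambda>t. s div t"])
      fix t assume "t \<in> {t. t dvd s \<and> e dvd t}"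
      then obtain j where t: "t = e * j" and jn: "j dvd n" using n en by auto
      then obtain i where i: "n = j * i" by auto
      have "j > 0" "i > 0" using en i by auto
      then show "e * (n div (s div t)) = t" "s div t \<in> {d. d dvd n}"
        using en by (auto simp: t n i mult.assoc)
    next
      fix d assume "d \<in> {d. d dvd n}"
      then obtain i where i: "n = d * i" by auto
      have "d > 0" "i > 0" using en i by auto
      then show "s div (e * (n div d)) = d" "e * (n div d) \<in> {t. t dvd s \<and> e dvd t}"
        using en by (auto simp: n i)
    qed simp
    then have "(\<Sum>t | t dvd s \<and> e dvd t. moebius (s div t) * g e) = (if n = 1 then 1 else 0) * g e"
      using sum_moebius_divisors[OF en(2)] by (simp flip: sum_distrib_right)
    then show "(\<Sum>t | t dvd s \<and> e dvd t. moebius (s div t) * g e) = (if e = s then g s else 0)"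
      using en by (auto simp: n)
  qed simp
  also have "\<dots> = g s" using fin[of s] by simp
  finally show ?thesis by simp
qed

section \<open>Frobenius and characteristic of a finite field\<close>

text \<open>Multiplication by a nonzero \<open>x\<close> permutes the nonzero elements; comparing
  their products gives \<open>x ^ (q - 1) = 1\<close>.\<close>

lemma power_CARD_eq:
  fixes x :: "'a::{field, finite}"
  shows "x ^ CARD('a) = x"
proof (cases "x = 0")
  case False
  have "(\<Prod>y\<in>UNIV - {0}. y) = (\<Prod>y\<in>UNIV - {0}. x * y)"
    by (rule prod.reindex_bij_witness[of _ "\<lambda>y. x * y" "\<lambda>y. y / x"]) (use False in auto)
  also have "\<dots> = x ^ (CARD('a) - 1) * (\<Prod>y\<in>UNIV - {0}. y)"
    by (simp add: prod.distrib)
  finally have "x ^ (CARD('a) - 1) = 1" by simp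
  then have "x * x ^ (CARD('a) - 1) = x" by simp
  then show ?thesis by (simp flip: power_Suc)
qed simp

lemma CARD_ge_2: "CARD('a::{field, finite}) \<ge> 2"
proof -
  have "card {0, 1 :: 'a} \<le> CARD('a)" by (intro card_mono) auto
  then show ?thesis by simp
qed

lemma CHAR_eq_of_CARD:
  assumes "CARD('a::{field, finite}) = p ^ r" "Factorial_Ring.prime p"
  shows "CHAR('a) = p"
proof -
  have "CHAR('a) > 0" by (rule finite_imp_CHAR_pos) simp
  then have "Factorial_Ring.prime CHAR('a)" by (rule prime_CHAR_semidom)
  moreover have "CHAR('a) dvd p ^ r" using CHAR_dvd_CARD[where ?'a = 'a] assms by simp
  ultimately show ?thesis using assms(2) by (metis prime_dvd_power primes_dvd_imp_eq)
qed

lemma CHAR_fun_closure: "CHAR('a::field fun_closure) = CHAR('a)"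
proof -
  have "of_nat n = (0 :: 'a alg_closure poly fract) \<longleftrightarrow> of_nat n = (0 :: 'a alg_closure)" for n
  proof -
    have "of_nat n = Fract (of_nat n :: 'a alg_closure poly) 1"
      by (induction n) (auto simp: Zero_fract_def One_fract_def)
    then show ?thesis by (simp add: Zero_fract_def eq_fract of_nat_poly)
  qed
  then have "CHAR('a alg_closure poly fract) = CHAR('a alg_closure)"
    by (intro CHAR_eqI) (auto simp: of_nat_eq_0_iff_char_dvd)
  then show ?thesis by simp
qed

lemma freshmans_dream_diff:
  fixes x y :: "'b::comm_ring_1"
  assumes "Factorial_Ring.prime CHAR('b)" "n = CHAR('b) ^ i"
  shows "(x - y) ^ n = x ^ n - y ^ n"
proof -
  have "x ^ n = (x - y) ^ n + y ^ n" using freshmans_dream'[OF assms, of "x - y" y] by simp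
  then show ?thesis by (simp add: eq_diff_eq)
qed

section \<open>Finite fields and traces\<close>

lemma ex_artin_schreier_root:
  fixes z :: "'b::alg_closed_field"
  assumes q: "q \<ge> 2"
  shows "\<exists>w. w ^ q - w = z"
proof -
  define P where "P = Polynomial.monom 1 q + [:- z, - 1 :: 'b:]"
  have "Polynomial.degree P = q"
    unfolding P_def using q by (subst degree_add_eq_left) (auto simp: degree_monom_eq)
  then obtain w where "poly P w = 0" using alg_closed_imp_poly_has_root[of P] q by auto
  then show ?thesis by (intro exI[of _ w]) (simp add: P_def poly_monom algebra_simps)
qed

context
  fixes p r :: nat
  assumes card: "CARD('a::{field, finite}) = p ^ r" and p: "Factorial_Ring.prime p"
begin

lemma frobenius:
  fixes x y :: "'a alg_closure"
  shows "(x + y) ^ (CARD('a) ^ i) = x ^ (CARD('a) ^ i) + y ^ (CARD('a) ^ i)"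
    and "(x - y) ^ (CARD('a) ^ i) = x ^ (CARD('a) ^ i) - y ^ (CARD('a) ^ i)"
    and "sum f S ^ (CARD('a) ^ i) = (\<Sum>s\<in>S. (f s :: 'a alg_closure) ^ (CARD('a) ^ i))"
proof -
  have "CHAR('a alg_closure) = p" using CHAR_eq_of_CARD[OF card p] by simp
  then have 1: "Factorial_Ring.prime CHAR('a alg_closure)" "CARD('a) ^ i = CHAR('a alg_closure) ^ (r * i)"
    using p card by (simp_all add: power_mult)
  show "(x + y) ^ (CARD('a) ^ i) = x ^ (CARD('a) ^ i) + y ^ (CARD('a) ^ i)"
    by (rule freshmans_dream'[OF 1])
  show "(x - y) ^ (CARD('a) ^ i) = x ^ (CARD('a) ^ i) - y ^ (CARD('a) ^ i)"
    by (rule freshmans_dream_diff[OF 1])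
  show "sum f S ^ (CARD('a) ^ i) = (\<Sum>s\<in>S. f s ^ (CARD('a) ^ i))"
    by (rule freshmans_dream_sum'[OF 1])
qed

lemma is_subfield_GF_ext: "is_subfield (GF_ext n :: 'a alg_closure set)"
  unfolding is_subfield_def is_subring_def GF_ext_def
  by (auto simp: frobenius power_mult_distrib power_inverse)

lemma power_CARD_power_eq: "(x::'a) ^ (CARD('a) ^ i) = x"
  by (induction i) (simp_all add: power_mult power_CARD_eq)

lemma to_ac_in_GF_ext: "to_ac (x::'a) \<in> GF_ext n"
  unfolding GF_ext_def by (simp add: power_CARD_power_eq flip: to_ac_power)

lemma GF_ext_power: "z \<in> GF_ext n \<Longrightarrow> (z :: 'a alg_closure) ^ (CARD('a) ^ (n * i)) = z"
  by (induction i) (simp_all add: GF_ext_def power_add power_mult)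

lemma GF_ext_mono: "t dvd n \<Longrightarrow> GF_ext t \<subseteq> (GF_ext n :: 'a alg_closure set)"
  using GF_ext_power by (auto simp: GF_ext_def elim!: dvdE)

text \<open>An upper bound for the number of roots is enough: it is always compared with a subset of
  known size. For \<open>n = 0\<close> the set is the whole closure.\<close>

lemma GF_ext_finite:
  assumes n: "n \<ge> 1"
  shows "finite (GF_ext n :: 'a alg_closure set)" "card (GF_ext n :: 'a alg_closure set) \<le> CARD('a) ^ n"
proof -
  have q: "CARD('a) ^ n > 1" using CARD_ge_2[where ?'a = 'a] n one_less_power[of "CARD('a)" n] by simp
  define P where "P = Polynomial.monom 1 (CARD('a) ^ n) + [:0, - 1 :: 'a alg_closure:]"
  have "Polynomial.degree P = CARD('a) ^ n"
    unfolding P_def using q by (subst degree_add_eq_left) (auto simp: degree_monom_eq)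
  moreover from this have "P \<noteq> 0" using q by auto
  moreover have "GF_ext n = {w. poly P w = 0}"
    by (auto simp: GF_ext_def P_def poly_monom)
  ultimately show "finite (GF_ext n :: 'a alg_closure set)" "card (GF_ext n :: 'a alg_closure set) \<le> CARD('a) ^ n"
    using poly_roots_finite[of P] card_poly_roots_bound[of P] by simp_all
qed

lemma power_CARD_eq_iff: "(z :: 'a alg_closure) ^ CARD('a) = z \<longleftrightarrow> z \<in> range to_ac"
proof -
  have "range to_ac \<subseteq> (GF_ext 1 :: 'a alg_closure set)" using to_ac_in_GF_ext by auto
  moreover have "card (range (to_ac :: 'a \<Rightarrow> _)) = CARD('a)" by (rule card_image) (rule inj_to_ac)
  ultimately have "range to_ac = (GF_ext 1 :: 'a alg_closure set)"
    using GF_ext_finite[of 1] by (intro card_seteq) auto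
  then show ?thesis by (auto simp: GF_ext_def)
qed

lemma tr_add: "tr n (x + y :: 'a alg_closure) = tr n x + tr n y"
  by (simp add: tr_def frobenius sum.distrib)

lemma tr_diff: "tr n (x - y :: 'a alg_closure) = tr n x - tr n y"
  by (simp add: tr_def frobenius sum_subtractf)

lemma tr_scale: "tr n (to_ac a * x :: 'a alg_closure) = to_ac a * tr n x"
  by (simp add: tr_def power_mult_distrib sum_distrib_left power_CARD_power_eq flip: to_ac_power)

lemma tr_0: "tr n (0 :: 'a alg_closure) = 0"
  using CARD_ge_2[where ?'a = 'a] by (simp add: tr_def power_0_left)

lemma tr_uminus: "tr n (- x :: 'a alg_closure) = - tr n x"
  using tr_diff[of n 0 x] by (simp add: tr_0)

text \<open>The sum telescopes. Hence a root \<open>w\<close> of \<open>w ^ q - w = z\<close> lies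
  in \<open>GF_ext n\<close> exactly if \<open>z\<close> has trace zero.\<close>

lemma tr_artin_schreier: "tr n (w ^ CARD('a) - w :: 'a alg_closure) = w ^ (CARD('a) ^ n) - w"
proof -
  have "tr n (w ^ CARD('a)) = (\<Sum>i<n. w ^ (CARD('a) ^ Suc i))"
    by (simp add: tr_def power_mult)
  then show ?thesis
    using sum_lessThan_telescope[of "\<lambda>i. w ^ (CARD('a) ^ i)" n]
    unfolding tr_diff by (simp add: tr_def sum_subtractf)
qed

text \<open>Additive Hilbert 90, with a root taken in the closure: by telescoping the trace decides
  whether it lies in \<open>GF_ext n\<close>, and all roots form one coset of the base
  field.\<close>

lemma card_artin_schreier_GF_ext:
  assumes z: "z \<in> (GF_ext n :: 'a alg_closure set)"
  shows "card {w \<in> GF_ext n. w ^ CARD('a) - w = z} = (if tr n z = 0 then CARD('a) else 0)"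
proof -
  have iff: "w \<in> GF_ext n \<longleftrightarrow> tr n z = 0" if "w ^ CARD('a) - w = z" for w
    using tr_artin_schreier[of n w] that by (simp add: GF_ext_def)
  obtain w0 where w0: "w0 ^ CARD('a) - w0 = z" using ex_artin_schreier_root[OF CARD_ge_2[where ?'a = 'a]] by blast
  have "w ^ CARD('a) - w = z \<longleftrightarrow> w - w0 \<in> range to_ac" for w
  proof -
    have "(w - w0) ^ CARD('a) - (w - w0) = (w ^ CARD('a) - w) - z"
      unfolding w0[symmetric] using frobenius(2)[of w w0 1] by simp
    then have "w ^ CARD('a) - w = z \<longleftrightarrow> (w - w0) ^ CARD('a) = w - w0"
      by (metis right_minus_eq)
    then show ?thesis by (simp add: power_CARD_eq_iff)
  qed
  then have "{w. w ^ CARD('a) - w = z} = (\<lambda>a. to_ac a + w0) ` UNIV"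
    by (auto simp: image_iff eq_diff_eq diff_eq_eq)
  then have "card {w. w ^ CARD('a) - w = z} = CARD('a)"
    by (simp add: card_image inj_on_def)
  moreover have "{w \<in> GF_ext n. w ^ CARD('a) - w = z} = (if tr n z = 0 then {w. w ^ CARD('a) - w = z} else {})"
    using iff by auto
  ultimately show ?thesis by simp
qed

lemma tr_subfield:
  assumes z: "z \<in> (GF_ext t :: 'a alg_closure set)"
  shows "tr (t * f) z = of_nat f * tr t z"
proof (induction f)
  case (Suc f)
  have split: "(\<Sum>i<a + b. g i) = (\<Sum>i<a. g i) + (\<Sum>i<b. g (a + i))" for a b and g :: "nat \<Rightarrow> 'a alg_closure"
    by (induction b) (simp_all add: add.assoc)
  have "tr (t * Suc f) z = (\<Sum>i<t * f + t. z ^ (CARD('a) ^ i))" by (simp add: tr_def add.commute)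
  also have "\<dots> = tr (t * f) z + (\<Sum>i<t. z ^ (CARD('a) ^ (t * f + i)))"
    by (simp add: tr_def split)
  also have "(\<Sum>i<t. z ^ (CARD('a) ^ (t * f + i))) = tr t z"
    by (simp add: tr_def power_add power_mult[of z] GF_ext_power[OF z])
  finally show ?case using Suc by (simp add: algebra_simps)
qed (simp add: tr_def)

section \<open>Degree over the base field\<close>

text \<open>Each line extension multiplies the size by \<open>q\<close>. The closure properties are
  carried through the induction since they give the injectivity: two different multiples of
  \<open>v\<close> agreeing modulo \<open>E\<close> would put \<open>v\<close> into
  \<open>E\<close>.\<close>

lemma dimension_card:
  assumes "ring.dimension ring_of_type_algebra n (range (to_ac :: 'a \<Rightarrow> _)) E"
  shows "finite E \<and> card E = CARD('a) ^ n \<and> 0 \<in> E \<and> (\<forall>x\<in>E. \<forall>y\<in>E. x - y \<in> E) \<and> (\<forall>a. \<forall>x\<in>E. to_ac a * x \<in> E)"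
proof -
  interpret ring "ring_of_type_algebra :: 'a alg_closure ring" by (rule ring_from_type_algebra)
  have "K = range to_ac \<Longrightarrow> ?thesis" if "dimension n K E" for K
    using that
  proof (induction rule: dimension.induct)
    case (zero_dim K)
    then show ?case by simp
  next
    case (Suc_dim v E n K)
    then have E: "finite E" "card E = CARD('a) ^ n" "0 \<in> E" and sub: "\<And>x y. x \<in> E \<Longrightarrow> y \<in> E \<Longrightarrow> x - y \<in> E"
      and scale: "\<And>a x. x \<in> E \<Longrightarrow> to_ac a * x \<in> E"
      by auto
    have add: "x + y \<in> E" if "x \<in> E" "y \<in> E" for x y
      using sub[OF that(1) sub[OF E(3) that(2)]] by simp
    define f where "f = (\<lambda>(a :: 'a, e). to_ac a * v + e)"
    have eq: "line_extension K v E = f ` (UNIV \<times> E)"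
      using Suc_dim.prems by (auto simp: f_def line_extension_mem_iff image_iff) blast
    have "inj_on f (UNIV \<times> E)"
    proof (rule inj_onI, clarify)
      fix a b e e' assume e: "e \<in> E" "e' \<in> E" and "f (a, e) = f (b, e')"
      then have *: "to_ac (a - b) * v = e' - e" by (simp add: f_def algebra_simps)
      have "a = b"
      proof (rule ccontr)
        assume "a \<noteq> b"
        then have "v = to_ac (inverse (a - b)) * (e' - e)"
          unfolding *[symmetric] by (simp del: to_ac_diff)
        then have "v \<in> E" using scale[OF sub[OF e(2) e(1)], of "inverse (a - b)"] by metis
        then show False using Suc_dim by simp
      qed
      then show "a = b \<and> e = e'" using * by simp
    qed
    then have "card (line_extension K v E) = CARD('a) ^ Suc n"
      by (simp add: eq card_image card_cartesian_product E)
    moreover have "finite (line_extension K v E)" using E by (simp add: eq)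
    moreover have "0 \<in> line_extension K v E"
      unfolding eq using E(3) by (intro image_eqI[of _ _ "(0, 0)"]) (auto simp: f_def)
    moreover have "x - y \<in> line_extension K v E" if xy: "x \<in> line_extension K v E" "y \<in> line_extension K v E" for x y
    proof -
      obtain a e b e' where "x = f (a, e)" "y = f (b, e')" "e \<in> E" "e' \<in> E" using xy by (auto simp: eq)
      then have "x - y = f (a - b, e - e')" "e - e' \<in> E" using sub by (auto simp: f_def algebra_simps)
      then show ?thesis by (auto simp: eq)
    qed
    moreover have "to_ac b * x \<in> line_extension K v E" if x: "x \<in> line_extension K v E" for b x
    proof -
      obtain a e where "x = f (a, e)" "e \<in> E" using x by (auto simp: eq)
      then have "to_ac b * x = f (b * a, to_ac b * e)" "to_ac b * e \<in> E" using scale by (auto simp: f_def algebra_simps)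
      then show ?thesis by (auto simp: eq)
    qed
    ultimately show ?case by blast
  qed
  then show ?thesis using assms by blast
qed

text \<open>A subspace of \<open>E\<close> of dimension \<open>n\<close> has \<open>q ^ n\<close>
  elements, which bounds \<open>n\<close>; a subspace of greatest dimension must be
  \<open>E\<close>, since otherwise it could be extended by a vector.\<close>

lemma dimension_exists:
  assumes E: "finite E" "0 \<in> E" "\<And>x y. x \<in> E \<Longrightarrow> y \<in> E \<Longrightarrow> x + y \<in> E" "\<And>a x. x \<in> E \<Longrightarrow> to_ac (a::'a) * x \<in> E"
  shows "\<exists>n. ring.dimension ring_of_type_algebra n (range (to_ac :: 'a \<Rightarrow> _)) E"
proof -
  interpret ring "ring_of_type_algebra :: 'a alg_closure ring" by (rule ring_from_type_algebra)
  let ?P = "\<lambda>n. \<exists>E'. dimension n (range (to_ac :: 'a \<Rightarrow> _)) E' \<and> E' \<subseteq> E"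
  have "dimension 0 (range (to_ac :: 'a \<Rightarrow> _)) {0}" using zero_dim by simp
  then have P0: "?P 0" using E(2) by blast
  have bound: "n \<le> card E" if "?P n" for n
  proof -
    obtain E' where "dimension n (range (to_ac :: 'a \<Rightarrow> _)) E'" "E' \<subseteq> E" using \<open>?P n\<close> by blast
    then have "CARD('a) ^ n \<le> card E" using dimension_card E(1) by (metis card_mono)
    moreover have "n < CARD('a) ^ n" using CARD_ge_2[where ?'a = 'a] by (intro power_gt_expt) auto
    ultimately show ?thesis by linarith
  qed
  have "?P (Greatest ?P)" using GreatestI_nat[of ?P, OF P0] bound by blast
  then obtain E' where E': "dimension (Greatest ?P) (range (to_ac :: 'a \<Rightarrow> _)) E'" "E' \<subseteq> E" by blast
  have "E' = E"
  proof (rule ccontr)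
    assume "E' \<noteq> E"
    then obtain v where v: "v \<in> E" "v \<notin> E'" using E'(2) by blast
    then have "dimension (Suc (Greatest ?P)) (range (to_ac :: 'a \<Rightarrow> _)) (line_extension (range to_ac) v E')"
      using E'(1) by (intro Suc_dim) auto
    moreover have "line_extension (range to_ac) v E' \<subseteq> E"
      using E'(2) v(1) by (auto simp: line_extension_mem_iff intro!: E(3,4))
    ultimately have "?P (Suc (Greatest ?P))" by blast
    then have "Suc (Greatest ?P) \<le> Greatest ?P" using Greatest_le_nat[of ?P] bound by blast
    then show False by simp
  qed
  then show ?thesis using E'(1) by blast
qed

text \<open>The field generated by \<open>z\<close> has \<open>q ^ e\<close> elements for some
  \<open>e\<close>, so it lies in \<open>GF_ext e\<close>, and membership of \<open>z\<close> in
  \<open>GF_ext t\<close> forces \<open>q ^ e \<le> q ^ t\<close>. Thus \<open>e\<close> is the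
  least positive \<open>t\<close> with \<open>z\<close> in \<open>GF_ext t\<close>;
  \<open>t = 0\<close> would give the whole closure.\<close>

lemma has_degree_iff:
  assumes m: "m \<ge> 1" and z: "z \<in> (GF_ext m :: 'a alg_closure set)"
  shows "has_degree z m \<longleftrightarrow> (\<forall>t. 1 \<le> t \<and> t < m \<longrightarrow> z \<notin> GF_ext t)"
proof -
  let ?E = "generate_field ring_of_type_algebra (insert z (range to_ac))"
  interpret field "ring_of_type_algebra :: 'a alg_closure ring" by (rule field_from_type_algebra)
  note Efield = is_subfieldD[OF is_subfield_generate_field[of "insert z (range to_ac)"]]
  have E: "?E \<subseteq> GF_ext t" if zt: "z \<in> GF_ext t" for t
    using zt to_ac_in_GF_ext by (intro generate_field_least[OF is_subfield_GF_ext]) auto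
  have zE: "z \<in> ?E" by (intro generate_field.incl) auto
  have toE: "to_ac a \<in> ?E" for a by (intro generate_field.incl) auto
  have "finite ?E" using E[OF z] GF_ext_finite(1)[OF m] finite_subset by blast
  then obtain e where e: "dimension e (range to_ac) ?E"
    using dimension_exists[of ?E] toE Efield(2,4,6) by blast
  have in_ext: "?E \<subseteq> GF_ext n" if n: "dimension n (range to_ac) ?E" for n
  proof
    have card: "finite ?E" "card ?E = CARD('a) ^ n" using dimension_card[OF n] by auto
    fix x assume x: "x \<in> ?E"
    show "x \<in> GF_ext n"
    proof (cases "x = 0")
      case True
      then show ?thesis using is_subfieldD(2)[OF is_subfield_GF_ext] by simp
    next
      case False
      note ix = Efield(8)[OF x]
      have "(\<Prod>y\<in>?E - {0}. y) = (\<Prod>y\<in>?E - {0}. x * y)"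
        by (rule prod.reindex_bij_witness[of _ "\<lambda>y. x * y" "\<lambda>y. inverse x * y"])
          (use False Efield(4) x ix in auto)
      also have "\<dots> = x ^ (CARD('a) ^ n - 1) * (\<Prod>y\<in>?E - {0}. y)"
        using card toE[of 0] by (simp add: prod.distrib card_Diff_singleton)
      finally have "x ^ (CARD('a) ^ n - 1) = 1" using card(1) by simp
      then have "x * x ^ (CARD('a) ^ n - 1) = x" by simp
      then show ?thesis by (simp add: GF_ext_def flip: power_Suc)
    qed
  qed
  have e1: "e \<ge> 1"
  proof (rule ccontr)
    assume "\<not> e \<ge> 1"
    then have "card ?E = 1" using dimension_card[OF e] by simp
    moreover have "card {0, 1 :: 'a alg_closure} \<le> card ?E"
      using toE[of 0] toE[of 1] \<open>finite ?E\<close> by (intro card_mono) auto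
    ultimately show False by simp
  qed
  have le: "e \<le> t" if t: "1 \<le> t" "z \<in> GF_ext t" for t
  proof -
    have "CARD('a) ^ e \<le> CARD('a) ^ t"
      using dimension_card[OF e] card_mono[OF GF_ext_finite(1)[OF t(1)] E[OF t(2)]] GF_ext_finite(2)[OF t(1)] by simp
    then show ?thesis using CARD_ge_2[where ?'a = 'a] by (simp add: power_increasing_iff)
  qed
  have uniq: "n = e" if n: "dimension n (range to_ac) ?E" for n
  proof -
    have "CARD('a) ^ n = CARD('a) ^ e" using dimension_card[OF n] dimension_card[OF e] by simp
    then show ?thesis using CARD_ge_2[where ?'a = 'a] by (simp add: power_inject_exp)
  qed
  have "has_degree z m \<longleftrightarrow> m = e" unfolding has_degree_def using uniq[of m] e by blast
  moreover have "z \<in> GF_ext e" using in_ext[OF e] zE by blast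
  ultimately show ?thesis using le e1 m z by (metis linorder_not_less order_antisym_conv nat_less_le)
qed

end

section \<open>The divisor sum\<close>

context
  fixes p r :: nat
  assumes card: "CARD('a::{field, finite}) = p ^ r" and p: "Factorial_Ring.prime p"
begin

text \<open>An element fixed by the powers \<open>e\<close> and \<open>m\<close> of Frobenius is
  fixed by the power \<open>m mod e\<close>, which minimality forces to be zero.\<close>

lemma minimal_degree_dvd:
  assumes z: "z \<in> (GF_ext m :: 'a alg_closure set)" and e: "e \<ge> 1" "z \<in> GF_ext e"
    and min: "\<And>t. 1 \<le> t \<Longrightarrow> t < e \<Longrightarrow> z \<notin> GF_ext t"
  shows "e dvd m"
proof (rule ccontr)
  assume "\<not> e dvd m"
  then have "m mod e \<ge> 1" by (simp add: dvd_eq_mod_eq_0)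
  moreover have "m mod e < e" using e by simp
  moreover have "z \<in> GF_ext (m mod e)"
  proof -
    have "z = z ^ (CARD('a) ^ (e * (m div e) + m mod e))" using z by (simp add: GF_ext_def)
    also have "\<dots> = (z ^ (CARD('a) ^ (e * (m div e)))) ^ (CARD('a) ^ (m mod e))"
      by (simp only: power_add power_mult[of z])
    also have "z ^ (CARD('a) ^ (e * (m div e))) = z" by (rule GF_ext_power[OF card p e(2)])
    finally show ?thesis by (simp add: GF_ext_def)
  qed
  ultimately show False using min by blast
qed

text \<open>Here \<open>p \<le> 3\<close> enters: the nonzero residues modulo 2 and 3 are only
  \<open>1\<close> and \<open>-1\<close>.\<close>

lemma of_nat_eq_unit:
  assumes "p \<in> {2, 3}" "\<not> p dvd f"
  shows "of_nat f = (1 :: 'a alg_closure) \<or> p = 3 \<and> of_nat f = (-1 :: 'a alg_closure)"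
proof -
  have char: "CHAR('a alg_closure) = p" using CHAR_eq_of_CARD[OF card p] by simp
  have p0: "of_nat p = (0 :: 'a alg_closure)" using char of_nat_CHAR by metis
  have "of_nat f = (of_nat (p * (f div p) + f mod p) :: 'a alg_closure)" by simp
  also have "\<dots> = of_nat (f mod p)" using p0 by (simp only: of_nat_add of_nat_mult) simp
  finally have *: "of_nat f = (of_nat (f mod p) :: 'a alg_closure)" .
  have "f mod p \<noteq> 0" "f mod p < p" using assms p by (auto simp: dvd_eq_mod_eq_0 prime_gt_0_nat)
  then consider "f mod p = 1" | "p = 3" "f mod p = 2" using assms by fastforce
  then show ?thesis
  proof cases
    case 2
    then have "(of_nat 3 :: 'a alg_closure) = 0" using p0 by simp
    then have "(2 :: 'a alg_closure) + 1 = 0" by simp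
    then show ?thesis using 2 * by (simp add: eq_neg_iff_add_eq_0)
  qed (use * in simp)
qed

lemma H_count_eq_sum_G_count:
  fixes c :: 'a and d :: int
  assumes p23: "p \<in> {2, 3}" and d: "d \<in> {-1, 3}" "d = 3 \<longrightarrow> p = 2" and c: "c \<noteq> 0" and s: "\<not> p dvd s"
  shows "H_count c d (p ^ k * s) = (\<Sum>t | t dvd s. G_count c d (p ^ k * t))"
proof -
  note sub = is_subfieldD[OF is_subfield_GF_ext[OF card p]]
  have p0: "p > 0" using p by (simp add: prime_gt_0_nat)
  have s0: "s > 0" using s by (auto intro: gr0I)
  have fin: "finite {t. t dvd s}" using s0 by simp
  define M where "M = p ^ k * s"
  have M: "M \<ge> 1" using p0 s0 by (simp add: M_def Suc_leI)
  define H where "H = {z \<in> GF_ext M. tr M z = 0 \<and> tr M (z powi d) = to_ac c}"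
  define A where "A t = {z \<in> H. z \<in> GF_ext (p ^ k * t) \<and> has_degree z (p ^ k * t)}" for t
  have finH: "finite H" using GF_ext_finite(1)[OF card p M] by (auto simp: H_def)
  have pos: "p ^ k * t \<ge> 1" if "t dvd s" for t
    using that s0 p0 by (cases "t = 0") (auto simp: Suc_leI)
  have deg: "has_degree z (p ^ k * t) \<longleftrightarrow> (\<forall>i. 1 \<le> i \<and> i < p ^ k * t \<longrightarrow> z \<notin> GF_ext i)"
    if "t dvd s" "z \<in> (GF_ext (p ^ k * t) :: 'a alg_closure set)" for t z
    using has_degree_iff[OF card p pos[OF that(1)] that(2)] .
  have HA: "H = (\<Union>t\<in>{t. t dvd s}. A t)"
  proof
    show "H \<subseteq> (\<Union>t\<in>{t. t dvd s}. A t)"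
    proof
      fix z assume z: "z \<in> H"
      then have zM: "z \<in> GF_ext M" and tr: "tr M (z powi d) = to_ac c" by (auto simp: H_def)
      define e where "e = (LEAST e. 1 \<le> e \<and> z \<in> GF_ext e)"
      have e: "1 \<le> e \<and> z \<in> GF_ext e" unfolding e_def by (rule LeastI[of _ M]) (use zM M in simp)
      have min: "z \<notin> GF_ext i" if "1 \<le> i" "i < e" for i
        using not_less_Least[of i "\<lambda>e. 1 \<le> e \<and> z \<in> GF_ext e"] that by (auto simp: e_def)
      have "e dvd M" using minimal_degree_dvd[OF zM _ _ min] e by blast
      then obtain f where f: "M = e * f" by auto
      have "\<not> p dvd f"
      proof
        assume "p dvd f"
        then have "of_nat f = (0 :: 'a alg_closure)"
          using CHAR_eq_of_CARD[OF card p] by (simp add: of_nat_eq_0_iff_char_dvd)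
        then have "tr M (z powi d) = 0"
          using tr_subfield[OF card p, of "z powi d" e f] sub(10)[of z e d] e by (simp add: f)
        then show False using tr c by simp
      qed
      then have "coprime (p ^ k) f" using p by (simp add: prime_imp_coprime)
      moreover have "p ^ k dvd e * f" using f by (metis M_def dvd_triv_left)
      ultimately have "p ^ k dvd e" by (simp add: coprime_dvd_mult_left_iff)
      then obtain t where t: "e = p ^ k * t" by auto
      have "t dvd s" using f t p0 by (simp add: M_def)
      moreover have "z \<in> A t"
        using z e min deg[OF \<open>t dvd s\<close>, of z] by (auto simp: A_def t)
      ultimately show "z \<in> (\<Union>t\<in>{t. t dvd s}. A t)" by blast
    qed
  qed (auto simp: A_def)
  have "card (A t) = G_count c d (p ^ k * t)" if t: "t dvd s" for t
  proof -
    define m where "m = p ^ k * t"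
    define B where "B = {z \<in> GF_ext m. has_degree z m \<and> tr m z = 0 \<and> tr m (z powi d) = to_ac c}"
    obtain f where f: "s = t * f" using t by auto
    define \<epsilon> where "\<epsilon> = (of_nat f :: 'a alg_closure)"
    have "\<not> p dvd f" using s by (auto simp: f)
    then have "\<epsilon> = 1 \<or> p = 3 \<and> \<epsilon> = -1" unfolding \<epsilon>_def by (rule of_nat_eq_unit[OF p23])
    \<comment> \<open>For \<open>d = 3\<close> the characteristic is 2 and the sign disappears; for
      \<open>d = -1\<close> a sign passes through inversion. In both cases \<open>\<epsilon>\<close>
      can be taken out of \<open>powi d\<close>.\<close>
    then have eps: "\<epsilon> = 1 \<or> d = -1 \<and> \<epsilon> = -1" using d by auto
    then have ee: "\<epsilon> * \<epsilon> = 1" and eps_powi: "(\<epsilon> * z) powi d = \<epsilon> * z powi d" for z by auto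
    have Mm: "M = m * f" by (simp add: M_def m_def f)
    have eps_mem: "\<epsilon> * z \<in> GF_ext n" if "z \<in> GF_ext n" for z n
      using eps that sub(5)[of z n] by auto
    have eps_iff: "\<epsilon> * z \<in> GF_ext n \<longleftrightarrow> z \<in> GF_ext n" for z n
      using eps_mem[of z n] eps_mem[of "\<epsilon> * z" n] ee by (auto simp flip: mult.assoc)
    have eps_deg: "has_degree (\<epsilon> * z) m \<longleftrightarrow> has_degree z m" if "z \<in> GF_ext m" for z
      using deg[OF t, of z] deg[OF t, of "\<epsilon> * z"] that by (simp add: eps_iff flip: m_def)
    have eps_tr: "tr m (\<epsilon> * z) = \<epsilon> * tr m z" for z
      using eps tr_uminus[OF card p, of m z] by auto
    have tr_M: "tr M z = \<epsilon> * tr m z" if "z \<in> GF_ext m" for z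
      unfolding Mm \<epsilon>_def by (rule tr_subfield[OF card p that])
    have mM: "z \<in> GF_ext M" if "z \<in> GF_ext m" for z :: "'a alg_closure"
      using GF_ext_mono[OF card p, of m M] that by (auto simp: Mm)
    have A_iff: "z \<in> A t \<longleftrightarrow> z \<in> GF_ext m \<and> has_degree z m \<and> \<epsilon> * tr m z = 0 \<and> \<epsilon> * tr m (z powi d) = to_ac c" for z
      using mM[of z] tr_M[of z] tr_M[of "z powi d"] sub(10)[of z m d]
      by (auto simp: A_def H_def simp flip: m_def)
    have e0: "\<epsilon> \<noteq> 0" using ee by auto
    \<comment> \<open>Passing from trace \<open>m\<close> to trace \<open>M\<close> multiplies by
      \<open>\<epsilon>\<close>, which the substitution of \<open>\<epsilon> * z\<close> for
      \<open>z\<close> undoes. As \<open>\<epsilon> * \<epsilon> = 1\<close>, the substitution is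
      its own inverse.\<close>
    have "bij_betw (\<lambda>z. \<epsilon> * z) (A t) B"
    proof (rule bij_betwI[where g = "\<lambda>z. \<epsilon> * z"])
      show "(\<lambda>z. \<epsilon> * z) \<in> A t \<rightarrow> B"
        by (auto simp: A_iff B_def eps_iff eps_deg eps_tr eps_powi)
      show "(\<lambda>z. \<epsilon> * z) \<in> B \<rightarrow> A t"
        using ee e0 by (auto simp: A_iff B_def eps_iff eps_deg eps_tr eps_powi simp flip: mult.assoc)
      show "\<epsilon> * (\<epsilon> * z) = z" for z using ee by (simp flip: mult.assoc)
      show "\<epsilon> * (\<epsilon> * z) = z" for z using ee by (simp flip: mult.assoc)
    qed
    then show ?thesis by (simp add: bij_betw_same_card G_count_def B_def m_def)
  qed
  moreover have "A t \<inter> A t' = {}" if "t dvd s" "t' dvd s" "t \<noteq> t'" for t t'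
  proof -
    have "p ^ k * t \<noteq> p ^ k * t'" using that(3) p0 by simp
    then have "p ^ k * t < p ^ k * t' \<or> p ^ k * t' < p ^ k * t" by linarith
    then show ?thesis
      using deg[OF that(1)] deg[OF that(2)] pos[OF that(1)] pos[OF that(2)] by (fastforce simp: A_def)
  qed
  moreover have "card (\<Union>t\<in>{t. t dvd s}. A t) = (\<Sum>t\<in>{t. t dvd s}. card (A t))"
    using finH calculation(2) fin by (intro card_UN_disjoint) (auto simp: A_def)
  ultimately have "card H = (\<Sum>t | t dvd s. G_count c d (p ^ k * t))"
    unfolding HA by simp
  then show ?thesis by (simp add: H_count_def H_def M_def)
qed

lemma G_count_eq_moebius_sum:
  fixes c :: 'a and d :: int
  assumes p23: "p \<in> {2, 3}" and d: "d \<in> {-1, 3}" "d = 3 \<longrightarrow> p = 2" and c: "c \<noteq> 0" and s: "\<not> p dvd s"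
  shows "int (G_count c d (p ^ k * s)) = (\<Sum>t | t dvd s. moebius (s div t) * int (H_count c d (p ^ k * t)))"
proof (rule moebius_inversion)
  show "s > 0" using s by (auto intro: gr0I)
  show "int (H_count c d (p ^ k * t)) = (\<Sum>e | e dvd t. int (G_count c d (p ^ k * e)))" if "t dvd s" for t
    using H_count_eq_sum_G_count[OF p23 d c, of t k] s that by (metis dvd_trans of_nat_sum)
qed

end

section \<open>The closure of the rational function field\<close>

lemma const_fun_simps [simp]:
  "const_fun (0 :: 'a::field alg_closure) = 0" "const_fun (1 :: 'a alg_closure) = 1"
  "const_fun (a + b :: 'a alg_closure) = const_fun a + const_fun b"
  "const_fun (a - b) = const_fun a - const_fun b" "const_fun (- a) = - const_fun a"
  "const_fun (a * b) = const_fun a * const_fun b" "const_fun (a ^ i) = const_fun a ^ i"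
  "const_fun (inverse a) = inverse (const_fun a)" "const_fun a = const_fun b \<longleftrightarrow> a = b"
proof -
  show 0: "const_fun (0 :: 'a alg_closure) = 0" and 1: "const_fun (1 :: 'a alg_closure) = 1"
    using Zero_fract_def[where ?'a = "'a alg_closure poly"] One_fract_def[where ?'a = "'a alg_closure poly"]
    by (simp_all add: const_fun_def pCons_one)
  show "const_fun (a + b) = const_fun a + const_fun b" for a b
    by (simp add: const_fun_def flip: to_ac_add)
  show "const_fun (a - b) = const_fun a - const_fun b" for a b
    by (simp add: const_fun_def flip: to_ac_diff)
  show "const_fun (- a) = - const_fun a" for a
    by (simp add: const_fun_def flip: to_ac_minus)
  show mult: "const_fun (a * b) = const_fun a * const_fun b" for a b
    by (simp add: const_fun_def mult.commute flip: to_ac_mult)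
  show "const_fun (a ^ i) = const_fun a ^ i"
    by (induction i) (simp_all add: 1 mult)
  show "const_fun a = const_fun b \<longleftrightarrow> a = b" for a b
    by (simp add: const_fun_def eq_fract)
  show "const_fun (inverse a) = inverse (const_fun a)"
    by (cases "a = 0") (auto simp: 0 1 intro!: inverse_unique[symmetric] simp flip: mult)
qed

lemma const_fun_eq_0_iff [simp]: "const_fun a = 0 \<longleftrightarrow> a = 0"
  by (metis const_fun_simps(1,9))

lemma const_fun_plus_x_fun_mult: "const_fun a + x_fun * to_ac (Fract P 1) = to_ac (Fract (pCons a P) 1)"
  by (simp add: const_fun_def x_fun_def flip: to_ac_add to_ac_mult)

lemma is_subfield_image_const_fun:
  assumes "is_subfield K"
  shows "is_subfield (const_fun ` K)"
proof -
  note K = is_subfieldD[OF assms]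
  have "1 \<in> const_fun ` K" by (rule image_eqI[of _ _ 1]) (simp_all add: K(1))
  moreover have "const_fun a - const_fun b \<in> const_fun ` K" "const_fun a * const_fun b \<in> const_fun ` K"
    "inverse (const_fun a) \<in> const_fun ` K" if ab: "a \<in> K" "b \<in> K" for a b
    using K(3)[OF ab] K(4)[OF ab] K(8)[OF ab(1)]
    by (auto intro: image_eqI[of _ _ "a - b"] image_eqI[of _ _ "a * b"] image_eqI[of _ _ "inverse a"])
  ultimately show ?thesis by (auto simp: is_subfield_def is_subring_def)
qed

abbreviation "const_funs \<equiv> range const_fun"

lemma is_subfield_const_funs: "is_subfield const_funs"
  by (rule is_subfield_image_const_fun) (simp add: is_subfield_def is_subring_def)

lemma poly_x_fun:
  "coeffs_in const_funs p \<Longrightarrow> \<exists>p0. poly p (x_fun :: 'a::field fun_closure) = to_ac (Fract p0 1) \<and> (p \<noteq> 0 \<longrightarrow> p0 \<noteq> 0)"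
proof (induction p)
  case 0
  then show ?case by (intro exI[of _ 0]) (simp add: Zero_fract_def[symmetric])
next
  case (pCons a p)
  note sub = is_subfieldD(11)[OF is_subfield_const_funs]
  obtain c where a: "a = const_fun c" and "coeffs_in const_funs p"
    using pCons.prems by (auto simp: coeffs_in_pCons_iff[OF sub])
  then obtain p0 where p0: "poly p x_fun = to_ac (Fract p0 1)" "p \<noteq> 0 \<longrightarrow> p0 \<noteq> 0" using pCons.IH by blast
  have "poly (pCons a p) x_fun = to_ac (Fract (pCons c p0) 1)"
    by (simp add: a p0 const_fun_plus_x_fun_mult)
  then show ?case using p0(2) pCons.hyps by (intro exI[of _ "pCons c p0"]) (auto simp: a)
qed

lemma x_fun_transcendental:
  assumes "coeffs_in const_funs p" "p \<noteq> 0"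
  shows "poly p x_fun \<noteq> 0"
  using poly_x_fun[OF assms(1)] assms(2) by (auto simp: Zero_fract_def eq_fract)

lemma x_fun_notin_const_funs: "(x_fun :: 'a::field fun_closure) \<notin> const_funs"
proof
  assume x: "(x_fun :: 'a fun_closure) \<in> const_funs"
  note sub = is_subfieldD[OF is_subfield_const_funs[where ?'a = 'a]]
  have "- (x_fun :: 'a fun_closure) \<in> const_funs" by (rule sub(5)[OF x])
  then have "coeffs_in const_funs [:- x_fun, 1 :: 'a fun_closure:]"
    using sub(1) by (simp add: coeffs_in_pCons_iff[OF sub(11)] coeffs_in_0[OF sub(11)])
  from x_fun_transcendental[OF this] show False by simp
qed

text \<open>The constants are algebraically closed, so they are relatively algebraically closed.\<close>

lemma transcendental_over_const_funs:
  fixes w :: "'a::field fun_closure"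
  assumes w: "w \<notin> const_funs" and p: "coeffs_in const_funs p" "p \<noteq> 0"
  shows "poly p w \<noteq> 0"
proof -
  define ev where "ev P = poly (map_poly const_fun P) w" for P :: "'a alg_closure poly"
  have ev_0: "ev 0 = 0" and ev_pCons: "ev (pCons a P) = const_fun a + w * ev P" for a P
    by (simp_all add: ev_def map_poly_pCons)
  have ev_add: "ev (P + Q) = ev P + ev Q" for P Q
    by (induction P Q rule: poly_induct2) (simp_all add: ev_0 ev_pCons algebra_simps)
  have ev_smult: "ev (smult a P) = const_fun a * ev P" for a P
    by (induction P) (simp_all add: ev_0 ev_pCons algebra_simps)
  have ev_mult: "ev (P * Q) = ev P * ev Q" for P Q
    by (induction P) (simp_all add: ev_0 ev_pCons ev_add ev_smult algebra_simps)
  have ev: "ev P \<noteq> 0" if "P \<noteq> 0" for P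
    using that
  proof (induction "Polynomial.degree P" arbitrary: P rule: less_induct)
    case less
    show ?case
    proof (cases "Polynomial.degree P = 0")
      case True
      then obtain a where "P = [:a:]" by (metis degree_eq_zeroE)
      then show ?thesis using less.prems by (simp add: ev_0 ev_pCons)
    next
      case False
      then obtain a where "poly P a = 0" using alg_closed_imp_poly_has_root[of P] by auto
      then obtain Q where Q: "P = [:- a, 1:] * Q" by (metis poly_eq_0_iff_dvd dvdE)
      then have "Q \<noteq> 0" using less.prems by auto
      then have "Polynomial.degree P = Suc (Polynomial.degree Q)" unfolding Q by (subst degree_mult_eq) auto
      then have "ev Q \<noteq> 0" using less.hyps \<open>Q \<noteq> 0\<close> by auto
      moreover have "ev [:- a, 1:] = w - const_fun a" by (simp add: ev_0 ev_pCons)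
      moreover have "w - const_fun a \<noteq> 0" using w by auto
      ultimately show ?thesis unfolding Q ev_mult by simp
    qed
  qed
  define P where "P = map_poly (inv_into UNIV const_fun) p"
  have inj: "inj const_fun" by (simp add: inj_on_def)
  have inv0: "inv_into UNIV const_fun 0 = 0" using inv_f_f[OF inj, of 0] by simp
  have "map_poly const_fun P = p"
    using p(1) by (intro poly_eqI) (simp add: P_def coeff_map_poly[of "inv_into UNIV const_fun", OF inv0] coeff_map_poly coeffs_in_def f_inv_into_f)
  moreover from this have "P \<noteq> 0" using p(2) by auto
  ultimately show ?thesis using ev[of P] by (simp add: ev_def)
qed

text \<open>Denominators in \<open>x\<close> are cleared from an algebraic equation of
  \<open>z\<close>, and powers of the variable are cancelled because \<open>z\<close> is nonzero.
  The nonzero constant coefficient exhibits a nonzero polynomial in \<open>x\<close> as a multiple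
  of \<open>z\<close>.\<close>

lemma fun_closure_algebraic:
  fixes z :: "'a::field fun_closure"
  assumes z: "z \<noteq> 0"
  shows "\<exists>Q. coeffs_in2 const_funs Q \<and> Polynomial.coeff Q 0 \<noteq> 0 \<and> eval2 Q x_fun z = 0"
proof -
  note sub = is_subfieldD(11)[OF is_subfield_const_funs]
  have frac: "\<exists>n e. coeffs_in const_funs n \<and> coeffs_in const_funs e \<and> e \<noteq> 0 \<and> (a \<noteq> 0 \<longrightarrow> n \<noteq> 0) \<and> to_ac a * poly e x_fun = poly n x_fun"
    for a :: "'a alg_closure poly fract"
  proof -
    obtain n e where a: "a = Fract n e" "e \<noteq> 0" by (cases a) auto
    have P: "coeffs_in const_funs (map_poly const_fun P) \<and> poly (map_poly const_fun P) x_fun = to_ac (Fract P 1)" for P :: "'a alg_closure poly"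
    proof
      show "coeffs_in const_funs (map_poly const_fun P)" by (auto simp: coeffs_in_def coeff_map_poly)
      show "poly (map_poly const_fun P) x_fun = to_ac (Fract P 1)"
        by (induction P) (simp_all add: map_poly_pCons const_fun_plus_x_fun_mult flip: Zero_fract_def)
    qed
    have nz: "map_poly const_fun P \<noteq> 0" if "P \<noteq> 0" for P :: "'a alg_closure poly"
      using that by (subst map_poly_eq_0_iff) auto
    have "to_ac a * to_ac (Fract e 1) = to_ac (Fract n 1)" using a by (simp add: eq_fract flip: to_ac_mult)
    moreover have "a \<noteq> 0 \<Longrightarrow> n \<noteq> 0" using a by (auto simp: Zero_fract_def eq_fract)
    ultimately show ?thesis
      using P nz[of e] nz[of n] a by (intro exI[of _ "map_poly const_fun n"] exI[of _ "map_poly const_fun e"]) auto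
  qed
  have clear: "\<exists>Q D. coeffs_in2 const_funs Q \<and> coeffs_in const_funs D \<and> D \<noteq> 0 \<and>
      (Polynomial.coeff P 0 \<noteq> 0 \<longrightarrow> Polynomial.coeff Q 0 \<noteq> 0) \<and>
      eval2 Q x_fun z = poly D x_fun * poly (map_poly to_ac P) z" for P :: "'a alg_closure poly fract poly"
  proof (induction P)
    case 0
    show ?case by (intro exI[of _ 0] exI[of _ 1]) (simp add: coeffs_in_0 coeffs_in_1[OF sub] coeffs_in_is_subring[OF sub])
  next
    case (pCons a P)
    then obtain Q D where Q: "coeffs_in2 const_funs Q" "coeffs_in const_funs D" "D \<noteq> 0"
      "eval2 Q x_fun z = poly D x_fun * poly (map_poly to_ac P) z" by blast
    obtain n e where n: "coeffs_in const_funs n" "coeffs_in const_funs e" "e \<noteq> 0" "a \<noteq> 0 \<longrightarrow> n \<noteq> 0"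
      "to_ac a * poly e x_fun = poly n x_fun" using frac by blast
    have "coeffs_in2 const_funs (pCons (D * n) (smult e Q))"
      using Q n by (simp add: coeffs_in2_pCons_iff[OF sub] coeffs_in2_smult[OF sub] coeffs_in_mult[OF sub])
    moreover have "coeffs_in const_funs (D * e)" using Q n by (simp add: coeffs_in_mult[OF sub])
    moreover have "eval2 (pCons (D * n) (smult e Q)) x_fun z = poly (D * e) x_fun * poly (map_poly to_ac (pCons a P)) z"
      using Q(4) by (simp add: map_poly_pCons n(5)[symmetric] algebra_simps)
    ultimately show ?case using Q(3) n(3,4) by (intro exI[of _ "pCons (D * n) (smult e Q)"] exI[of _ "D * e"]) auto
  qed
  obtain P where P: "P \<noteq> 0" "poly (map_poly to_ac P) z = 0" by (rule alg_closure_algebraic)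
  have "\<exists>P. Polynomial.coeff P 0 \<noteq> 0 \<and> poly (map_poly to_ac P) z = 0"
    using P
  proof (induction P)
    case (pCons a P)
    then show ?case
    proof (cases "a = 0")
      case True
      then have "poly (map_poly to_ac P) z = 0" "P \<noteq> 0" using pCons.prems z by (auto simp: map_poly_pCons)
      then show ?thesis using pCons.IH by blast
    next
      case False
      then show ?thesis using pCons.prems by (intro exI[of _ "pCons a P"]) auto
    qed
  qed simp
  then obtain P where "Polynomial.coeff P 0 \<noteq> 0" "poly (map_poly to_ac P) z = 0" by blast
  then show ?thesis using clear[of P] by auto
qed

lemma poly_split_power:
  assumes B: "is_subring (B :: 'b::field set)"
  shows "coeffs_in B p \<Longrightarrow> p \<noteq> 0 \<Longrightarrow> \<exists>k p1. coeffs_in B p1 \<and> poly p1 0 \<noteq> 0 \<and> (\<forall>t. poly p t = t ^ k * poly p1 t)"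
proof (induction p)
  case (pCons a p)
  show ?case
  proof (cases "a = 0")
    case True
    then obtain k p1 where "coeffs_in B p1" "poly p1 0 \<noteq> 0" "\<forall>t. poly p t = t ^ k * poly p1 t"
      using pCons by (auto simp: coeffs_in_pCons_iff[OF B])
    then show ?thesis using True by (intro exI[of _ "Suc k"] exI[of _ p1]) simp
  next
    case False
    then show ?thesis using pCons.prems by (intro exI[of _ 0] exI[of _ "pCons a p"]) auto
  qed
qed simp

text \<open>A valuation of the closure, trivial on the constants and centred at \<open>w0\<close>, has rank one.\<close>

lemma order_finite:
  fixes w z :: "'a::field fun_closure"
  assumes q: "q \<ge> 1" and w: "w ^ q - w = x_fun" and V: "is_valring UNIV V" and CV: "const_funs \<subseteq> V"
    and w0: "w0 \<in> const_funs" and wN: "w - w0 \<in> nonunits V" and z: "z \<noteq> 0"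
  shows "\<exists>k. z / (w - w0) ^ k \<notin> V"
proof (rule ccontr)
  assume "\<nexists>k. z / (w - w0) ^ k \<notin> V"
  then have zV: "z / (w - w0) ^ k \<in> V" for k by blast
  note C = is_subfield_const_funs[where ?'a = 'a]
  note sub = is_subfieldD[OF C] and sV = is_valring_subringD[OF V]
  note sub' = sub(11)
  define T where "T = w - w0"
  have T: "T \<in> nonunits V" using wN by (simp add: T_def)
  obtain Q where Q: "coeffs_in2 const_funs Q" "Polynomial.coeff Q 0 \<noteq> 0" "eval2 Q x_fun z = 0"
    using fun_closure_algebraic[OF z] by blast
  obtain a R where QR: "Q = pCons a R" by (rule pCons_cases)
  have a: "coeffs_in const_funs a" "a \<noteq> 0" and R: "coeffs_in2 const_funs R"
    using Q(1,2) by (auto simp: QR coeffs_in2_pCons_iff[OF sub'])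
  have z1: "z \<in> V" using zV[of 0] by simp
  have w1: "w \<in> V" using sV(6)[of "w - w0" w0] w0 CV wN nonunits_subset by auto
  have x1: "x_fun \<in> V" unfolding w[symmetric] by (intro sV w1)
  define v where "v = eval2 R x_fun z"
  have v: "v \<in> V" unfolding v_def by (intro eval2_in_subring[OF sub' is_valringD(1)[OF V]] CV x1 z1 R)
  \<comment> \<open>By this multiple, divisibility of \<open>z\<close> by all powers of
    \<open>w - w0\<close> passes to a nonzero polynomial in \<open>x\<close>.\<close>
  have ax: "poly a x_fun = - (z * v)" using Q(3) by (simp add: QR v_def eq_neg_iff_add_eq_0)
  \<comment> \<open>\<open>x = w ^ q - w\<close> and \<open>w = w0 + T\<close> rewrite
    \<open>a\<close> at \<open>x\<close> as a polynomial in \<open>T\<close> with constant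
    coefficients.\<close>
  define b where "b = pcompose a (pcompose (Polynomial.monom 1 q - [:0, 1:]) [:w0, 1:])"
  have b: "coeffs_in const_funs b"
    unfolding b_def
    by (intro coeffs_in_pcompose[OF sub'] coeffs_in_diff[OF sub'] coeffs_in_monom[OF sub'] a)
      (use w0 sub(1,2) in \<open>auto simp: coeffs_in_pCons_iff[OF sub'] coeffs_in_0[OF sub']\<close>)
  have bT: "poly b T = poly a x_fun" by (simp add: b_def poly_pcompose poly_monom T_def w)
  have "b \<noteq> 0" using x_fun_transcendental[OF a] bT by auto
  then obtain k b1 where b1: "coeffs_in const_funs b1" "poly b1 0 \<noteq> 0" "\<And>t. poly b t = t ^ k * poly b1 t"
    using poly_split_power[OF sub' b] by auto
  have T0: "T \<noteq> 0" using bT b1(3)[of T] x_fun_transcendental[OF a] w sub(4,3,7) w0 x_fun_notin_const_funs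
    by (metis T_def eq_iff_diff_eq_0)
  have "T ^ k * poly b1 T = - (z * v)" using b1(3) bT ax by simp
  \<comment> \<open>One power of \<open>T\<close> more than the exact factor \<open>T ^ k\<close> is
    available, so \<open>b1\<close> at \<open>T\<close> is a nonunit although its constant term is
    not zero.\<close>
  then have "poly b1 T = T * (z / T ^ Suc k * (- v))" using T0 by (simp add: field_simps)
  also have "\<dots> \<in> nonunits V"
    using zV[of "Suc k"] v by (intro nonunits_mult(1)[OF V T] sV) (simp_all add: T_def)
  finally have "poly b1 T \<in> nonunits V" .
  moreover have "poly b1 T - poly b1 0 \<in> nonunits V" "poly b1 0 \<in> const_funs"
    using poly_cong_nonunits[OF V is_subfield_UNIV C CV sub(2) _ b1(1), of T] T by simp_all
  ultimately have "poly b1 T - (poly b1 T - poly b1 0) \<in> nonunits V"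
    using nonunits_diff[OF V is_subfield_UNIV] by blast
  then show False
    using unit_notin_nonunits[OF V C CV \<open>poly b1 0 \<in> const_funs\<close> b1(2)] by simp
qed

text \<open>Specialising \<open>t\<close> to \<open>0\<close> is well defined on polynomials in
  \<open>t\<close> over the constants, because \<open>t\<close> is transcendental over them.\<close>

lemma ex_valring_centred:
  fixes t :: "'a::field fun_closure"
  assumes t: "t \<notin> const_funs"
  shows "\<exists>V. is_valring UNIV V \<and> const_funs \<subseteq> V \<and> t \<in> nonunits V"
proof -
  note sub = is_subfieldD[OF is_subfield_const_funs[where ?'a = 'a]]
  have "\<exists>V. is_valring UNIV V \<and> (\<lambda>p. poly p t) ` {p. coeffs_in const_funs p} \<subseteq> V \<and>
      (\<lambda>p. poly p t) ` {p \<in> {p. coeffs_in const_funs p}. poly p 0 = 0} \<subseteq> nonunits V"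
  proof (rule ex_valring_of_hom[OF coeffs_in_is_subring[OF sub(11)], where g = "\<lambda>p. poly p 0"])
    show "poly p 0 = 0" if "p \<in> {p. coeffs_in const_funs p}" "poly p t = 0" for p
      using transcendental_over_const_funs[OF t, of p] that by (cases "p = 0") auto
  qed simp_all
  then obtain V where V: "is_valring UNIV V" "\<And>p. coeffs_in const_funs p \<Longrightarrow> poly p t \<in> V"
    "\<And>p. coeffs_in const_funs p \<Longrightarrow> poly p 0 = 0 \<Longrightarrow> poly p t \<in> nonunits V"
    by blast
  have "coeffs_in const_funs [:0, 1 :: 'a fun_closure:]"
    using sub(1,2) by (simp add: coeffs_in_pCons_iff[OF sub(11)] coeffs_in_0[OF sub(11)])
  then have "t \<in> nonunits V" using V(3)[of "[:0, 1:]"] by simp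
  moreover have "c \<in> V" if "c \<in> const_funs" for c
    using V(2)[of "[:c:]"] coeffs_in_const[OF sub(11), of c] that by simp
  ultimately show ?thesis using V(1) by blast
qed

section \<open>Ramified places\<close>

text \<open>A nonzero nonunit is neither a constant nor invertible in \<open>V\<close>, so it
  excludes both \<open>V = C\<close> and the trivial ring \<open>V = F\<close>.\<close>

lemma rational_valring_of_residue:
  assumes C: "is_subfield C" and F: "is_subfield F" and V: "is_valring F V" and CV: "C \<subseteq> V"
    and pi: "\<pi> \<in> nonunits V" "\<pi> \<noteq> 0" and res: "\<forall>z\<in>V. \<exists>c\<in>C. z - c \<in> nonunits V"
  shows "is_rational_valring F C V"
proof -
  have "\<pi> \<notin> C" using unit_notin_nonunits[OF V C CV _ pi(2)] pi(1) by blast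
  moreover have "\<pi> \<in> V" "inverse \<pi> \<notin> V" using pi by (auto simp: nonunits_def)
  moreover from this have "inverse \<pi> \<in> F" using is_valringD(3)[OF V] is_subfieldD(8)[OF F] by blast
  ultimately show ?thesis using V CV res by (auto simp: is_rational_valring_def)
qed

lemma (in valuation_class) rational_valrings:
  assumes all: "\<And>z. z \<in> F \<Longrightarrow> z = 0 \<or> (\<exists>k c. asym z k c)"
  shows "V \<in> \<V> \<Longrightarrow> is_rational_valring F C V" "V \<in> \<V> \<Longrightarrow> V' \<in> \<V> \<Longrightarrow> V = V'"
  using rational_valring_of_residue[OF C F V CV pi pi0] valring_residue[OF all] valring_unique[OF all]
  by blast+

text \<open>A simple pole of \<open>u ^ q - u\<close>: the place is totally ramified and \<open>1 / u\<close> is a uniformiser.\<close>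

lemma ramified_simple_pole:
  fixes t u \<beta> :: "'b::field"
  assumes C: "is_subfield C" and F: "is_subfield F" "C \<subseteq> F" "t \<in> F" "u \<in> F" and \<beta>: "\<beta> \<in> C" and q: "q \<ge> 2"
    and rel: "(t ^ q - t) * (u ^ q - u - \<beta>) = 1" and u0: "u \<noteq> 0"
    and \<V>: "\<And>V. V \<in> \<V> \<Longrightarrow> is_valring F V \<and> C \<subseteq> V \<and> t \<in> nonunits V"
  shows "valuation_class C F \<V> (inverse u)"
    "valuation_class.asym C F \<V> (inverse u) t (int q) (-1)"
    "valuation_class.asym C F \<V> (inverse u) u (-1) 1"
proof -
  note cD = is_subfieldD[OF C] and fD = is_subfieldD[OF F(1)] and sF = F
  define \<pi> where "\<pi> = inverse u"
  have pi: "\<pi> \<in> nonunits V" if "V \<in> \<V>" for V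
  proof -
    have V: "is_valring F V" and CV: "C \<subseteq> V" and t: "t \<in> nonunits V" using \<V>[OF that] by auto
    note vD = is_valring_subringD[OF V]
    have "u \<notin> V"
    proof
      assume u: "u \<in> V"
      have "t ^ q - t \<in> nonunits V"
        using q by (intro nonunits_diff[OF V F(1)] nonunits_power[OF V t] t) auto
      moreover have "u ^ q - u - \<beta> \<in> V" using u \<beta> CV by (intro vD) auto
      ultimately have "1 \<in> nonunits V" using nonunits_mult(1)[OF V] rel by metis
      then show False using one_notin_nonunits[OF V] by simp
    qed
    then show ?thesis unfolding \<pi>_def by (rule inverse_in_nonunits[OF V F(4)])
  qed
  have piF: "\<pi> \<in> F" unfolding \<pi>_def by (intro fD F)
  have pi0: "\<pi> \<noteq> 0" using u0 by (simp add: \<pi>_def)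
  interpret valuation_class C F \<V> \<pi>
    using C F \<V> pi piF pi0 by unfold_locales auto
  show "valuation_class C F \<V> (inverse u)" using valuation_class_axioms by (simp add: \<pi>_def)
  have "asym (inverse \<pi>) (- 1) (inverse 1)" by (rule asym_inverse[OF asym_pi])
  then show "valuation_class.asym C F \<V> (inverse u) u (-1) 1" by (simp add: \<pi>_def)
  \<comment> \<open>Unit factors: \<open>t ^ q - t = t * \<rho>1\<close> and
    \<open>u ^ q - u - \<beta> = u ^ q * \<rho>2\<close>. The relation becomes
    \<open>t = \<pi> ^ q / (\<rho>1 * \<rho>2)\<close>, which gives \<open>t\<close> order
    \<open>q\<close>.\<close>
  define \<rho>1 \<rho>2 where "\<rho>1 = t ^ (q - 1) - 1" and "\<rho>2 = 1 - \<pi> ^ (q - 1) - \<beta> * \<pi> ^ q"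
  have "asym \<rho>1 0 (-1)"
  proof (rule asym_perturb)
    show "-1 \<in> C" "\<rho>1 \<in> F" unfolding \<rho>1_def by (intro cD fD sF)+
    show "\<rho>1 - - 1 \<in> nonunits V" if "V \<in> \<V>" for V
      using nonunits_power[of F V t "q - 1"] \<V>[OF that] q by (simp add: \<rho>1_def)
  qed simp
  moreover have "asym \<rho>2 0 1"
  proof (rule asym_perturb)
    show "1 \<in> C" "\<rho>2 \<in> F" unfolding \<rho>2_def using \<beta> sF(2) piF by (intro cD fD; auto)+
    show "\<rho>2 - 1 \<in> nonunits V" if W: "V \<in> \<V>" for V
    proof -
      note v = V[OF W]
      have "- (\<pi> ^ (q - 1) + \<pi> ^ q * \<beta>) \<in> nonunits V"
        using q \<beta> CV[OF W]
        by (intro nonunits_uminus[OF v] nonunits_add[OF v sF(1)] nonunits_mult(1)[OF v] nonunits_power[OF v pi[OF W]]) auto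
      then show ?thesis by (simp add: \<rho>2_def mult.commute)
    qed
  qed simp
  ultimately have "asym (\<pi> ^ q / (\<rho>1 * \<rho>2)) (int q * 1 - (0 + 0)) (1 ^ q / (- 1 * 1))"
    by (intro asym_divide asym_mult asym_power asym_pi)
  moreover have "\<pi> ^ q / (\<rho>1 * \<rho>2) = t"
  proof -
    have tt: "t * \<rho>1 = t ^ q - t" using q by (cases q) (auto simp: \<rho>1_def algebra_simps)
    have uu: "u ^ q = u * u ^ (q - 1)" using q by (cases q) auto
    have up: "u ^ i * \<pi> ^ i = 1" for i using u0 by (simp add: \<pi>_def flip: power_mult_distrib)
    have "u ^ q * \<rho>2 = u ^ q - u * (u ^ (q - 1) * \<pi> ^ (q - 1)) - \<beta> * (u ^ q * \<pi> ^ q)"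
      unfolding \<rho>2_def by (simp add: right_diff_distrib uu)
    also have "\<dots> = u ^ q - u - \<beta>" unfolding up by simp
    finally have "u ^ q * \<rho>2 = u ^ q - u - \<beta>" .
    then have "t * \<rho>1 * (u ^ q * \<rho>2) = 1" using rel tt by simp
    then have "u ^ q * (t * (\<rho>1 * \<rho>2)) = 1" by (simp add: algebra_simps)
    moreover from this have "\<rho>1 * \<rho>2 \<noteq> 0" by auto
    ultimately show ?thesis using u0 by (simp add: \<pi>_def field_simps)
  qed
  ultimately show "valuation_class.asym C F \<V> (inverse u) t (int q) (-1)" by (simp add: \<pi>_def)
qed

text \<open>
  A pole of order \<open>2 q + 1\<close> at infinity: the place is totally ramified, and \<open>w\<^sup>2 / u\<close> is a
  uniformiser because \<open>(2 q + 1) - 2 q = 1\<close>.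
\<close>

lemma ramified_infinity:
  fixes w u \<beta> :: "'b::field"
  assumes C: "is_subfield C" and F: "is_subfield F" "C \<subseteq> F" "w \<in> F" "u \<in> F" and \<beta>: "\<beta> \<in> C" and q: "q \<ge> 2"
    and rel: "u ^ q - u = w ^ (2 * q + 1) + w ^ (q + 2) + \<beta>" and w0: "w \<noteq> 0" and u0: "u \<noteq> 0"
    and ne: "\<V> \<noteq> {}"
    and \<V>: "\<And>V. V \<in> \<V> \<Longrightarrow> is_valring F V \<and> C \<subseteq> V \<and> inverse w \<in> nonunits V"
  shows "valuation_class C F \<V> (w\<^sup>2 / u)"
    "valuation_class.asym C F \<V> (w\<^sup>2 / u) w (- int q) 1"
    "valuation_class.asym C F \<V> (w\<^sup>2 / u) u (- int (2 * q + 1)) 1"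
proof -
  note cD = is_subfieldD[OF C] and fD = is_subfieldD[OF F(1)] and sF = F
  define \<pi> where "\<pi> = w\<^sup>2 / u"
  define t where "t = inverse w"
  \<comment> \<open>The two sides of the equation with their dominant monomials split off, namely
    \<open>w ^ (2 * q + 1) * \<rho>0\<close> and \<open>u ^ q * \<rho>1\<close>; both factors are
    congruent to \<open>1\<close>.\<close>
  define \<rho>0 \<rho>1 where "\<rho>0 = 1 + t ^ (q - 1) + \<beta> * t ^ (2 * q + 1)" and "\<rho>1 = 1 - inverse u ^ (q - 1)"
  have tF: "t \<in> F" unfolding t_def by (intro fD F)
  have t0: "t \<noteq> 0" using w0 by (simp add: t_def)
  have wt: "w ^ i * t ^ i = 1" for i using w0 by (simp add: t_def flip: power_mult_distrib)
  have rho0: "u ^ q - u = w ^ (2 * q + 1) * \<rho>0"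
  proof -
    have w1: "w ^ (2 * q + 1) = w ^ (q + 2) * w ^ (q - 1)"
      using q by (subst power_add[symmetric]) (rule arg_cong[where f = "\<lambda>n. w ^ n"], simp)
    have "w ^ (2 * q + 1) * \<rho>0 = w ^ (2 * q + 1) + w ^ (2 * q + 1) * t ^ (q - 1) + \<beta> * (w ^ (2 * q + 1) * t ^ (2 * q + 1))"
      unfolding \<rho>0_def by (simp only: distrib_left mult.right_neutral mult.left_commute)
    also have "w ^ (2 * q + 1) * t ^ (q - 1) = w ^ (q + 2)"
      unfolding w1 mult.assoc wt by simp
    finally show ?thesis unfolding rel wt by simp
  qed
  have rho1: "u ^ q - u = u ^ q * \<rho>1"
  proof -
    have "u ^ q = u * u ^ (q - 1)" using q by (cases q) auto
    then show ?thesis using u0 by (simp add: \<rho>1_def right_diff_distrib power_inverse)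
  qed
  \<comment> \<open>Since \<open>\<pi> ^ q * u ^ q = w ^ (2 * q)\<close>, one factor
    \<open>inverse w\<close> remains. So \<open>\<pi> ^ q\<close> is a nonunit, and therefore
    \<open>\<pi>\<close> is one.\<close>
  have rho: "\<pi> ^ q * \<rho>0 = t * \<rho>1"
  proof -
    have "w ^ (2 * q + 1) * \<rho>0 = u ^ q * \<rho>1" using rho0 rho1 by simp
    moreover have "\<pi> ^ q * u ^ q = w ^ (2 * q)" using u0 by (simp add: \<pi>_def power_divide flip: power_mult)
    ultimately have "u ^ q * (\<pi> ^ q * \<rho>0) * w = u ^ q * \<rho>1"
      by (simp add: mult.commute mult.left_commute)
    then show ?thesis using u0 w0 by (simp add: t_def field_simps)
  qed
  have r0: "\<rho>0 - 1 \<in> nonunits V" and r1: "\<rho>1 - 1 \<in> nonunits V" and pi: "\<pi> \<in> nonunits V" if W: "V \<in> \<V>" for V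
  proof -
    have V: "is_valring F V" and CV: "C \<subseteq> V" and t: "t \<in> nonunits V" using \<V>[OF W] by (auto simp: t_def)
    note vD = is_valring_subringD[OF V]
    have "t ^ (q - 1) + t ^ (2 * q + 1) * \<beta> \<in> nonunits V"
      using q \<beta> CV by (intro nonunits_add[OF V F(1)] nonunits_mult(1)[OF V] nonunits_power[OF V t]) auto
    then show r0: "\<rho>0 - 1 \<in> nonunits V" by (simp add: \<rho>0_def mult.commute)
    have unit: "\<rho> \<notin> nonunits V" if "\<rho> - 1 \<in> nonunits V" for \<rho>
    proof
      assume "\<rho> \<in> nonunits V"
      then have "\<rho> - (\<rho> - 1) \<in> nonunits V" using that by (rule nonunits_diff[OF V F(1)])
      then show False using one_notin_nonunits[OF V] by simp
    qed
    have "u \<notin> V"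
    proof
      assume u: "u \<in> V"
      have "t ^ (2 * q + 1) * (u ^ q - u) \<in> nonunits V"
        by (intro nonunits_mult(1)[OF V] nonunits_power[OF V t] vD u) simp
      moreover have "t ^ (2 * q + 1) * (u ^ q - u) = (w ^ (2 * q + 1) * t ^ (2 * q + 1)) * \<rho>0"
        unfolding rho0 by (simp only: mult_ac)
      ultimately show False unfolding wt using unit[OF r0] by simp
    qed
    then have "inverse u \<in> nonunits V" by (rule inverse_in_nonunits[OF V F(4)])
    then have "- (inverse u ^ (q - 1)) \<in> nonunits V"
      using q by (intro nonunits_uminus[OF V] nonunits_power[OF V]) auto
    then show r1: "\<rho>1 - 1 \<in> nonunits V" by (simp add: \<rho>1_def)
    have rV: "\<rho> \<in> V" if "\<rho> - 1 \<in> nonunits V" for \<rho>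
      using vD(6)[of "\<rho> - 1" 1] that nonunits_subset vD(1) by auto
    have "t * \<rho>1 \<in> nonunits V" by (intro nonunits_mult(1)[OF V t] rV r1)
    then have *: "\<pi> ^ q * \<rho>0 \<in> nonunits V" unfolding rho .
    have "inverse \<rho>0 \<in> V" "\<rho>0 \<noteq> 0" using rV[OF r0] unit[OF r0] zero_in_nonunits[OF V] by (auto simp: nonunits_def)
    then have "\<pi> ^ q * \<rho>0 * inverse \<rho>0 \<in> nonunits V" by (intro nonunits_mult(1)[OF V *])
    then have "\<pi> ^ q \<in> nonunits V" using \<open>\<rho>0 \<noteq> 0\<close> by (simp add: mult.assoc)
    moreover have "\<pi> \<in> F" unfolding \<pi>_def by (intro fD F)
    ultimately show "\<pi> \<in> nonunits V" using nonunits_powerD[OF V] by blast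
  qed
  have piF: "\<pi> \<in> F" unfolding \<pi>_def by (intro fD F)
  have pi0: "\<pi> \<noteq> 0" using u0 w0 by (simp add: \<pi>_def)
  interpret valuation_class C F \<V> \<pi>
    using C F \<V> pi piF pi0 by unfold_locales auto
  show "valuation_class C F \<V> (w\<^sup>2 / u)" using valuation_class_axioms by (simp add: \<pi>_def)
  have "asym \<rho>0 0 1"
  proof (rule asym_perturb[OF cD(1) _ _ r0])
    show "\<rho>0 \<in> F" unfolding \<rho>0_def using \<beta> sF(2) tF by (intro fD) auto
  qed simp_all
  moreover have "asym \<rho>1 0 1"
  proof (rule asym_perturb[OF cD(1) _ _ r1])
    show "\<rho>1 \<in> F" unfolding \<rho>1_def using sF by (intro fD) auto
  qed simp_all
  moreover have quot: "inverse (\<pi> ^ q * \<rho>0 / \<rho>1) = w"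
  proof -
    \<comment> \<open>This is where the family must be nonempty: a member shows that
      \<open>\<rho>1\<close> is not zero.\<close>
    obtain V where V: "V \<in> \<V>" using ne by blast
    have "\<rho>1 \<noteq> 0"
    proof
      assume "\<rho>1 = 0"
      have v: "is_valring F V" using \<V>[OF V] by blast
      show False using nonunits_uminus[OF v r1[OF V]] one_notin_nonunits[OF v] by (simp add: \<open>\<rho>1 = 0\<close>)
    qed
    then show ?thesis unfolding rho by (simp add: t_def)
  qed
  ultimately have "asym (inverse (\<pi> ^ q * \<rho>0 / \<rho>1)) (- (int q * 1 + 0 - 0)) (inverse (1 ^ q * 1 / 1))"
    by (intro asym_inverse asym_divide asym_mult asym_power asym_pi)
  then have w: "asym w (- int q) 1" unfolding quot by simp
  then show "valuation_class.asym C F \<V> (w\<^sup>2 / u) w (- int q) 1" by (simp add: \<pi>_def)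
  have "asym (w ^ 2 / \<pi>) (int 2 * (- int q) - 1) (1 ^ 2 / 1)"
    by (intro asym_divide asym_power asym_pi w)
  moreover have "w ^ 2 / \<pi> = u" using w0 by (simp add: \<pi>_def)
  moreover have "int 2 * (- int q) - 1 = - int (2 * q + 1)" by simp
  ultimately have "asym u (- int (2 * q + 1)) 1" by (simp only: power_one div_by_1)
  then show "valuation_class.asym C F \<V> (w\<^sup>2 / u) u (- int (2 * q + 1)) 1" by (simp only: \<pi>_def)
qed

section \<open>Counting the places of an Artin-Schreier extension\<close>

text \<open>\<open>C\<close> is the finite constant field of the places and \<open>CL\<close> the
  field of all constants of the closure. The auxiliary rings contain \<open>CL\<close>: for them
  \<open>centred\<close> is an existence statement and \<open>ord\<close> is the rank one
  property.\<close>

locale curve_base =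
  fixes C CL :: "'b::field set" and q :: nat and w :: 'b
  assumes C: "is_subfield C" and CL: "is_subfield CL" and C_CL: "C \<subseteq> CL" and q: "q \<ge> 2"
    and frob: "\<And>x y :: 'b. (x - y) ^ q = x ^ q - y ^ q"
    and w: "w \<notin> CL"
    and ord: "\<And>V w0 z. is_valring UNIV V \<Longrightarrow> CL \<subseteq> V \<Longrightarrow> w0 \<in> CL \<Longrightarrow> w - w0 \<in> nonunits V \<Longrightarrow> z \<noteq> 0 \<Longrightarrow>
      \<exists>k. z / (w - w0) ^ k \<notin> V"
    and centred: "\<And>t. t \<notin> CL \<Longrightarrow> \<exists>V. is_valring UNIV V \<and> CL \<subseteq> V \<and> t \<in> nonunits V"

text \<open>Independence of the powers of \<open>u\<close> below \<open>q\<close> over the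
  polynomials in \<open>w\<close> takes the place of irreducibility of the equation.\<close>

locale smooth_curve = curve_base C CL q w
  for C CL :: "'b::field set" and q :: nat and w :: 'b +
  fixes u :: 'b and h g :: "'b poly"
  assumes h: "coeffs_in C h" and g: "coeffs_in C g" and rel: "poly h w * (u ^ q - u) = poly g w"
    and hw: "poly h w \<noteq> 0"
    and indep: "\<And>R. coeffs_in2 CL R \<Longrightarrow> Polynomial.degree R < q \<Longrightarrow> eval2 R w u = 0 \<Longrightarrow> R = 0"
begin

abbreviation "F \<equiv> frac_field C w u"

lemmas subC = is_subfieldD(11)[OF C] and subCL = is_subfieldD(11)[OF CL]

lemma F: "is_subfield F" "C \<subseteq> F" "w \<in> F" "u \<in> F"
  by (rule is_subfield_frac_field[OF subC] frac_field_gens[OF subC])+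

definition smooth :: "'b \<Rightarrow> 'b \<Rightarrow> 'b set set" where
  "smooth w0 u0 = {V. is_valring F V \<and> C \<subseteq> V \<and> w - w0 \<in> nonunits V \<and> u - u0 \<in> nonunits V}"

text \<open>\<open>poly h w0\<close> being nonzero is the smoothness condition: the cofactor of
  \<open>u - u0\<close> in the equation has value \<open>- poly h w0\<close> at the point.\<close>

definition point :: "'b \<Rightarrow> 'b \<Rightarrow> bool" where
  "point w0 u0 \<longleftrightarrow> poly h w0 \<noteq> 0 \<and> poly h w0 * (u0 ^ q - u0) = poly g w0"

text \<open>Reduced below degree \<open>q\<close>, a relation at the generic point becomes the zero
  polynomial by independence. Evaluating the same reduction at \<open>(w0, u0)\<close>, where
  \<open>h\<close> is nonzero, gives the claim.\<close>

lemma relation_at_point: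
  assumes pt: "point w0 u0" and Q: "coeffs_in2 CL Q" and zero: "eval2 Q w u = 0"
  shows "eval2 Q w0 u0 = 0"
proof -
  have hg: "coeffs_in CL h" "coeffs_in CL g" using h g C_CL by (auto simp: coeffs_in_def)
  obtain N R where R: "coeffs_in2 CL R" "Polynomial.degree R < q"
    and *: "\<forall>w u. poly h w * (u ^ q - u) = poly g w \<longrightarrow> poly h w ^ N * eval2 Q w u = eval2 R w u"
    using reduce_degree[OF subCL hg q Q] by (elim exE conjE)
  have "eval2 R w u = 0" using * rel zero by fastforce
  then have "R = 0" using indep R by blast
  then have "poly h w0 ^ N * eval2 Q w0 u0 = 0" using *[rule_format, of w0 u0] pt by (simp add: point_def)
  then show ?thesis using pt by (simp add: point_def)
qed

lemma ex_valring_at_point: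
  assumes pt: "point w0 u0" and w0: "w0 \<in> CL" and u0: "u0 \<in> CL"
  shows "\<exists>V. is_valring UNIV V \<and> CL \<subseteq> V \<and> w - w0 \<in> nonunits V \<and> u - u0 \<in> nonunits V"
proof -
  note CI = coeffs_in2_intros[OF subCL] coeffs_in2_map_const[OF subCL]
  have "\<exists>V. is_valring UNIV V \<and> (\<lambda>Q. eval2 Q w u) ` {Q. coeffs_in2 CL Q} \<subseteq> V \<and>
      (\<lambda>Q. eval2 Q w u) ` {Q \<in> {Q. coeffs_in2 CL Q}. eval2 Q w0 u0 = 0} \<subseteq> nonunits V"
  proof (rule ex_valring_of_hom[OF coeffs_in_is_subring[OF coeffs_in_is_subring[OF subCL]], where g = "\<lambda>Q. eval2 Q w0 u0"])
    show "eval2 Q w0 u0 = 0" if "Q \<in> {Q. coeffs_in2 CL Q}" "eval2 Q w u = 0" for Q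
      using relation_at_point[OF pt] that by simp
  qed simp_all
  then obtain V where V: "is_valring UNIV V" "\<And>Q. coeffs_in2 CL Q \<Longrightarrow> eval2 Q w u \<in> V"
    and N: "\<And>Q. coeffs_in2 CL Q \<Longrightarrow> eval2 Q w0 u0 = 0 \<Longrightarrow> eval2 Q w u \<in> nonunits V"
    by blast
  have "c \<in> V" if "c \<in> CL" for c
  proof -
    have "coeffs_in2 CL [:[:c:]:]" using that CI by (simp add: coeffs_in_const[OF subCL])
    then show ?thesis using V(2)[of "[:[:c:]:]"] by simp
  qed
  moreover have "w - w0 \<in> nonunits V"
  proof -
    have "coeffs_in CL [:- w0, 1:]"
      using w0 is_subfieldD(1,5)[OF CL] coeffs_in_0[OF subCL] by (simp add: coeffs_in_pCons_iff[OF subCL])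
    then show ?thesis using N[of "[:[:- w0, 1:]:]"] CI by simp
  qed
  moreover have "u - u0 \<in> nonunits V"
  proof -
    have "coeffs_in2 CL [:[:- u0:], 1:]"
      using u0 is_subfieldD(5)[OF CL] coeffs_in_1[OF subCL] CI
      by (simp add: coeffs_in2_pCons_iff[OF subCL] coeffs_in_const[OF subCL])
    then show ?thesis using N[of "[:[:- u0:], 1:]"] by simp
  qed
  ultimately show ?thesis using V(1) by blast
qed

text \<open>The one ring \<open>V0\<close> has two tasks: its trace on \<open>F\<close> shows that
  the class is nonempty, and its rank one property makes the expansion at the point
  terminate.\<close>

lemma
  assumes pt: "point w0 u0" and w0: "w0 \<in> C" and u0: "u0 \<in> C"
  shows smooth_nonempty: "smooth w0 u0 \<noteq> {}"
    and smooth_rational: "V \<in> smooth w0 u0 \<Longrightarrow> is_rational_valring F C V"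
    and smooth_unique: "V \<in> smooth w0 u0 \<Longrightarrow> V' \<in> smooth w0 u0 \<Longrightarrow> V = V'"
proof -
  obtain V0 where V0: "is_valring UNIV V0" "CL \<subseteq> V0" "w - w0 \<in> nonunits V0" "u - u0 \<in> nonunits V0"
    using ex_valring_at_point[OF pt] w0 u0 C_CL by blast
  have "w - w0 \<in> F" "u - u0 \<in> F" using F w0 u0 by (auto intro: is_subfieldD(3)[OF F(1)])
  then have "V0 \<inter> F \<in> smooth w0 u0"
    unfolding smooth_def using V0 is_valring_Int[OF V0(1) F(1)] C_CL F(2) by auto
  then show "smooth w0 u0 \<noteq> {}" by blast
  have ww0: "w - w0 \<noteq> 0" using w w0 C_CL by auto
  interpret vc: valuation_class C F "smooth w0 u0" "w - w0"
    using C F \<open>w - w0 \<in> F\<close> ww0 by unfold_locales (auto simp: smooth_def)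
  have all: "z = 0 \<or> (\<exists>k c. vc.asym z k c)" if "z \<in> F" for z
  proof (rule vc.asym_smooth[OF refl w0 u0 refl _ h g q frob rel _ _ V0(1) _ V0(3,4) _ that])
    show "C \<subseteq> V0" using V0(2) C_CL by blast
    show "\<exists>k. z / (w - w0) ^ k \<notin> V0" if "z \<noteq> 0" for z
      using ord[OF V0(1,2) _ V0(3) that] w0 C_CL by blast
  qed (use pt in \<open>auto simp: point_def smooth_def\<close>)
  show "V \<in> smooth w0 u0 \<Longrightarrow> is_rational_valring F C V"
    and "V \<in> smooth w0 u0 \<Longrightarrow> V' \<in> smooth w0 u0 \<Longrightarrow> V = V'"
    using vc.rational_valrings[OF all] by blast+
qed

lemma const_nonunit_eq_0: "is_valring F V \<Longrightarrow> C \<subseteq> V \<Longrightarrow> c \<in> C \<Longrightarrow> c \<in> nonunits V \<Longrightarrow> c = 0"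
  using unit_notin_nonunits[OF _ C] by blast

lemma centre_unique:
  assumes "is_valring F V" "C \<subseteq> V" "a \<in> C" "b \<in> C" "z - a \<in> nonunits V" "z - b \<in> nonunits V"
  shows "a = b"
proof -
  have "(z - b) - (z - a) \<in> nonunits V" by (rule nonunits_diff[OF assms(1) F(1) assms(6,5)])
  moreover have "a - b \<in> C" using assms is_subfieldD(3)[OF C] by blast
  ultimately have "a - b = 0" using const_nonunit_eq_0[OF assms(1,2), of "a - b"] by simp
  then show ?thesis by simp
qed

lemma smooth_disjoint:
  assumes "V \<in> smooth w0 u0" "V \<in> smooth w1 u1" "w0 \<in> C" "u0 \<in> C" "w1 \<in> C" "u1 \<in> C"
  shows "w0 = w1" "u0 = u1"
  using assms centre_unique[of V w0 w1 w] centre_unique[of V u0 u1 u] by (auto simp: smooth_def)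

text \<open>The residues of \<open>w\<close> and \<open>u\<close> are constants by rationality, and
  reducing the equation modulo the maximal ideal shows that they satisfy it.\<close>

lemma smooth_cover:
  assumes V: "is_rational_valring F C V" and wV: "w \<in> V" and uV: "u \<in> V"
  shows "\<exists>w0\<in>C. \<exists>u0\<in>C. V \<in> smooth w0 u0 \<and> poly h w0 * (u0 ^ q - u0) = poly g w0"
proof -
  have v: "is_valring F V" and CV: "C \<subseteq> V" using V by (auto simp: is_rational_valring_def)
  obtain w0 u0 where w0: "w0 \<in> C" "w - w0 \<in> nonunits V" and u0: "u0 \<in> C" "u - u0 \<in> nonunits V"
    using V wV uV unfolding is_rational_valring_def by blast
  note CI = coeffs_in2_intros[OF subC] coeffs_in2_map_const[OF subC]
  define Y where "Y = [:0, 1 :: 'b poly:]"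
  have Y: "coeffs_in2 C Y"
    unfolding Y_def using coeffs_in_0[OF subC] coeffs_in_1[OF subC] CI by (simp add: coeffs_in2_pCons_iff[OF subC])
  define Q where "Q = [:h:] * (Y ^ q - Y) - [:g:]"
  have Q: "coeffs_in2 C Q" unfolding Q_def by (intro CI h g Y)
  have eval: "eval2 Q a b = poly h a * (b ^ q - b) - poly g a" for a b by (simp add: Q_def Y_def)
  note cong = eval2_cong_nonunits[OF v F(1) C CV w0(1) u0(1) w0(2) u0(2) Q]
  have "- eval2 Q w0 u0 \<in> nonunits V" using cong(1) rel by (simp add: eval)
  moreover have "- eval2 Q w0 u0 \<in> C" using cong(2) is_subfieldD(5)[OF C] by blast
  ultimately have "eval2 Q w0 u0 = 0" using const_nonunit_eq_0[OF v CV] by (metis neg_equal_0_iff_equal)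
  then show ?thesis using w0 u0 v CV by (auto simp: smooth_def eval)
qed

text \<open>The affine points are treated once for both curves. The classes \<open>ram\<close> of
  ramified places remain a parameter, and \<open>cover\<close> demands that every other rational
  ring contain \<open>w\<close> and \<open>u\<close> and have its centre away from the zeros of
  \<open>h\<close>.\<close>

lemma card_rational_places_smooth:
  fixes ram :: "'i \<Rightarrow> 'b set set"
  assumes fin: "finite C" "finite T"
    and ram: "\<And>i V. i \<in> T \<Longrightarrow> V \<in> ram i \<Longrightarrow> is_rational_valring F C V" "\<And>i. i \<in> T \<Longrightarrow> ram i \<noteq> {}"
      "\<And>i V V'. i \<in> T \<Longrightarrow> V \<in> ram i \<Longrightarrow> V' \<in> ram i \<Longrightarrow> V = V'"
      "\<And>i j V. i \<in> T \<Longrightarrow> j \<in> T \<Longrightarrow> V \<in> ram i \<Longrightarrow> V \<in> ram j \<Longrightarrow> i = j"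
    and mixed: "\<And>i V w0 u0. i \<in> T \<Longrightarrow> V \<in> ram i \<Longrightarrow> w0 \<in> C \<Longrightarrow> point w0 u0 \<Longrightarrow> V \<notin> smooth w0 u0"
    and cover: "\<And>V. is_rational_valring F C V \<Longrightarrow> V \<notin> (\<Union>i\<in>T. ram i) \<Longrightarrow>
      w \<in> V \<and> u \<in> V \<and> (\<forall>w0\<in>C. w - w0 \<in> nonunits V \<longrightarrow> poly h w0 \<noteq> 0)"
  shows "card (rational_places (subring_struct F) C) = card {(w0, u0). w0 \<in> C \<and> u0 \<in> C \<and> point w0 u0} + card T"
proof -
  define S where "S = {(w0, u0). w0 \<in> C \<and> u0 \<in> C \<and> point w0 u0}"
  define \<C> where "\<C> = case_sum (\<lambda>(w0, u0). smooth w0 u0) ram"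
  have "card (rational_places (subring_struct F) C) = card (S <+> T)"
  proof (rule card_rational_places[OF F(1) C])
    show "is_rational_valring F C V" if "i \<in> S <+> T" "V \<in> \<C> i" for i V
      using that smooth_rational ram(1) by (auto simp: \<C>_def S_def)
    show "\<C> i \<noteq> {}" if "i \<in> S <+> T" for i
      using that smooth_nonempty ram(2) by (auto simp: \<C>_def S_def)
    show "V = V'" if i: "i \<in> S <+> T" and V: "V \<in> \<C> i" "V' \<in> \<C> i" for i V V'
      using i V smooth_unique[of _ _ V V'] ram(3)[of _ V V'] by (cases i) (auto simp: \<C>_def S_def)
    show "i = j" if "i \<in> S <+> T" "j \<in> S <+> T" "V \<in> \<C> i" "V \<in> \<C> j" for i j V
      using that smooth_disjoint mixed ram(4) by (auto simp: \<C>_def S_def)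
    show "\<exists>i\<in>S <+> T. V \<in> \<C> i" if V: "is_rational_valring F C V" for V
    proof (cases "V \<in> (\<Union>i\<in>T. ram i)")
      case True
      then show ?thesis by (auto simp: \<C>_def intro: bexI[of _ "Inr _"])
    next
      case False
      then obtain w0 u0 where "w0 \<in> C" "u0 \<in> C" "V \<in> smooth w0 u0" "point w0 u0"
        using smooth_cover[OF V] cover[OF V False] by (auto simp: point_def smooth_def)
      then show ?thesis by (intro bexI[of _ "Inl (w0, u0)"]) (auto simp: \<C>_def S_def)
    qed
  qed
  moreover have "finite S" by (rule finite_subset[of _ "C \<times> C"]) (auto simp: S_def fin)
  ultimately show ?thesis using fin by (simp add: card_Plus S_def)
qed

end

section \<open>The two curves: simple poles, and a pole at infinity\<close>

context curve_base
begin

lemma frac_field_translate: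
  assumes "a \<in> C"
  shows "frac_field C (w - a) u = frac_field C w u"
proof -
  note sC = is_subfieldD(11)[OF C]
  note F1 = is_subfield_frac_field[OF sC, of w u] frac_field_gens[OF sC, where w = w and u = u]
  note F2 = is_subfield_frac_field[OF sC, of "w - a" u] frac_field_gens[OF sC, where w = "w - a" and u = u]
  show ?thesis
  proof
    show "frac_field C (w - a) u \<subseteq> frac_field C w u"
      using F1 assms by (intro frac_field_least[OF C] is_subfieldD(3)[OF F1(1)]) auto
    have "(w - a) + a \<in> frac_field C (w - a) u"
      using F2 assms by (intro is_subfieldD(6)[OF F2(1)]) auto
    then show "frac_field C w u \<subseteq> frac_field C (w - a) u"
      using F2 by (intro frac_field_least[OF C]) auto
  qed
qed

theorem card_places_simple_poles:
  assumes fin: "finite C" and \<beta>: "\<beta> \<in> C" and eqn: "(w ^ q - w) * (u ^ q - u - \<beta>) = 1"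
    and nosol: "\<And>u0. u0 \<in> C \<Longrightarrow> u0 ^ q - u0 \<noteq> \<beta>"
  shows "card (rational_places (subring_struct (frac_field C w u)) C)
    = card {(w0, u0). w0 \<in> C \<and> u0 \<in> C \<and> (w0 ^ q - w0) * (u0 ^ q - u0 - \<beta>) = 1} + card {w0 \<in> C. w0 ^ q = w0}"
proof -
  note sC = is_subfieldD(11)[OF C]
  \<comment> \<open>If \<open>u\<close> were zero, the equation would make \<open>w ^ q - w\<close>
    a unit at a ring in which \<open>w\<close> is a nonunit.\<close>
  have u0: "u \<noteq> 0"
  proof
    assume "u = 0"
    then have 1: "(w ^ q - w) * (- \<beta>) = 1" using eqn q by (simp add: power_0_left)
    obtain V where V: "is_valring UNIV V" "CL \<subseteq> V" "w \<in> nonunits V" using centred[OF w] by blast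
    have "(w ^ q - w) * (- \<beta>) \<in> nonunits V"
      using q V(2) \<beta> C_CL is_subfieldD(5)[OF CL, of \<beta>]
      by (intro nonunits_mult(1)[OF V(1)] nonunits_diff[OF V(1) is_subfield_UNIV] nonunits_power[OF V(1)] V(3)) auto
    then show False unfolding 1 using one_notin_nonunits[OF V(1)] by simp
  qed
  define h where "h = Polynomial.monom 1 q - [:0, 1 :: 'b:]"
  define g where "g = [:\<beta>:] * h + 1"
  have ph: "poly h a = a ^ q - a" for a by (simp add: h_def poly_monom)
  have pg: "poly g a = \<beta> * (a ^ q - a) + 1" for a by (simp add: g_def ph)
  have h: "coeffs_in C h"
    unfolding h_def using is_subfieldD(1,2)[OF C]
    by (intro coeffs_in_diff[OF sC] coeffs_in_monom[OF sC]) (auto simp: coeffs_in_pCons_iff[OF sC] coeffs_in_0[OF sC])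
  have g: "coeffs_in C g"
    unfolding g_def using \<beta> h
    by (intro coeffs_in_add[OF sC] coeffs_in_mult[OF sC] coeffs_in_1[OF sC]) (auto simp: coeffs_in_const[OF sC])
  have eqn': "poly h w * (u ^ q - u) = poly g w" using eqn by (simp add: ph pg algebra_simps)
  have hw: "poly h w \<noteq> 0" using eqn by (auto simp: ph)
  interpret smooth_curve C CL q w u h g
  proof unfold_locales
    fix R assume R: "coeffs_in2 CL R" "Polynomial.degree R < q" "eval2 R w u = 0"
    show "R = 0"
    proof (rule ccontr)
      assume "R \<noteq> 0"
      \<comment> \<open>Independence is tested at one place above \<open>w = 0\<close>: there
        \<open>w\<close> has order \<open>q\<close> and \<open>u\<close> has order
        \<open>-1\<close>, so a nonzero \<open>R\<close> has a leading term and cannot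
        vanish.\<close>
      obtain V0 where V0: "is_valring UNIV V0" "CL \<subseteq> V0" "w \<in> nonunits V0" using centred[OF w] by blast
      have \<V>: "\<And>V. V \<in> {V0} \<Longrightarrow> is_valring UNIV V \<and> CL \<subseteq> V \<and> w \<in> nonunits V" using V0 by blast
      have \<beta>': "\<beta> \<in> CL" using \<beta> C_CL by blast
      note ram = ramified_simple_pole[OF CL is_subfield_UNIV subset_UNIV UNIV_I UNIV_I \<beta>' q eqn u0 \<V>]
      interpret vc: valuation_class CL UNIV "{V0}" "inverse u" by (rule ram(1))
      have ram_w: "vc.asym w (int q) (- 1)" and ram_u: "vc.asym u (- 1) 1" by (rule ram(2,3); assumption)+
      have "\<exists>k c. vc.asym (eval2 R w u) k c"
        by (rule vc.asym_eval2_ramified[OF ram_w ram_u]) (use q R \<open>R \<noteq> 0\<close> in auto)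
      then show False using vc.asym_nonzero R(3) by blast
    qed
  qed (use h g eqn' hw in auto)
  define ram where "ram w0 = {V. is_valring F V \<and> C \<subseteq> V \<and> w - w0 \<in> nonunits V}" for w0
  \<comment> \<open>Translation by a root of \<open>a ^ q = a\<close> leaves
    \<open>w ^ q - w\<close> unchanged, so each of the poles can be moved to
    \<open>0\<close>.\<close>
  have tw: "(w - a) ^ q - (w - a) = w ^ q - w" if "a ^ q = a" for a
    using that frob[of w a] by simp
  have ram_props: "(V \<in> ram w0 \<longrightarrow> is_rational_valring F C V) \<and> (V \<in> ram w0 \<and> V' \<in> ram w0 \<longrightarrow> V = V') \<and> ram w0 \<noteq> {}"
    if w0: "w0 \<in> C" "w0 ^ q = w0" for w0 V V'
  proof -
    have rel0: "((w - w0) ^ q - (w - w0)) * (u ^ q - u - \<beta>) = 1" unfolding tw[OF w0(2)] by (rule eqn)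
    have wF: "w - w0 \<in> F" using F w0 by (auto intro: is_subfieldD(3)[OF F(1)])
    have \<V>: "\<And>V. V \<in> ram w0 \<Longrightarrow> is_valring F V \<and> C \<subseteq> V \<and> w - w0 \<in> nonunits V" by (auto simp: ram_def)
    note r = ramified_simple_pole[OF C F(1,2) wF F(4) \<beta> q rel0 u0 \<V>]
    interpret vc: valuation_class C F "ram w0" "inverse u" by (rule r(1)) auto
    have "z = 0 \<or> (\<exists>k c. vc.asym z k c)" if z: "z \<in> F" for z
    proof (rule vc.asym_ramified)
      show "F = frac_field C (w - w0) u" using frac_field_translate[OF w0(1)] by simp
      show "vc.asym (w - w0) (int q) (-1)" "vc.asym u (- 1) 1" by (rule r(2,3); assumption)+
      show "poly h (w - w0) * (u ^ q - u) = poly g (w - w0)" using eqn' by (simp add: ph pg tw[OF w0(2)])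
      show "poly h (w - w0) \<noteq> 0" using hw by (simp add: ph tw[OF w0(2)])
    qed (use q h g z in auto)
    from vc.rational_valrings[OF this]
    have "V \<in> ram w0 \<longrightarrow> is_rational_valring F C V" "V \<in> ram w0 \<and> V' \<in> ram w0 \<longrightarrow> V = V'" by blast+
    moreover have "w - w0 \<notin> CL"
      using w w0(1) C_CL is_subfieldD(6)[OF CL, of "w - w0" w0] by auto
    then obtain V0 where V0: "is_valring UNIV V0" "CL \<subseteq> V0" "w - w0 \<in> nonunits V0" using centred by blast
    then have "V0 \<inter> F \<in> ram w0"
      unfolding ram_def using is_valring_Int[OF V0(1) F(1)] C_CL F(2) wF by auto
    ultimately show ?thesis by blast
  qed
  define T where "T = {w0 \<in> C. w0 ^ q = w0}"
  have "card (rational_places (subring_struct F) C) = card {(w0, u0). w0 \<in> C \<and> u0 \<in> C \<and> point w0 u0} + card T"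
  proof (rule card_rational_places_smooth[where ram = ram])
    show "finite C" "finite T" using fin by (simp_all add: T_def)
    fix i V assume i: "i \<in> T"
    then have iC: "i \<in> C" "i ^ q = i" by (simp_all add: T_def)
    show "is_rational_valring F C V" if "V \<in> ram i" using ram_props[OF iC, of V] that by blast
    show "ram i \<noteq> {}" using ram_props[OF iC] by blast
    show "V = V'" if "V \<in> ram i" "V' \<in> ram i" for V' using ram_props[OF iC, of V V'] that by blast
    show "i = j" if "j \<in> T" "V \<in> ram i" "V \<in> ram j" for j
      using centre_unique[of V i j w] that iC by (auto simp: ram_def T_def)
    show "V \<notin> smooth w0 u0" if "V \<in> ram i" "w0 \<in> C" "point w0 u0" for w0 u0
      using centre_unique[of V w0 i w] that iC by (auto simp: smooth_def ram_def point_def ph)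
  next
    fix V assume V: "is_rational_valring F C V" and no: "V \<notin> (\<Union>i\<in>T. ram i)"
    then have v: "is_valring F V" and CV: "C \<subseteq> V" and res: "\<And>z. z \<in> V \<Longrightarrow> \<exists>c\<in>C. z - c \<in> nonunits V"
      by (auto simp: is_rational_valring_def)
    note vD = is_valring_subringD[OF v]
    have inv_rel: "u ^ q - u = \<beta> + inverse (poly h w)" using eqn hw by (simp add: ph field_simps)
    have h0: "poly h w0 \<noteq> 0" if "w0 \<in> C" "w - w0 \<in> nonunits V" for w0
      using no that v CV by (auto simp: T_def ram_def ph)
    have wV: "w \<in> V"
    proof (rule ccontr)
      assume wV: "w \<notin> V"
      define t where "t = inverse w"
      have t: "t \<in> nonunits V" unfolding t_def by (rule inverse_in_nonunits[OF v F(3) wV])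
      have w0: "w \<noteq> 0" using wV vD(2) by auto
      define \<rho> where "\<rho> = 1 - t ^ (q - 1)"
      have tq: "t ^ (q - 1) \<in> nonunits V" using q by (intro nonunits_power[OF v t]) auto
      have "t ^ (q - 1) \<in> V" using tq nonunits_subset by blast
      then have r: "\<rho> \<in> V" unfolding \<rho>_def by (intro vD(1,3))
      have rN: "\<rho> \<notin> nonunits V"
      proof
        assume "\<rho> \<in> nonunits V"
        from nonunits_add[OF v F(1) this tq] show False using one_notin_nonunits[OF v] by (simp add: \<rho>_def)
      qed
      have ir: "inverse \<rho> \<in> V" using r rN by (auto simp: nonunits_def)
      have "poly h w = w ^ q * \<rho>"
      proof -
        have "w ^ q = w * w ^ (q - 1)" using q by (cases q) auto
        then show ?thesis using w0 by (simp add: ph \<rho>_def t_def right_diff_distrib power_inverse)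
      qed
      then have "inverse (poly h w) = t ^ q * inverse \<rho>" by (simp add: t_def power_inverse)
      also have "\<dots> \<in> nonunits V" using q by (intro nonunits_mult(1)[OF v] nonunits_power[OF v t] ir) auto
      finally have ih: "inverse (poly h w) \<in> nonunits V" .
      then have "u ^ q - u \<in> V" unfolding inv_rel using \<beta> CV nonunits_subset by (intro vD) auto
      then have uV: "u \<in> V" by (rule val_integral[OF v F(1) F(4) q])
      then obtain u1 where u1: "u1 \<in> C" "u - u1 \<in> nonunits V" using res by blast
      \<comment> \<open>Modulo the maximal ideal the term \<open>inverse (poly h w)\<close>
        disappears, and the residue \<open>u1\<close> would solve the excluded equation.\<close>
      have "(u - u1) ^ q - (u - u1) - inverse (poly h w) \<in> nonunits V"
        using q by (intro nonunits_diff[OF v F(1)] nonunits_power[OF v] u1 ih) auto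
      also have "(u - u1) ^ q - (u - u1) - inverse (poly h w) = \<beta> - (u1 ^ q - u1)"
        using inv_rel frob[of u u1] by (simp add: algebra_simps)
      finally have "\<beta> - (u1 ^ q - u1) = 0"
        using \<beta> u1 by (intro const_nonunit_eq_0[OF v CV]) (auto intro!: is_subfieldD[OF C])
      then show False using nosol[OF u1(1)] by simp
    qed
    obtain w0 where w0: "w0 \<in> C" "w - w0 \<in> nonunits V" using res[OF wV] by blast
    note cong = poly_cong_nonunits[OF v F(1) C CV w0(1) w0(2) h]
    have "poly h w \<notin> nonunits V"
    proof
      assume "poly h w \<in> nonunits V"
      from nonunits_diff[OF v F(1) this cong(1)] have "poly h w0 \<in> nonunits V" by simp
      then show False using const_nonunit_eq_0[OF v CV cong(2)] h0[OF w0] by blast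
    qed
    then have "inverse (poly h w) \<in> V" using cong(3) by (auto simp: nonunits_def)
    then have "u ^ q - u \<in> V" unfolding inv_rel using \<beta> CV by (intro vD) auto
    then have "u \<in> V" by (rule val_integral[OF v F(1) F(4) q])
    then show "w \<in> V \<and> u \<in> V \<and> (\<forall>w0\<in>C. w - w0 \<in> nonunits V \<longrightarrow> poly h w0 \<noteq> 0)" using wV h0 by blast
  qed
  moreover have "point w0 u0 \<longleftrightarrow> (w0 ^ q - w0) * (u0 ^ q - u0 - \<beta>) = 1" for w0 u0
    by (auto simp: point_def ph pg algebra_simps)
  ultimately show ?thesis by (simp add: T_def)
qed

theorem card_places_pole_at_infinity:
  assumes fin: "finite C" and \<beta>: "\<beta> \<in> C" and eqn: "u ^ q - u = w ^ (2 * q + 1) + w ^ (q + 2) + \<beta>"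
  shows "card (rational_places (subring_struct (frac_field C w u)) C)
    = card {(w0, u0). w0 \<in> C \<and> u0 \<in> C \<and> u0 ^ q - u0 = w0 ^ (2 * q + 1) + w0 ^ (q + 2) + \<beta>} + 1"
proof -
  note sC = is_subfieldD(11)[OF C]
  have w0: "w \<noteq> 0" using w is_subfieldD(2)[OF CL] by auto
  have iw: "inverse w \<notin> CL" using w is_subfieldD(8)[OF CL, of "inverse w"] by auto
  obtain V0 where V0: "is_valring UNIV V0" "CL \<subseteq> V0" "inverse w \<in> nonunits V0" using centred[OF iw] by blast
  \<comment> \<open>With \<open>u = 0\<close> the right-hand side would vanish, although
    \<open>w ^ (2 * q + 1)\<close> dominates it at a pole of \<open>w\<close>.\<close>
  have u0: "u \<noteq> 0"
  proof
    assume "u = 0"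
    then have 0: "w ^ (2 * q + 1) + w ^ (q + 2) + \<beta> = 0" using eqn q by (simp add: power_0_left)
    define t where "t = inverse w"
    have t: "t \<in> nonunits V0" using V0(3) by (simp add: t_def)
    have wt: "w ^ i * t ^ i = 1" for i using w0 by (simp add: t_def flip: power_mult_distrib)
    have te: "t ^ (2 * q + 1) = t ^ (q + 2) * t ^ (q - 1)"
      using q by (subst power_add[symmetric]) (rule arg_cong[where f = "\<lambda>n. t ^ n"], simp)
    have 1: "w ^ (q + 2) * t ^ (2 * q + 1) = t ^ (q - 1)"
      unfolding te mult.assoc[symmetric] wt by simp
    have "(w ^ (2 * q + 1) + w ^ (q + 2) + \<beta>) * t ^ (2 * q + 1) = 1 + (t ^ (q - 1) + t ^ (2 * q + 1) * \<beta>)"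
      unfolding distrib_right 1 wt by (simp only: add.assoc mult.commute)
    then have "1 = - (t ^ (q - 1) + t ^ (2 * q + 1) * \<beta>)" unfolding 0 by (intro eq_neg_iff_add_eq_0[THEN iffD2]) simp
    also have "\<dots> \<in> nonunits V0"
      using q \<beta> V0(2) C_CL
      by (intro nonunits_uminus[OF V0(1)] nonunits_add[OF V0(1) is_subfield_UNIV] nonunits_mult(1)[OF V0(1)]
          nonunits_power[OF V0(1) t]) auto
    finally show False using one_notin_nonunits[OF V0(1)] by simp
  qed
  have co: "coprime (int q) (int (2 * q + 1))"
    by (metis coprime_1_right coprime_int_iff coprime_mult_self_left_iff gcd_add_mult coprime_iff_gcd_eq_1 mult.commute)
  define g where "g = Polynomial.monom 1 (2 * q + 1) + Polynomial.monom 1 (q + 2) + [:\<beta>:]"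
  have pg: "poly g a = a ^ (2 * q + 1) + a ^ (q + 2) + \<beta>" for a by (simp only: g_def poly_add poly_monom) simp
  have g: "coeffs_in C g"
    unfolding g_def using is_subfieldD(1)[OF C] \<beta>
    by (intro coeffs_in_add[OF sC] coeffs_in_monom[OF sC]) (auto simp: coeffs_in_const[OF sC])
  have rel': "poly 1 w * (u ^ q - u) = poly g w" using eqn by (simp add: pg)
  interpret smooth_curve C CL q w u 1 g
  proof unfold_locales
    fix R assume R: "coeffs_in2 CL R" "Polynomial.degree R < q" "eval2 R w u = 0"
    show "R = 0"
    proof (rule ccontr)
      assume "R \<noteq> 0"
      have \<V>: "\<And>V. V \<in> {V0} \<Longrightarrow> is_valring UNIV V \<and> CL \<subseteq> V \<and> inverse w \<in> nonunits V" using V0 by blast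
      have \<beta>': "\<beta> \<in> CL" using \<beta> C_CL by blast
      note ram = ramified_infinity[OF CL is_subfield_UNIV subset_UNIV UNIV_I UNIV_I \<beta>' q eqn w0 u0 insert_not_empty \<V>]
      interpret vc: valuation_class CL UNIV "{V0}" "w\<^sup>2 / u" by (rule ram(1))
      have ram_w: "vc.asym w (- int q) 1" and ram_u: "vc.asym u (- int (2 * q + 1)) 1"
        by (rule ram(2,3); assumption)+
      have "\<exists>k c. vc.asym (eval2 R w u) k c"
        by (rule vc.asym_eval2_ramified[OF ram_w ram_u _ _ co]) (use q R \<open>R \<noteq> 0\<close> in auto)
      then show False using vc.asym_nonzero R(3) by blast
    qed
  qed (use g rel' coeffs_in_1[OF sC] in auto)
  define inf where "inf = {V. is_valring F V \<and> C \<subseteq> V \<and> inverse w \<in> nonunits V}"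
  have iwF: "inverse w \<in> F" by (rule is_subfieldD(8)[OF F(1,3)])
  have inf_ne: "inf \<noteq> {}"
  proof -
    have "V0 \<inter> F \<in> inf"
      unfolding inf_def using V0 is_valring_Int[OF V0(1) F(1)] C_CL F(2) iwF by auto
    then show ?thesis by blast
  qed
  have \<V>: "\<And>V. V \<in> inf \<Longrightarrow> is_valring F V \<and> C \<subseteq> V \<and> inverse w \<in> nonunits V" by (auto simp: inf_def)
  note ram = ramified_infinity[OF C F \<beta> q eqn w0 u0 inf_ne \<V>]
  interpret vc: valuation_class C F inf "w\<^sup>2 / u" by (rule ram(1))
  have all: "z = 0 \<or> (\<exists>k c. vc.asym z k c)" if z: "z \<in> F" for z
  proof (rule vc.asym_ramified[OF refl _ _ _ q co coeffs_in_1[OF sC] g rel' _ z])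
    show "vc.asym w (- int q) 1" "vc.asym u (- int (2 * q + 1)) 1" by (rule ram(2,3); assumption)+
  qed auto
  \<comment> \<open>The unit type indexes the single class of rings at infinity. As
    \<open>h = 1\<close>, no affine centre is exceptional.\<close>
  have "card (rational_places (subring_struct F) C)
      = card {(w0, u0). w0 \<in> C \<and> u0 \<in> C \<and> point w0 u0} + card (UNIV :: unit set)"
  proof (rule card_rational_places_smooth[where ram = "\<lambda>_. inf"])
    show "is_rational_valring F C V" if "V \<in> inf" for V using vc.rational_valrings(1)[OF all that] .
    show "V = V'" if "V \<in> inf" "V' \<in> inf" for V V' using vc.rational_valrings(2)[OF all that] .
    show "V \<notin> smooth w1 u1" if "V \<in> inf" "w1 \<in> C" for V w1 u1
    proof
      assume "V \<in> smooth w1 u1"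
      then have v: "is_valring F V" "C \<subseteq> V" "inverse w \<in> nonunits V" "w - w1 \<in> nonunits V"
        using that by (auto simp: smooth_def inf_def)
      have "w \<in> V"
        using is_valring_subringD(6)[OF v(1), of "w - w1" w1] v that(2) nonunits_subset by auto
      then have "inverse w * w \<in> nonunits V" by (rule nonunits_mult(1)[OF v(1,3)])
      then show False using w0 one_notin_nonunits[OF v(1)] by simp
    qed
    fix V assume V: "is_rational_valring F C V" and no: "V \<notin> (\<Union>i\<in>UNIV :: unit set. inf)"
    then have v: "is_valring F V" and CV: "C \<subseteq> V" by (auto simp: is_rational_valring_def)
    have wV: "w \<in> V" using no inverse_in_nonunits[OF v F(3)] v CV by (auto simp: inf_def)
    then have "poly g w \<in> V" by (intro poly_in_subring[OF sC is_valringD(1)[OF v] CV] g)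
    then have "u ^ q - u \<in> V" using rel' by simp
    then have "u \<in> V" by (rule val_integral[OF v F(1) F(4) q])
    then show "w \<in> V \<and> u \<in> V \<and> (\<forall>w0\<in>C. w - w0 \<in> nonunits V \<longrightarrow> poly 1 w0 \<noteq> 0)" using wV by simp
  qed (use fin inf_ne in auto)
  then show ?thesis by (simp add: point_def pg)
qed

end

section \<open>The function field of the theorem\<close>

text \<open>With \<open>W = w ^ q\<close> the difference is
  \<open>3 W w\<^sup>2 - 3 W\<^sup>2 w\<close>, whose coefficients are \<open>1\<close> in
  characteristic 2. This is the origin of the exponents \<open>2 q + 1\<close> and
  \<open>q + 2\<close>.\<close>

lemma cube_artin_schreier_char_2:
  fixes w :: "'b::comm_ring_1"
  assumes "CHAR('b) = 2"
  shows "(w ^ q - w) ^ 3 - ((w ^ 3) ^ q - w ^ 3) = w ^ (2 * q + 1) + w ^ (q + 2)"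
proof -
  define W where "W = w ^ q"
  have "(of_nat 2 :: 'b) = 0" using assms of_nat_CHAR by metis
  then have 2: "(2 :: 'b) = 0" by simp
  have "(W - w) ^ 3 - (W ^ 3 - w ^ 3) = W ^ 2 * w + W * w ^ 2 + 2 * (W * w ^ 2 - 2 * (W ^ 2 * w))"
    by (simp add: power2_eq_square power3_eq_cube algebra_simps)
  also have "\<dots> = W ^ 2 * w + W * w ^ 2" unfolding 2 by simp
  finally show ?thesis
    by (simp add: W_def mult.commute power_add flip: power_mult) (simp add: power2_eq_square mult.commute mult.left_commute)
qed

context
  fixes p r :: nat
  assumes card: "CARD('a::{field, finite}) = p ^ r" and p: "Factorial_Ring.prime p"
begin

text \<open>The pairs are sorted by \<open>x = w ^ q - w\<close>. Over each admissible
  \<open>x\<close> there are \<open>q\<close> choices of \<open>w\<close> and independently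
  \<open>q\<close> of \<open>v\<close>. The predicate \<open>P\<close> expresses
  \<open>x \<noteq> 0\<close> for \<open>d = -1\<close> and is \<open>True\<close> for
  \<open>d = 3\<close>.\<close>

lemma card_artin_schreier_pairs:
  fixes f :: "'a alg_closure \<Rightarrow> 'a alg_closure"
  assumes n: "n \<ge> 1" and f: "\<And>x. x \<in> GF_ext n \<Longrightarrow> f x \<in> GF_ext n"
  shows "card {(w, v). w \<in> GF_ext n \<and> v \<in> GF_ext n \<and> P (w ^ CARD('a) - w) \<and> v ^ CARD('a) - v = f (w ^ CARD('a) - w)}
    = CARD('a)\<^sup>2 * card {x \<in> GF_ext n. tr n x = 0 \<and> P x \<and> tr n (f x) = 0}"
proof -
  note K = is_subfieldD[OF is_subfield_GF_ext[OF card p, of n]]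
  note finK = GF_ext_finite(1)[OF card p n]
  define AS where "AS z = {w \<in> GF_ext n. w ^ CARD('a) - w = z}" for z :: "'a alg_closure"
  have AS: "card (AS z) = (if tr n z = 0 then CARD('a) else 0)" if "z \<in> GF_ext n" for z
    unfolding AS_def by (rule card_artin_schreier_GF_ext[OF card p that])
  have finAS: "finite (AS z)" for z using finK by (simp add: AS_def)
  define T where "T = {x \<in> GF_ext n. tr n x = 0 \<and> P x \<and> tr n (f x) = 0}"
  have tr_AS: "tr n (w ^ CARD('a) - w) = 0" if "w \<in> GF_ext n" for w :: "'a alg_closure"
    using tr_artin_schreier[OF card p, of n w] that by (simp add: GF_ext_def)
  have "{(w, v). w \<in> GF_ext n \<and> v \<in> GF_ext n \<and> P (w ^ CARD('a) - w) \<and> v ^ CARD('a) - v = f (w ^ CARD('a) - w)}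
      = snd ` (SIGMA x:T. AS x \<times> AS (f x))" (is "?S = _")
  proof
    show "?S \<subseteq> snd ` (SIGMA x:T. AS x \<times> AS (f x))"
    proof clarify
      fix w v assume wv: "w \<in> GF_ext n" "v \<in> GF_ext n" "P (w ^ CARD('a) - w)" "v ^ CARD('a) - v = f (w ^ CARD('a) - w)"
      then have "w ^ CARD('a) - w \<in> T"
        using tr_AS[OF wv(1)] tr_AS[OF wv(2)] K(3,7) by (simp add: T_def)
      then have "(w ^ CARD('a) - w, w, v) \<in> (SIGMA x:T. AS x \<times> AS (f x))" using wv by (simp add: AS_def)
      then show "(w, v) \<in> snd ` (SIGMA x:T. AS x \<times> AS (f x))" by force
    qed
    show "snd ` (SIGMA x:T. AS x \<times> AS (f x)) \<subseteq> ?S" by (auto simp: AS_def T_def)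
  qed
  moreover have "inj_on snd (SIGMA x:T. AS x \<times> AS (f x))"
    by (rule inj_onI) (auto simp: AS_def)
  ultimately have "card ?S = card (SIGMA x:T. AS x \<times> AS (f x))" by (simp add: card_image)
  also have "\<dots> = (\<Sum>x\<in>T. card (AS x \<times> AS (f x)))"
    using finK finAS by (intro card_SigmaI) (auto simp: T_def)
  also have "\<dots> = (\<Sum>x\<in>T. CARD('a)\<^sup>2)"
  proof (rule sum.cong)
    fix x assume "x \<in> T"
    then show "card (AS x \<times> AS (f x)) = CARD('a)\<^sup>2"
      using AS[of x] AS[OF f, of x] by (simp add: T_def card_cartesian_product power2_eq_square)
  qed simp
  finally show ?thesis by (simp add: T_def mult.commute)
qed

lemma frobenius_fun_closure:
  fixes x y :: "'a fun_closure"
  shows "(x - y) ^ CARD('a) = x ^ CARD('a) - y ^ CARD('a)"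
proof (rule freshmans_dream_diff)
  have "CHAR('a fun_closure) = p" using CHAR_fun_closure[where ?'a = 'a] CHAR_eq_of_CARD[OF card p] by simp
  then show "Factorial_Ring.prime CHAR('a fun_closure)" "CARD('a) = CHAR('a fun_closure) ^ r"
    using card p by simp_all
qed

lemma curve_base_fun_closure:
  assumes w: "w ^ CARD('a) - w = (x_fun :: 'a fun_closure)"
  shows "curve_base (const_fun ` GF_ext n) const_funs CARD('a) w"
proof unfold_locales
  show "is_subfield (const_fun ` (GF_ext n :: 'a alg_closure set))"
    by (intro is_subfield_image_const_fun is_subfield_GF_ext[OF card p])
  show "is_subfield (const_funs :: 'a fun_closure set)" by (rule is_subfield_const_funs)
  show "CARD('a) \<ge> 2" by (rule CARD_ge_2)
  show "(x - y) ^ CARD('a) = x ^ CARD('a) - y ^ CARD('a)" for x y :: "'a fun_closure"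
    by (rule frobenius_fun_closure)
  show "w \<notin> const_funs"
    using w x_fun_notin_const_funs is_subfieldD(3,7)[OF is_subfield_const_funs] by metis
  show "\<exists>k. z / (w - w0) ^ k \<notin> V"
    if "is_valring UNIV V" "const_funs \<subseteq> V" "w0 \<in> const_funs" "w - w0 \<in> nonunits V" "z \<noteq> 0" for V w0 z
    using order_finite[OF _ w that] CARD_ge_2[where ?'a = 'a] by simp
  show "\<exists>V. is_valring UNIV V \<and> const_funs \<subseteq> V \<and> t \<in> nonunits V" if "t \<notin> const_funs" for t :: "'a fun_closure"
    using ex_valring_centred[OF that] .
qed auto

text \<open>
  With \<open>u = (y_a - y_b) / (a - b)\<close> and \<open>w = y_a - a u\<close>, the two equations become \<open>w ^ q - w = x\<close>
  and \<open>u ^ q - u = \<beta> + x ^ d\<close>.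
\<close>

lemma fun_field_eq:
  fixes a b :: 'a
  assumes ab: "a \<noteq> b"
  shows "\<exists>w u. w ^ CARD('a) - w = x_fun \<and> u ^ CARD('a) - u = const_fun \<beta> + x_fun powi d \<and>
    fun_field a b n d \<beta> = subring_struct (frac_field (const_fun ` GF_ext n) w u)"
proof -
  define C where "C = const_fun ` (GF_ext n :: 'a alg_closure set)"
  have C: "is_subfield C"
    unfolding C_def by (intro is_subfield_image_const_fun is_subfield_GF_ext[OF card p])
  note sC = is_subfieldD(11)[OF C]
  have y: "y_fun d \<beta> e ^ CARD('a) - y_fun d \<beta> e = x_fun + const_fun (to_ac e) * (const_fun \<beta> + x_fun powi d)" for e :: 'a
    unfolding y_fun_def by (rule someI_ex) (rule ex_artin_schreier_root[OF CARD_ge_2])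
  define A B where "A = const_fun (to_ac a)" and "B = const_fun (to_ac b)"
  define ya yb where "ya = y_fun d \<beta> a" and "yb = y_fun d \<beta> b"
  define u where "u = (ya - yb) / (A - B)"
  define w where "w = ya - A * u"
  have AC: "A \<in> C" and BC: "B \<in> C" using to_ac_in_GF_ext[OF card p] by (auto simp: A_def B_def C_def)
  have AB: "A - B \<noteq> 0" using ab by (simp add: A_def B_def)
  have Aq: "A ^ CARD('a) = A" and ABq: "(A - B) ^ CARD('a) = A - B"
    by (simp_all add: A_def B_def power_CARD_eq flip: const_fun_simps to_ac_power to_ac_diff)
  note frob = frobenius_fun_closure
  \<comment> \<open>Together with the analogous formula for \<open>yb\<close> this inverts the
    change of generators, as needed for equality of the two fields.\<close>
  have ya: "ya = w + A * u" by (simp add: w_def)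
  have yb: "yb = w + B * u"
  proof -
    have "(A - B) * u = ya - yb" using AB by (simp add: u_def)
    then show ?thesis by (simp add: w_def algebra_simps)
  qed
  have ueq: "u ^ CARD('a) - u = const_fun \<beta> + x_fun powi d"
  proof -
    have "u ^ CARD('a) - u = ((ya ^ CARD('a) - ya) - (yb ^ CARD('a) - yb)) / (A - B)"
    proof -
      have "u ^ CARD('a) = (ya ^ CARD('a) - yb ^ CARD('a)) / (A - B)"
        unfolding u_def power_divide ABq by (simp only: frob)
      then show ?thesis by (simp add: u_def diff_divide_distrib)
    qed
    also have "\<dots> = const_fun \<beta> + x_fun powi d"
      unfolding ya_def yb_def y A_def[symmetric] B_def[symmetric]
      using AB by (simp add: divide_eq_eq) (simp add: algebra_simps)
    finally show ?thesis .
  qed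
  have weq: "w ^ CARD('a) - w = x_fun"
  proof -
    have "w ^ CARD('a) - w = (ya ^ CARD('a) - ya) - A * (u ^ CARD('a) - u)"
      by (simp add: w_def frob power_mult_distrib Aq algebra_simps)
    also have "\<dots> = x_fun" unfolding ueq unfolding ya_def y A_def by simp
    finally show ?thesis .
  qed
  define S where "S = C \<union> {x_fun, ya, yb}"
  note G = is_subfieldD[OF is_subfield_generate_field[of S]]
  note F = is_subfieldD[OF is_subfield_frac_field[OF sC, of w u]]
  note FG = frac_field_gens[OF sC, where w = w and u = u]
  have H: "z \<in> generate_field ring_of_type_algebra S" if "z \<in> S" for z
    by (rule generate_field.incl[OF that])
  have "generate_field ring_of_type_algebra S = frac_field C w u"
  proof
    show "generate_field ring_of_type_algebra S \<subseteq> frac_field C w u"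
    proof (rule generate_field_least[OF is_subfield_frac_field[OF sC]])
      have "x_fun \<in> frac_field C w u" unfolding weq[symmetric] by (intro F(3,7) FG)
      moreover have "ya \<in> frac_field C w u" unfolding ya using AC FG(1) by (intro F(4,6) FG) auto
      moreover have "yb \<in> frac_field C w u" unfolding yb using BC FG(1) by (intro F(4,6) FG) auto
      ultimately show "S \<subseteq> frac_field C w u" using FG(1) by (auto simp: S_def)
    qed
    have AG: "A \<in> generate_field ring_of_type_algebra S" "B \<in> generate_field ring_of_type_algebra S"
      and yG: "ya \<in> generate_field ring_of_type_algebra S" "yb \<in> generate_field ring_of_type_algebra S"
      using AC BC by (intro H; simp add: S_def)+
    have uG: "u \<in> generate_field ring_of_type_algebra S"
      unfolding u_def by (intro G(3,9) AG yG)
    then have wG: "w \<in> generate_field ring_of_type_algebra S"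
      unfolding w_def by (rule G(3)[OF yG(1) G(4)[OF AG(1)]])
    have "C \<subseteq> generate_field ring_of_type_algebra S" by (intro subsetI H) (simp add: S_def)
    then show "frac_field C w u \<subseteq> generate_field ring_of_type_algebra S"
      by (rule frac_field_least[OF C is_subfield_generate_field _ wG uG])
  qed
  then have "fun_field a b n d \<beta> = subring_struct (frac_field C w u)"
    by (simp add: fun_field_def S_def C_def ya_def yb_def)
  then show ?thesis using weq ueq by (auto simp: C_def)
qed

lemma card_image_const_fun_pairs:
  "card {(w, v). w \<in> const_fun ` K \<and> v \<in> const_fun ` K \<and> R w v}
    = card {(w, v). w \<in> K \<and> v \<in> K \<and> R (const_fun w :: 'a fun_closure) (const_fun v)}"
proof -
  have "{(w, v). w \<in> const_fun ` K \<and> v \<in> const_fun ` K \<and> R w v}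
      = map_prod const_fun const_fun ` {(w, v). w \<in> K \<and> v \<in> K \<and> R (const_fun w) (const_fun v)}"
    by (auto simp: image_iff) 
  then show ?thesis by (simp add: card_image inj_on_def)
qed

context
  fixes a b c :: 'a and n :: nat and \<alpha> :: "'a alg_closure"
  assumes ab: "a \<noteq> b" and c: "c \<noteq> 0" and n: "n \<ge> 1" and \<alpha>: "\<alpha> \<in> GF_ext n" "tr n \<alpha> = 1"
begin

lemma beta_in_GF_ext: "- \<alpha> * to_ac c \<in> GF_ext n"
  using \<alpha>(1) to_ac_in_GF_ext[OF card p]
  by (intro is_subfieldD(4,5)[OF is_subfield_GF_ext[OF card p]])

lemma tr_beta: "tr n (- \<alpha> * to_ac c) = - to_ac c"
  using tr_uminus[OF card p, of n "to_ac c * \<alpha>"] tr_scale[OF card p, of n c \<alpha>] \<alpha>(2)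
  by (simp add: mult.commute)

text \<open>The reason for the choice of \<open>\<beta>\<close>: its trace is \<open>-c\<close>, so
  the solvability condition for \<open>u\<close> becomes the condition that the trace equals
  \<open>c\<close>.\<close>

lemma tr_beta_add: "tr n (- \<alpha> * to_ac c + z) = 0 \<longleftrightarrow> tr n z = to_ac c"
  unfolding tr_add[OF card p] tr_beta by (auto simp: algebra_simps)

lemma N_places_minus_one:
  "N_places a b n (-1) (- \<alpha> * to_ac c) = CARD('a)\<^sup>2 * H_count c (-1) n + CARD('a)"
proof -
  define \<beta> where "\<beta> = - \<alpha> * to_ac c"
  note K = is_subfieldD[OF is_subfield_GF_ext[OF card p, of n]]
  note finK = GF_ext_finite(1)[OF card p n]
  have \<beta>: "\<beta> \<in> GF_ext n" unfolding \<beta>_def by (rule beta_in_GF_ext)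
  obtain w u where weq: "w ^ CARD('a) - w = x_fun" and ueq: "u ^ CARD('a) - u = const_fun \<beta> + x_fun powi (-1)"
    and F: "fun_field a b n (-1) \<beta> = subring_struct (frac_field (const_fun ` GF_ext n) w u)"
    using fun_field_eq[OF ab] by blast
  interpret curve_base "const_fun ` GF_ext n" const_funs "CARD('a)" w by (rule curve_base_fun_closure[OF weq])
  have "(x_fun :: 'a fun_closure) \<noteq> 0"
    using x_fun_notin_const_funs is_subfieldD(2)[OF is_subfield_const_funs] by metis
  then have eqn: "(w ^ CARD('a) - w) * (u ^ CARD('a) - u - const_fun \<beta>) = 1" unfolding weq ueq by simp
  \<comment> \<open>Values of \<open>v ^ q - v\<close> on \<open>GF_ext n\<close> have trace zero,
    whereas \<open>\<beta>\<close> has trace \<open>-c\<close>, which is not zero.\<close>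
  have nosol: "u0 ^ CARD('a) - u0 \<noteq> const_fun \<beta>" if u0: "u0 \<in> const_fun ` GF_ext n" for u0
  proof
    assume eq: "u0 ^ CARD('a) - u0 = const_fun \<beta>"
    obtain v where v: "v \<in> GF_ext n" "u0 = const_fun v" using u0 by auto
    then have "v ^ CARD('a) - v = \<beta>" using eq by (simp only: v(2) const_fun_simps(9) flip: const_fun_simps(4,7))
    then have "tr n \<beta> = 0" using tr_artin_schreier[OF card p, of n v] v(1) by (simp add: GF_ext_def)
    then show False using c tr_beta unfolding \<beta>_def by simp
  qed
  have "N_places a b n (-1) \<beta>
      = card {(w0, u0). w0 \<in> const_fun ` GF_ext n \<and> u0 \<in> const_fun ` GF_ext n \<and>
          (w0 ^ CARD('a) - w0) * (u0 ^ CARD('a) - u0 - const_fun \<beta>) = 1}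
        + card {w0 \<in> const_fun ` (GF_ext n :: 'a alg_closure set). w0 ^ CARD('a) = w0}"
    unfolding N_places_def F
  proof (rule card_places_simple_poles[OF _ _ eqn])
    show "u0 ^ CARD('a) - u0 \<noteq> const_fun \<beta>" if "u0 \<in> const_fun ` GF_ext n" for u0
      using nosol[OF that] .
  qed (use finK \<beta> in auto)
  also have "{w0 \<in> const_fun ` (GF_ext n :: 'a alg_closure set). w0 ^ CARD('a) = w0} = range (\<lambda>e :: 'a. const_fun (to_ac e))"
    using power_CARD_eq_iff[OF card p] to_ac_in_GF_ext[OF card p] by (auto simp flip: const_fun_simps(7))
  also have "card \<dots> = CARD('a)" by (intro card_image) (simp add: inj_on_def)
  also have "card {(w0, u0). w0 \<in> const_fun ` GF_ext n \<and> u0 \<in> const_fun ` GF_ext n \<and>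
      (w0 ^ CARD('a) - w0) * (u0 ^ CARD('a) - u0 - const_fun \<beta>) = 1}
    = card {(w, v). w \<in> GF_ext n \<and> v \<in> GF_ext n \<and> w ^ CARD('a) - w \<noteq> 0 \<and>
        v ^ CARD('a) - v = \<beta> + inverse (w ^ CARD('a) - w)}"
  proof -
    have "(const_fun w ^ CARD('a) - const_fun w) * (const_fun v ^ CARD('a) - const_fun v - const_fun \<beta>) = 1 \<longleftrightarrow>
        (w ^ CARD('a) - w) * (v ^ CARD('a) - v - \<beta>) = 1" for w v
    proof -
      have "(const_fun w ^ CARD('a) - const_fun w) * (const_fun v ^ CARD('a) - const_fun v - const_fun \<beta>)
          = const_fun ((w ^ CARD('a) - w) * (v ^ CARD('a) - v - \<beta>))" by simp
      moreover have "const_fun z = 1 \<longleftrightarrow> z = 1" for z :: "'a alg_closure"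
        using const_fun_simps(9)[of z 1] by (simp only: const_fun_simps(2))
      ultimately show ?thesis by (simp only:)
    qed
    moreover have "(w ^ CARD('a) - w) * (v ^ CARD('a) - v - \<beta>) = 1 \<longleftrightarrow> w ^ CARD('a) - w \<noteq> 0 \<and>
        v ^ CARD('a) - v = \<beta> + inverse (w ^ CARD('a) - w)" for w v :: "'a alg_closure"
      by (cases "w ^ CARD('a) - w = 0") (auto simp: field_simps)
    ultimately show ?thesis by (simp add: card_image_const_fun_pairs)
  qed
  also have "\<dots> = CARD('a)\<^sup>2 * card {x \<in> GF_ext n. tr n x = 0 \<and> x \<noteq> 0 \<and> tr n (\<beta> + inverse x) = 0}"
    using \<beta> by (intro card_artin_schreier_pairs[OF n]) (auto intro: K)
  \<comment> \<open>The condition \<open>x \<noteq> 0\<close> is automatic on the right: with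
    \<open>0 powi (-1) = 0\<close> the trace would be zero and not \<open>c\<close>.\<close>
  also have "{x \<in> GF_ext n. tr n x = 0 \<and> x \<noteq> 0 \<and> tr n (\<beta> + inverse x) = 0}
      = {x \<in> GF_ext n. tr n x = 0 \<and> tr n (x powi (-1)) = to_ac c}"
    unfolding \<beta>_def tr_beta_add using c by (auto simp: tr_0[OF card p])
  finally show ?thesis by (simp add: H_count_def \<beta>_def)
qed

lemma N_places_three:
  assumes p2: "p = 2"
  shows "N_places a b n 3 (- \<alpha> * to_ac c) = CARD('a)\<^sup>2 * H_count c 3 n + 1"
proof -
  define \<beta> where "\<beta> = - \<alpha> * to_ac c"
  note K = is_subfieldD[OF is_subfield_GF_ext[OF card p, of n]]
  note finK = GF_ext_finite(1)[OF card p n]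
  have \<beta>: "\<beta> \<in> GF_ext n" unfolding \<beta>_def by (rule beta_in_GF_ext)
  have char: "CHAR('a alg_closure) = 2" "CHAR('a fun_closure) = 2"
    using CHAR_fun_closure[where ?'a = 'a] CHAR_eq_of_CARD[OF card p] p2 by simp_all
  obtain w u where weq: "w ^ CARD('a) - w = x_fun" and ueq: "u ^ CARD('a) - u = const_fun \<beta> + x_fun powi 3"
    and F: "fun_field a b n 3 \<beta> = subring_struct (frac_field (const_fun ` GF_ext n) w u)"
    using fun_field_eq[OF ab] by blast
  interpret curve_base "const_fun ` GF_ext n" const_funs "CARD('a)" w by (rule curve_base_fun_closure[OF weq])
  \<comment> \<open>Subtracting \<open>w ^ 3\<close> cancels the term of degree \<open>3 q\<close>,
    which has even degree, and leaves the odd degree \<open>2 q + 1\<close>.\<close>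
  define u' where "u' = u - w ^ 3"
  have eqn: "u' ^ CARD('a) - u' = w ^ (2 * CARD('a) + 1) + w ^ (CARD('a) + 2) + const_fun \<beta>"
  proof -
    have "u' ^ CARD('a) - u' = (u ^ CARD('a) - u) - ((w ^ 3) ^ CARD('a) - w ^ 3)"
      by (simp add: u'_def frobenius_fun_closure)
    also have "\<dots> = const_fun \<beta> + ((w ^ CARD('a) - w) ^ 3 - ((w ^ 3) ^ CARD('a) - w ^ 3))"
      unfolding ueq weq by simp
    also note cube_artin_schreier_char_2[OF char(2), of w "CARD('a)"]
    finally show ?thesis by (simp only: add.commute)
  qed
  have F': "frac_field (const_fun ` GF_ext n) w u' = frac_field (const_fun ` GF_ext n) w u" (is "?F' = ?F")
  proof
    note sC = is_subfieldD(11)[OF C]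
    note F1 = is_subfieldD[OF is_subfield_frac_field[OF sC, of w u]] and G1 = frac_field_gens[OF sC, where w = w and u = u]
    note F2 = is_subfieldD[OF is_subfield_frac_field[OF sC, of w u']] and G2 = frac_field_gens[OF sC, where w = w and u = u']
    have "u' \<in> ?F" unfolding u'_def by (intro F1(3,7) G1)
    then show "?F' \<subseteq> ?F" using G1 by (intro frac_field_least[OF C is_subfield_frac_field[OF sC]])
    have "u' + w ^ 3 \<in> ?F'" by (intro F2(6,7) G2)
    then have "u \<in> ?F'" by (simp add: u'_def)
    then show "?F \<subseteq> ?F'" using G2 by (intro frac_field_least[OF C is_subfield_frac_field[OF sC]])
  qed
  have "N_places a b n 3 \<beta>
      = card {(w0, u0). w0 \<in> const_fun ` GF_ext n \<and> u0 \<in> const_fun ` GF_ext n \<and>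
          u0 ^ CARD('a) - u0 = w0 ^ (2 * CARD('a) + 1) + w0 ^ (CARD('a) + 2) + const_fun \<beta>} + 1"
    unfolding N_places_def F F'[symmetric] using finK \<beta> by (intro card_places_pole_at_infinity[OF _ _ eqn]) auto
  also have "card {(w0, u0). w0 \<in> const_fun ` GF_ext n \<and> u0 \<in> const_fun ` GF_ext n \<and>
          u0 ^ CARD('a) - u0 = w0 ^ (2 * CARD('a) + 1) + w0 ^ (CARD('a) + 2) + const_fun \<beta>}
    = card {(w, v). w \<in> GF_ext n \<and> v \<in> GF_ext n \<and> v ^ CARD('a) - v = w ^ (2 * CARD('a) + 1) + w ^ (CARD('a) + 2) + \<beta>}"
  proof -
    have "const_fun v ^ CARD('a) - const_fun v
          = const_fun w ^ (2 * CARD('a) + 1) + const_fun w ^ (CARD('a) + 2) + const_fun \<beta> \<longleftrightarrow>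
        v ^ CARD('a) - v = w ^ (2 * CARD('a) + 1) + w ^ (CARD('a) + 2) + \<beta>" for w v
    proof -
      have "const_fun v ^ CARD('a) - const_fun v = const_fun (v ^ CARD('a) - v)"
        "const_fun w ^ (2 * CARD('a) + 1) + const_fun w ^ (CARD('a) + 2) + const_fun \<beta>
          = const_fun (w ^ (2 * CARD('a) + 1) + w ^ (CARD('a) + 2) + \<beta>)" by simp_all
      then show ?thesis by (simp only: const_fun_simps(9))
    qed
    then show ?thesis by (simp only: card_image_const_fun_pairs)
  qed
  also have "\<dots> = card {(w, v). w \<in> GF_ext n \<and> v \<in> GF_ext n \<and> True \<and> v ^ CARD('a) - v = \<beta> + (w ^ CARD('a) - w) ^ 3}"
  proof -
    have 1: "(v - w ^ 3) ^ CARD('a) - (v - w ^ 3) = w ^ (2 * CARD('a) + 1) + w ^ (CARD('a) + 2) + \<beta> \<longleftrightarrow>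
        v ^ CARD('a) - v = \<beta> + (w ^ CARD('a) - w) ^ 3" for w v :: "'a alg_closure"
    proof -
      have "(v - w ^ 3) ^ CARD('a) - (v - w ^ 3) = (v ^ CARD('a) - v) - ((w ^ 3) ^ CARD('a) - w ^ 3)"
        using frobenius(2)[OF card p, of v "w ^ 3" 1] by simp
      then show ?thesis
        unfolding cube_artin_schreier_char_2[OF char(1), of w "CARD('a)", symmetric] by (auto simp: algebra_simps)
    qed
    have 2: "v - w ^ 3 \<in> GF_ext n" "v + w ^ 3 \<in> GF_ext n" if "w \<in> GF_ext n" "v \<in> GF_ext n" for w v :: "'a alg_closure"
      using K(3,6,7) that by blast+
    show ?thesis (is "card ?S = card ?T")
    \<comment> \<open>The substitution made for the function field is undone on the points, so that
      the right-hand side depends on \<open>w ^ q - w\<close> alone again.\<close>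
    proof (rule bij_betw_same_card[of "\<lambda>(w, v). (w, v + w ^ 3)"], rule bij_betwI[where g = "\<lambda>(w, v). (w, v - w ^ 3)"])
      show "(\<lambda>(w, v). (w, v + w ^ 3)) \<in> ?S \<rightarrow> ?T" using 2(2) by (auto simp flip: 1)
      show "(\<lambda>(w, v). (w, v - w ^ 3)) \<in> ?T \<rightarrow> ?S" using 2(1) 1 by auto
    qed auto
  qed
  also have "\<dots> = CARD('a)\<^sup>2 * card {x \<in> GF_ext n. tr n x = 0 \<and> True \<and> tr n (\<beta> + x ^ 3) = 0}"
    using \<beta> by (intro card_artin_schreier_pairs[OF n]) (auto intro: K)
  also have "{x \<in> GF_ext n. tr n x = 0 \<and> True \<and> tr n (\<beta> + x ^ 3) = 0}
      = {x \<in> GF_ext n. tr n x = 0 \<and> tr n (x powi 3) = to_ac c}"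
    unfolding \<beta>_def tr_beta_add by simp
  finally show ?thesis by (simp add: H_count_def \<beta>_def)
qed

end

end

theorem theorem4p6:
  fixes a b c :: "'a::{field, finite}"
    and d :: int
    and p r m k s :: nat
  assumes "CARD('a) = p ^ r"
    and "p \<in> {2, 3}"
    and "d \<in> {-1, 3}"
    and "d = 3 \<longrightarrow> p = 2"
    and "a \<noteq> b"
    and "c \<noteq> 0"
    and "m = p ^ k * s"
    and "\<not> p dvd s"
  shows "int (G_count c d m) =
           (\<Sum>t | t dvd s. moebius (s div t) * int (H_count c d (p ^ k * t)))
       \<and> (\<forall>n\<ge>1. \<forall>\<alpha> \<in> GF_ext n. tr n \<alpha> = 1 \<longrightarrow>
           (of_nat (H_count c d n) :: rat) =
             1 / of_nat (CARD('a)) ^ 2 *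
               (of_nat (N_places a b n d (- \<alpha> * to_ac c)) - 1
                + (if d = 3 then 0 else 1 - of_nat (CARD('a)))))"
proof (intro conjI allI impI ballI)
  have p: "Factorial_Ring.prime p" using assms(2) by auto
  show "int (G_count c d m) = (\<Sum>t | t dvd s. moebius (s div t) * int (H_count c d (p ^ k * t)))"
    unfolding assms(7) by (rule G_count_eq_moebius_sum[OF assms(1) p assms(2-4,6,8)])
  fix n :: nat and \<alpha> :: "'a alg_closure"
  assume n: "1 \<le> n" and \<alpha>: "\<alpha> \<in> GF_ext n" "tr n \<alpha> = 1"
  \<comment> \<open>The summand is the number of ramified places, \<open>1\<close> or
    \<open>q\<close>; solving for \<open>H_count\<close> turns it into the correction term.\<close>
  have "(of_nat (N_places a b n d (- \<alpha> * to_ac c)) :: rat)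
      = of_nat (CARD('a)) ^ 2 * of_nat (H_count c d n) + (if d = 3 then 1 else of_nat (CARD('a)))"
    using assms(3,4) N_places_minus_one[OF assms(1) p assms(5,6) n \<alpha>] N_places_three[OF assms(1) p assms(5,6) n \<alpha>]
    by auto
  then show "(of_nat (H_count c d n) :: rat) = 1 / of_nat (CARD('a)) ^ 2 *
      (of_nat (N_places a b n d (- \<alpha> * to_ac c)) - 1 + (if d = 3 then 0 else 1 - of_nat (CARD('a))))"
    by simp
qed

end
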